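(* (i) Let $p$ be an odd prime. Then, as polynomials in $x$, $$\sum_{k=0}^{p-1}(-1)^kA_k(x)\equiv\sum_{k=0}^{p-1}(-1)^kW_k(-x)\equiv\sum_{k=0}^{p-1}\frac{\binom{2k}{k}^3}{16^k}x^k\pmod{p^2}.$$ Also, for any $p$-adic integer $x\not\equiv0\pmod p$, we have $$\sum_{k=0}^{p-1}A_k(x)\equiv\sum_{k=0}^{p-1}W_k(x)\pmod{p^2}$$ and $$\sum_{k=0}^{p-1}A_k(x)\equiv\left(\frac xp\right)\sum_{k=0}^{p-1}\frac{\binom{4k}{k,k,k,k}}{(256x)^k}\pmod{p}.$$ (ii) For any positive integer $n$ we have the polynomial identity $$\frac1n\sum_{k=0}^{n-1}(2k+1)A_k(x)=\sum_{k=0}^{n-1}\binom{n-1}{k}\binom{n+k}{k}\binom{n+k}{2k+1}\binom{2k}{k}x^k.$$ If $p>3$ is a prime, then $$\sum_{k=0}^{p-1}(2k+1)A_k\equiv p+\frac76p^4B_{p-3}\pmod{p^5}$$ and $$\sum_{k=0}^{p-1}(2k+1)A_k(-1)\equiv\left(\frac{-1}p\right)p-p^3E_{p-3}\pmod{p^4}.$$ (iii) Given $\varepsilon\in\{1,-1\}$ and a positive integer $m$, for any prime $p$ we have $$\sum_{k=0}^{p-1}(2k+1)\varepsilon^kA_k^m\equiv0\pmod p.$$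
   Context: For $n\in\{0,1,2,\ldots\}$ define the polynomials $$A_n(x)=\sum_{k=0}^n\binom nk^2\binom{n+k}k^2x^k,\qquad W_n(x)=\sum_{k=0}^n\binom nk^2\binom{n-k}k^2x^k=\sum_{k=0}^{\lfloor n/2\rfloor}\binom n{2k}^2\binom{2k}k^2x^k,$$ and the Apéry numbers $A_n=A_n(1)$. The multinomial coefficient is $\binom{4k}{k,k,k,k}=(4k)!/(k!)^4$. The symbol $\left(\frac{\cdot}{p}\right)$ is the Legendre symbol; for a $p$-adic integer $x$, $\left(\frac xp\right)$ is the Legendre symbol of the residue of $x$ modulo $p$. The Bernoulli numbers are given by $B_0=1$ and $\sum_{k=0}^n\binom{n+1}kB_k=0$ for $n\ge1$. The Euler numbers are given by $E_0=1$ and $\sum_{0\le k\le n,\ 2\mid k}\binom nkE_{n-k}=0$ for $n\ge1$. For rational or $p$-adic numbers $a,b$ and $m\ge1$, $a\equiv b\pmod{p^m}$ means that $(a-b)/p^m$ is a $p$-adic integer; for polynomials in $x$ the congruence is understood coefficientwise. *)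

theory Defs
  imports
    "HOL-Algebra.Ring"
    "HOL-Number_Theory.Number_Theory"
    "HOL-Computational_Algebra.Polynomial"
begin

text \<open>The ring of \<open>p\<close>-adic integers is the inverse limit of the rings of integers modulo \<open>p ^ n\<close>:
  the element \<open>a\<close> is the coherent sequence of its residues \<open>a n\<close> in \<open>{0..<p ^ n}\<close>.
  Coherence in the form \<open>a (Suc n) mod p ^ n = a n\<close> already forces \<open>a n\<close> into that range.
  In particular \<open>a 1\<close> is the residue of \<open>a\<close> modulo \<open>p\<close>.
  The image of an integer \<open>k\<close> in this ring is its \<open>k\<close>-fold multiple of the unit element.\<close>

definition Zp :: "nat \<Rightarrow> (nat \<Rightarrow> int) ring" where
  "Zp p =
    \<lparr> carrier = {a. \<forall>n. a (Suc n) mod int p ^ n = a n},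
      monoid.mult = (\<lambda>a b n. (a n * b n) mod int p ^ n),
      monoid.one = (\<lambda>n. 1 mod int p ^ n),
      ring.zero = (\<lambda>n. 0),
      ring.add = (\<lambda>a b n. (a n + b n) mod int p ^ n) \<rparr>"

lemma Zp_simps:
  "carrier (Zp p) = {a. \<forall>n. a (Suc n) mod int p ^ n = a n}"
  "a \<otimes>\<^bsub>Zp p\<^esub> b = (\<lambda>n. (a n * b n) mod int p ^ n)"
  "\<one>\<^bsub>Zp p\<^esub> = (\<lambda>n. 1 mod int p ^ n)"
  "\<zero>\<^bsub>Zp p\<^esub> = (\<lambda>n. 0)"
  "a \<oplus>\<^bsub>Zp p\<^esub> b = (\<lambda>n. (a n + b n) mod int p ^ n)"
  by (simp_all add: Zp_def)

lemma Zp_mod: "a \<in> carrier (Zp p) \<Longrightarrow> a n mod int p ^ n = a n"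
  by (simp add: Zp_simps) (metis mod_mod_trivial)

lemma Zp_carrierI:
  assumes "\<And>n. [b (Suc n) = b n] (mod int p ^ n)"
  shows "(\<lambda>n. b n mod int p ^ n) \<in> carrier (Zp p)"
  using assms by (simp add: Zp_simps cong_def mod_mod_cancel le_imp_power_dvd)

lemma Zp_cong:
  assumes "a \<in> carrier (Zp p)"
  shows "[a (Suc n) = a n] (mod int p ^ n)"
  using assms Zp_mod[OF assms, of n] by (simp add: Zp_simps cong_def)

lemma cring_Zp: "cring (Zp p)"
proof (rule cringI)
  show "abelian_group (Zp p)"
  proof (rule abelian_groupI)
    fix x y assume "x \<in> carrier (Zp p)" "y \<in> carrier (Zp p)"
    then show "x \<oplus>\<^bsub>Zp p\<^esub> y \<in> carrier (Zp p)"
      unfolding Zp_simps(5) by (intro Zp_carrierI cong_add Zp_cong)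
  next
    show "\<zero>\<^bsub>Zp p\<^esub> \<in> carrier (Zp p)" by (simp add: Zp_simps)
  next
    fix x y z
    show "x \<oplus>\<^bsub>Zp p\<^esub> y \<oplus>\<^bsub>Zp p\<^esub> z = x \<oplus>\<^bsub>Zp p\<^esub> (y \<oplus>\<^bsub>Zp p\<^esub> z)"
      by (simp add: Zp_simps mod_simps add.assoc)
  next
    fix x y show "x \<oplus>\<^bsub>Zp p\<^esub> y = y \<oplus>\<^bsub>Zp p\<^esub> x"
      by (simp add: Zp_simps add.commute)
  next
    fix x assume "x \<in> carrier (Zp p)"
    then show "\<zero>\<^bsub>Zp p\<^esub> \<oplus>\<^bsub>Zp p\<^esub> x = x"
      using Zp_mod by (simp add: Zp_simps(4,5))
  next
    fix x assume x: "x \<in> carrier (Zp p)"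
    have "(\<lambda>n. (- x n) mod int p ^ n) \<in> carrier (Zp p)"
      using x Zp_cong by (intro Zp_carrierI) (simp add: cong_minus_minus_iff)
    moreover have "(\<lambda>n. (- x n) mod int p ^ n) \<oplus>\<^bsub>Zp p\<^esub> x = \<zero>\<^bsub>Zp p\<^esub>"
      by (simp add: Zp_simps mod_simps)
    ultimately show "\<exists>y\<in>carrier (Zp p). y \<oplus>\<^bsub>Zp p\<^esub> x = \<zero>\<^bsub>Zp p\<^esub>" by blast
  qed
next
  show "Group.comm_monoid (Zp p)"
  proof (rule comm_monoidI)
    fix x y assume "x \<in> carrier (Zp p)" "y \<in> carrier (Zp p)"
    then show "x \<otimes>\<^bsub>Zp p\<^esub> y \<in> carrier (Zp p)"
      unfolding Zp_simps(2) by (intro Zp_carrierI cong_mult Zp_cong)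
  next
    show "\<one>\<^bsub>Zp p\<^esub> \<in> carrier (Zp p)" unfolding Zp_simps(3) by (intro Zp_carrierI) simp
  next
    fix x y z
    show "x \<otimes>\<^bsub>Zp p\<^esub> y \<otimes>\<^bsub>Zp p\<^esub> z = x \<otimes>\<^bsub>Zp p\<^esub> (y \<otimes>\<^bsub>Zp p\<^esub> z)"
      by (simp add: Zp_simps mod_simps mult.assoc)
  next
    fix x assume "x \<in> carrier (Zp p)"
    then show "\<one>\<^bsub>Zp p\<^esub> \<otimes>\<^bsub>Zp p\<^esub> x = x"
      using Zp_mod by (simp add: Zp_simps(2,3) mod_simps)
  next
    fix x y show "x \<otimes>\<^bsub>Zp p\<^esub> y = y \<otimes>\<^bsub>Zp p\<^esub> x"
      by (simp add: Zp_simps mult.commute)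
  qed
next
  fix x y z
  show "(x \<oplus>\<^bsub>Zp p\<^esub> y) \<otimes>\<^bsub>Zp p\<^esub> z = x \<otimes>\<^bsub>Zp p\<^esub> z \<oplus>\<^bsub>Zp p\<^esub> y \<otimes>\<^bsub>Zp p\<^esub> z"
    by (simp add: Zp_simps mod_simps distrib_right)
qed

lemma Zp_of_nat: "[(k::nat)] \<cdot>\<^bsub>Zp p\<^esub> \<one>\<^bsub>Zp p\<^esub> = (\<lambda>n. int k mod int p ^ n)"
proof -
  interpret cring "Zp p" by (rule cring_Zp)
  show ?thesis
    by (induction k) (simp_all add: add.nat_pow_Suc, simp_all add: Zp_simps mod_simps add.commute)
qed

lemma Zp_of_int: "[(k::int)] \<cdot>\<^bsub>Zp p\<^esub> \<one>\<^bsub>Zp p\<^esub> = (\<lambda>n. k mod int p ^ n)"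
proof -
  interpret cring "Zp p" by (rule cring_Zp)
  show ?thesis
  proof (cases "k \<ge> 0")
    case True
    then show ?thesis by (simp add: add_pow_int_ge Zp_of_nat)
  next
    case False
    have "(\<lambda>n. k mod int p ^ n) = \<ominus>\<^bsub>Zp p\<^esub> ([nat (- k)] \<cdot>\<^bsub>Zp p\<^esub> \<one>\<^bsub>Zp p\<^esub>)"
    proof (rule minus_equality[symmetric])
      show "(\<lambda>n. k mod int p ^ n) \<oplus>\<^bsub>Zp p\<^esub> [nat (- k)] \<cdot>\<^bsub>Zp p\<^esub> \<one>\<^bsub>Zp p\<^esub> = \<zero>\<^bsub>Zp p\<^esub>"
        using False unfolding Zp_of_nat by (simp add: Zp_simps mod_simps)
      show "(\<lambda>n. k mod int p ^ n) \<in> carrier (Zp p)" by (intro Zp_carrierI) simp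
    qed simp
    with False show ?thesis by (simp add: add_pow_int_lt)
  qed
qed

text \<open>So \<open>m_inv\<close> of a \<open>p\<close>-adic integer with nonzero residue modulo \<open>p\<close> is its genuine inverse.\<close>

lemma Zp_UnitsI:
  assumes p: "prime p" and x: "x \<in> carrier (Zp p)" and x1: "x 1 \<noteq> 0"
  shows "x \<in> Units (Zp p)"
proof -
  interpret cring "Zp p" by (rule cring_Zp)
  have red: "[x (Suc n) = x 1] (mod int p)" for n
  proof (induction n)
    case (Suc n)
    have "[x (Suc (Suc n)) = x (Suc n)] (mod int p)"
      using Zp_cong[OF x, of "Suc n"] by (rule cong_dvd_modulus) simp
    then show ?case using Suc by (rule cong_trans)
  qed simp
  have nd: "\<not> int p dvd x (Suc n)" for n
    using red[of n] x1 Zp_mod[OF x, of 1] by (simp add: cong_def dvd_eq_mod_eq_0)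
  have cop: "coprime (x n) (int p ^ n)" for n
  proof (cases n)
    case (Suc m)
    have "prime (int p)" using p by simp
    then have "coprime (int p) (x n)"
      using nd[of m] Suc by (simp add: prime_imp_coprime)
    then show ?thesis by (simp add: coprime_commute)
  qed simp
  then have "\<forall>n. \<exists>y. [x n * y = 1] (mod int p ^ n)"
    using cong_solve_coprime_int by blast
  then obtain y where y: "\<And>n. [x n * y n = 1] (mod int p ^ n)" by metis
  have coh: "[y (Suc n) = y n] (mod int p ^ n)" for n
  proof -
    have "[x n * y (Suc n) = x (Suc n) * y (Suc n)] (mod int p ^ n)"
      by (rule cong_scalar_right[OF cong_sym[OF Zp_cong[OF x]]])
    also have "[x (Suc n) * y (Suc n) = 1] (mod int p ^ n)"
      using y[of "Suc n"] by (rule cong_dvd_modulus) simp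
    also have "[1 = x n * y n] (mod int p ^ n)"
      by (rule cong_sym[OF y])
    finally have "[x n * y (Suc n) = x n * y n] (mod int p ^ n)" .
    then show ?thesis using cop[of n] by (simp add: cong_mult_lcancel)
  qed
  define z where "z = (\<lambda>n. y n mod int p ^ n)"
  have z: "z \<in> carrier (Zp p)"
    unfolding z_def by (rule Zp_carrierI[OF coh])
  have xz: "x \<otimes>\<^bsub>Zp p\<^esub> z = \<one>\<^bsub>Zp p\<^esub>"
    using y by (simp add: z_def Zp_simps mod_simps cong_def)
  have "z \<otimes>\<^bsub>Zp p\<^esub> x = \<one>\<^bsub>Zp p\<^esub>"
    using xz m_comm[OF x z] by simp
  then show ?thesis
    unfolding Units_def using x z xz by blast
qed

text \<open>A rational number \<open>a / b\<close> is a \<open>p\<close>-adic integer iff \<open>b z = a\<close> has a solution \<open>z\<close> in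
  the integral domain of \<open>p\<close>-adic integers.\<close>

definition rat_padic_integer :: "nat \<Rightarrow> rat \<Rightarrow> bool" where
  "rat_padic_integer p r \<longleftrightarrow>
    (\<exists>z\<in>carrier (Zp p).
      [snd (quotient_of r)] \<cdot>\<^bsub>Zp p\<^esub> \<one>\<^bsub>Zp p\<^esub> \<otimes>\<^bsub>Zp p\<^esub> z = [fst (quotient_of r)] \<cdot>\<^bsub>Zp p\<^esub> \<one>\<^bsub>Zp p\<^esub>)"

lemma rat_padic_integer_iff:
  assumes p: "prime p"
  shows "rat_padic_integer p r \<longleftrightarrow> \<not> int p dvd snd (quotient_of r)"
proof -
  interpret cring "Zp p" by (rule cring_Zp)
  obtain a b where ab: "quotient_of r = (a, b)" by (cases "quotient_of r")
  have cop: "coprime a b" using quotient_of_coprime[OF ab] .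
  show ?thesis
  proof
    assume "rat_padic_integer p r"
    then obtain z where "[b] \<cdot>\<^bsub>Zp p\<^esub> \<one>\<^bsub>Zp p\<^esub> \<otimes>\<^bsub>Zp p\<^esub> z = [a] \<cdot>\<^bsub>Zp p\<^esub> \<one>\<^bsub>Zp p\<^esub>"
      by (auto simp: rat_padic_integer_def ab)
    from fun_cong[OF this, of 1] have "(b * z 1) mod int p = a mod int p"
      unfolding Zp_of_int Zp_simps(2) by (simp add: mod_simps)
    then have "int p dvd b * z 1 \<longleftrightarrow> int p dvd a"
      by (simp add: dvd_eq_mod_eq_0)
    then have "int p dvd a" if "int p dvd b"
      using that by (simp add: dvd_mult2)
    then show "\<not> int p dvd snd (quotient_of r)"
      using cop p coprime_common_divisor[of a b "int p"] by (auto simp: ab)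
  next
    assume nd: "\<not> int p dvd snd (quotient_of r)"
    let ?b = "[b] \<cdot>\<^bsub>Zp p\<^esub> \<one>\<^bsub>Zp p\<^esub>" and ?a = "[a] \<cdot>\<^bsub>Zp p\<^esub> \<one>\<^bsub>Zp p\<^esub>"
    have u: "?b \<in> Units (Zp p)"
    proof (rule Zp_UnitsI[OF p])
      show "?b 1 \<noteq> 0" using nd unfolding Zp_of_int by (simp add: ab dvd_eq_mod_eq_0)
    qed simp
    have a: "?a \<in> carrier (Zp p)" by simp
    have "?b \<otimes>\<^bsub>Zp p\<^esub> (inv\<^bsub>Zp p\<^esub> ?b \<otimes>\<^bsub>Zp p\<^esub> ?a) = (?b \<otimes>\<^bsub>Zp p\<^esub> inv\<^bsub>Zp p\<^esub> ?b) \<otimes>\<^bsub>Zp p\<^esub> ?a"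
      by (rule m_assoc[symmetric, OF Units_closed[OF u] Units_inv_closed[OF u] a])
    also have "\<dots> = ?a"
      unfolding Units_r_inv[OF u] by (rule l_one[OF a])
    finally show "rat_padic_integer p r"
      unfolding rat_padic_integer_def ab fst_conv snd_conv
      by (rule bexI[OF _ m_closed[OF Units_inv_closed[OF u] a]])
  qed
qed

definition rat_cong :: "nat \<Rightarrow> nat \<Rightarrow> rat \<Rightarrow> rat \<Rightarrow> bool" where
  "rat_cong p m a b \<longleftrightarrow> rat_padic_integer p ((a - b) / of_nat p ^ m)"

definition rat_poly_cong :: "nat \<Rightarrow> nat \<Rightarrow> rat poly \<Rightarrow> rat poly \<Rightarrow> bool" where
  "rat_poly_cong p m f g \<longleftrightarrow> (\<forall>i. rat_cong p m (coeff f i) (coeff g i))"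

text \<open>For \<open>p\<close>-adic integers, \<open>(a - b) / p ^ m\<close> is a \<open>p\<close>-adic integer iff \<open>a - b = p ^ m z\<close> for
  some \<open>p\<close>-adic integer \<open>z\<close>.\<close>

definition Zp_cong_mod :: "nat \<Rightarrow> nat \<Rightarrow> (nat \<Rightarrow> int) \<Rightarrow> (nat \<Rightarrow> int) \<Rightarrow> bool" where
  "Zp_cong_mod p m a b \<longleftrightarrow>
    (\<exists>z\<in>carrier (Zp p). a \<ominus>\<^bsub>Zp p\<^esub> b = ([(p ^ m)] \<cdot>\<^bsub>Zp p\<^esub> \<one>\<^bsub>Zp p\<^esub>) \<otimes>\<^bsub>Zp p\<^esub> z)"

definition ring_eval :: "('a, 'b) ring_scheme \<Rightarrow> int poly \<Rightarrow> 'a \<Rightarrow> 'a" where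
  "ring_eval R f x = (\<Oplus>\<^bsub>R\<^esub>i\<in>{..degree f}. [coeff f i] \<cdot>\<^bsub>R\<^esub> (x [^]\<^bsub>R\<^esub> i))"

definition Apery_poly :: "nat \<Rightarrow> 'a :: comm_ring_1 poly" where
  "Apery_poly n = (\<Sum>k\<le>n. monom (of_nat ((n choose k)\<^sup>2 * ((n + k) choose k)\<^sup>2)) k)"

definition W_poly :: "nat \<Rightarrow> 'a :: comm_ring_1 poly" where
  "W_poly n = (\<Sum>k\<le>n. monom (of_nat ((n choose k)\<^sup>2 * ((n - k) choose k)\<^sup>2)) k)"

definition Apery_num :: "nat \<Rightarrow> int" where
  "Apery_num n = poly (Apery_poly n) 1"

text \<open>The division is exact.\<close>

definition multinomial4 :: "nat \<Rightarrow> nat" where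
  "multinomial4 k = fact (4 * k) div fact k ^ 4"

lemma multinomial4_exact: "multinomial4 k * fact k ^ 4 = fact (4 * k)"
proof -
  have "fact k * fact (m * k) dvd (fact (Suc m * k) :: nat)" for m
    using choose_dvd[of k "Suc m * k", where 'a = nat] by simp
  from this[of 1] this[of 2] this[of 3]
  have "fact k * fact k dvd (fact (2 * k) :: nat)" "fact k * fact (2 * k) dvd (fact (3 * k) :: nat)"
    "fact k * fact (3 * k) dvd (fact (4 * k) :: nat)"
    by (simp_all add: numeral_eq_Suc)
  then have "fact k * (fact k * (fact k * fact k)) dvd (fact (4 * k) :: nat)"
    by (meson dvd_refl dvd_trans mult_dvd_mono)
  then show ?thesis
    by (simp add: multinomial4_def power4_eq_xxxx mult.assoc)
qed

fun bernoulli_num :: "nat \<Rightarrow> rat" where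
  "bernoulli_num n =
    (if n = 0 then 1
     else - (\<Sum>k<n. of_nat (Suc n choose k) * bernoulli_num k) / of_nat (Suc n))"

declare bernoulli_num.simps [simp del]

lemma bernoulli_num_0: "bernoulli_num 0 = 1"
  by (simp add: bernoulli_num.simps)

lemma bernoulli_num_rec:
  assumes "n \<ge> 1"
  shows "(\<Sum>k\<le>n. of_nat (Suc n choose k) * bernoulli_num k) = 0"
proof -
  have "{..n} = insert n {..<n}" by auto
  then show ?thesis
    using assms by (simp add: bernoulli_num.simps[of n] field_simps del: of_nat_Suc)
qed

fun euler_num :: "nat \<Rightarrow> int" where
  "euler_num n =
    (if n = 0 then 1
     else - (\<Sum>k | k \<in> {1..n} \<and> even k. of_nat (n choose k) * euler_num (n - k)))"

declare euler_num.simps [simp del]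

lemma euler_num_0: "euler_num 0 = 1"
  by (simp add: euler_num.simps)

lemma euler_num_rec:
  assumes "n \<ge> 1"
  shows "(\<Sum>k | k \<le> n \<and> even k. of_nat (n choose k) * euler_num (n - k)) = 0"
proof -
  let ?A = "{k. k \<in> {1..n} \<and> even k}"
  have fin: "finite ?A" by (rule finite_subset[of _ "{1..n}"]) auto
  have "{k. k \<le> n \<and> even k} = insert 0 ?A" by (auto simp: Suc_le_eq)
  then have "(\<Sum>k | k \<le> n \<and> even k. of_nat (n choose k) * euler_num (n - k)) =
      euler_num n + (\<Sum>k\<in>?A. of_nat (n choose k) * euler_num (n - k))"
    using sum.insert[OF fin, of 0 "\<lambda>k. int (n choose k) * euler_num (n - k)"] by simp
  also have "\<dots> = 0"
    using assms by (subst euler_num.simps) simp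
  finally show ?thesis .
qed

end

theory Submission
  imports Defs
begin

text \<open>
Everything rests on the factorization
\<open>(n choose k) * (n + k choose k) = (n + k choose 2 * k) * (2 * k choose k)\<close>, which turns the
coefficient of \<open>x ^ j\<close> in a sum over Apery polynomials into
\<open>(2 * j choose j) ^ 2\<close> times a sum over \<open>k\<close> of weighted squares \<open>(k + j choose 2 * j) ^ 2\<close>;
the same factorization with \<open>n - k\<close> in place of \<open>n + k\<close> gives
\<open>(k choose 2 * j) ^ 2\<close> for the polynomials \<open>W\<close>. All further work concerns these one-parameter sums.

Part (i). Only \<open>j < p\<close> occurs. For \<open>p \<le> 2 * j\<close> the factor \<open>(2 * j choose j) ^ 2\<close> vanishes modulo \<open>p ^ 2\<close>. For
\<open>2 * j < p\<close> a shift of the summation index by \<open>j\<close> changes the sum only by squares of binomial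
coefficients divisible by \<open>p\<close> (\<open>sum_choose_square_shift\<close>), so the sums for \<open>A\<close> and \<open>W\<close> agree
coefficientwise, up to the sign \<open>(-1) ^ j\<close> in the alternating case. The alternating sums satisfy
a two-term recurrence in \<open>j\<close>, found by creative telescoping, whose boundary term is divisible by
\<open>p ^ 2\<close> (\<open>sum_alternating_choose_square_step\<close>); solving it gives
\<open>(2 * j choose j) / 16 ^ j\<close>. The comparison of the sums without
sign with multinomial coefficients holds modulo \<open>p\<close> only: expanding \<open>(k choose m) ^ 2\<close> in the basis \<open>k choose r\<close> leaves only the term with
\<open>r = p - 1\<close> (\<open>sum_choose_square_cong\<close>), and reversing the order of the coefficients,
\<open>j = (p - 1) / 2 - k\<close>, turns it into the multinomial sum multiplied by \<open>x ^ ((p - 1) / 2)\<close>,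
which is the Legendre symbol by Euler's criterion. Since all of this is coefficientwise, a \<open>p\<close>-adic
argument enters only through its residue.

Part (ii). The weight \<open>2 * k + 1\<close> makes the sum of squares telescope
(\<open>sum_odd_mult_choose_square\<close>), which is the polynomial identity. For \<open>n = p\<close> it takes the form
of \<open>p ^ 2\<close> times the sum over \<open>j < p\<close> of \<open>x ^ j * P j ^ 2 / (2 * j + 1)\<close>, where \<open>P j\<close> is the product of the factors
\<open>1 - p ^ 2 / i ^ 2\<close> for \<open>1 \<le> i \<le> j\<close>. The middle term \<open>j = h = (p - 1) / 2\<close>
has denominator \<open>p\<close> and is the main term; pairing \<open>h + i\<close> with \<open>h - i\<close> in the others reduces the
first congruence to two harmonic sums,
the sum of \<open>1 / i ^ 2\<close> for \<open>i \<le> h\<close> modulo \<open>p ^ 2\<close> and a double sum modulo \<open>p\<close>. Both are multiples of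
the Bernoulli number \<open>B (p - 3)\<close>: inverse powers become powers by Fermat's theorem, inner power sums
become Bernoulli polynomials, and among the resulting outer power sums only the one with exponent \<open>p - 1\<close>
survives (\<open>sum_power_mult_bernoulli_poly_cong\<close>). The argument \<open>1 / 2\<close> appears because
\<open>h + 1\<close> is \<open>1 / 2\<close> modulo \<open>p\<close>. At \<open>x = -1\<close> the same pairing leads to an alternating
sum of odd powers, which Euler polynomials evaluate.

Part (iii). The reflection \<open>k \<mapsto> p - 1 - k\<close> preserves Apery polynomials modulo \<open>p\<close> and negates
\<open>2 * k + 1\<close>, so the sum is its own negative.
\<close>

section \<open>Congruences between rational numbers modulo a prime power\<close>

text \<open>The congruence relation of rational numbers is a congruence for multiplication only by \<open>p\<close>-integral
factors, so almost every rule below comes with integrality side conditions; \<open>padic_intros\<close> collects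
the closure properties that discharge them.\<close>

locale prime_modulus =
  fixes p :: nat
  assumes prime: "prime p"
begin

lemma prime_int: "prime (int p)"
  using prime by simp

lemma p_pos: "p > 0"
  using prime prime_gt_0_nat by blast

lemma p_gt_1: "p > 1"
  using prime prime_gt_1_nat by blast

lemma p_nonzero [simp]: "p \<noteq> 0"
  using p_pos by simp

text \<open>Fractions need not be in lowest terms for this characterization, which is what makes sums and
products easy to treat.\<close>

lemma padic_iff:
  "rat_padic_integer p r \<longleftrightarrow> (\<exists>a b. r = of_int a / of_int b \<and> \<not> int p dvd b)"
proof
  assume "rat_padic_integer p r"
  then have nd: "\<not> int p dvd snd (quotient_of r)"
    using rat_padic_integer_iff[OF prime] by simp
  obtain a b where ab: "quotient_of r = (a, b)" by fastforce
  with nd quotient_of_div[OF ab] show "\<exists>a b. r = of_int a / of_int b \<and> \<not> int p dvd b" by auto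
next
  assume "\<exists>a b. r = of_int a / of_int b \<and> \<not> int p dvd b"
  then obtain a b where r: "r = of_int a / of_int b" and b: "\<not> int p dvd b" by blast
  obtain n d where nd: "quotient_of r = (n, d)" by fastforce
  have d: "d > 0" using quotient_of_denom_pos[OF nd] .
  have "b \<noteq> 0" using b by auto
  have "(of_int n / of_int d :: rat) = of_int a / of_int b"
    using r quotient_of_div[OF nd] by simp
  then have "(of_int (n * b) :: rat) = of_int (a * d)"
    using d \<open>b \<noteq> 0\<close> by (simp add: field_simps)
  then have eq: "n * b = a * d" by (simp only: of_int_eq_iff)
  have "\<not> int p dvd d"
  proof
    assume *: "int p dvd d"
    then have "int p dvd n * b" unfolding eq by simp
    then have "int p dvd n" using b prime_int prime_dvd_mult_iff by blast
    with * quotient_of_coprime[OF nd] prime_int show False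
      by (meson coprime_common_divisor not_prime_unit)
  qed
  then show "rat_padic_integer p r" using rat_padic_integer_iff[OF prime] nd by simp
qed

lemma padic_of_int: "rat_padic_integer p (of_int a)"
  unfolding padic_iff using prime_int by (intro exI[of _ a] exI[of _ 1]) auto

lemma padic_of_nat: "rat_padic_integer p (of_nat a)"
  using padic_of_int[of "int a"] by simp

lemma padic_numeral: "rat_padic_integer p (numeral n)"
  using padic_of_int[of "numeral n"] by simp

lemma padic_0: "rat_padic_integer p 0" and padic_1: "rat_padic_integer p 1"
  using padic_of_int[of 0] padic_of_int[of 1] by simp_all

lemma padic_add:
  assumes "rat_padic_integer p a" "rat_padic_integer p b"
  shows "rat_padic_integer p (a + b)"
proof -
  from assms obtain x y u v where *: "a = of_int x / of_int y" "\<not> int p dvd y"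
    "b = of_int u / of_int v" "\<not> int p dvd v" unfolding padic_iff by blast
  then have nz: "y \<noteq> 0" "v \<noteq> 0" by auto
  have "a + b = of_int (x * v + u * y) / of_int (y * v)"
    using * nz by (simp add: field_simps)
  moreover have "\<not> int p dvd y * v" using * prime_int prime_dvd_mult_iff by blast
  ultimately show ?thesis unfolding padic_iff by blast
qed

lemma padic_mult:
  assumes "rat_padic_integer p a" "rat_padic_integer p b"
  shows "rat_padic_integer p (a * b)"
proof -
  from assms obtain x y u v where *: "a = of_int x / of_int y" "\<not> int p dvd y"
    "b = of_int u / of_int v" "\<not> int p dvd v" unfolding padic_iff by blast
  have "a * b = of_int (x * u) / of_int (y * v)" using * by simp
  moreover have "\<not> int p dvd y * v" using * prime_int prime_dvd_mult_iff by blast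
  ultimately show ?thesis unfolding padic_iff by blast
qed

lemma padic_uminus: "rat_padic_integer p a \<Longrightarrow> rat_padic_integer p (- a)"
  using padic_mult[OF padic_of_int[of "-1"], of a] by simp

lemma padic_diff:
  "rat_padic_integer p a \<Longrightarrow> rat_padic_integer p b \<Longrightarrow> rat_padic_integer p (a - b)"
  using padic_add[OF _ padic_uminus, of a b] by simp

lemma padic_power: "rat_padic_integer p a \<Longrightarrow> rat_padic_integer p (a ^ n)"
  by (induction n) (auto intro: padic_1 padic_mult)

lemma padic_sum: "(\<And>i. i \<in> A \<Longrightarrow> rat_padic_integer p (f i)) \<Longrightarrow> rat_padic_integer p (sum f A)"
  by (induction A rule: infinite_finite_induct) (auto intro: padic_0 padic_add)

lemma padic_prod: "(\<And>i. i \<in> A \<Longrightarrow> rat_padic_integer p (f i)) \<Longrightarrow> rat_padic_integer p (prod f A)"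
  by (induction A rule: infinite_finite_induct) (auto intro: padic_1 padic_mult)

lemma padic_divide_of_int:
  assumes "rat_padic_integer p a" "\<not> int p dvd b"
  shows "rat_padic_integer p (a / of_int b)"
proof -
  have "rat_padic_integer p (1 / of_int b)"
    unfolding padic_iff using assms(2) by (intro exI[of _ 1] exI[of _ b]) simp
  from padic_mult[OF assms(1) this] show ?thesis by simp
qed

lemma padic_divide_of_nat:
  "rat_padic_integer p a \<Longrightarrow> \<not> p dvd b \<Longrightarrow> rat_padic_integer p (a / of_nat b)"
  using padic_divide_of_int[of a "int b"] by simp

lemma padic_divide_of_nat_power:
  "rat_padic_integer p a \<Longrightarrow> \<not> p dvd b \<Longrightarrow> rat_padic_integer p (a / of_nat b ^ k)"
  using padic_divide_of_nat[of a "b ^ k"] prime prime_dvd_power_nat_iff[OF prime] 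
  by (cases "k = 0") (auto simp: prime_dvd_power_nat_iff)

lemmas padic_intros = padic_0 padic_1 padic_of_int padic_of_nat padic_numeral padic_add padic_mult
  padic_uminus padic_diff padic_power padic_sum padic_prod padic_divide_of_nat padic_divide_of_nat_power

lemma not_dvd_less: "0 < k \<Longrightarrow> k < p \<Longrightarrow> \<not> p dvd k"
  using nat_dvd_not_less by blast

lemma rat_congI:
  "a = b + of_nat p ^ m * z \<Longrightarrow> rat_padic_integer p z \<Longrightarrow> rat_cong p m a b"
  unfolding rat_cong_def by simp

lemma rat_congE:
  assumes "rat_cong p m a b"
  obtains z where "a = b + of_nat p ^ m * z" "rat_padic_integer p z"
proof
  show "a = b + of_nat p ^ m * ((a - b) / of_nat p ^ m)" by simp
  show "rat_padic_integer p ((a - b) / of_nat p ^ m)" using assms unfolding rat_cong_def .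
qed

lemma rat_cong_refl [simp]: "rat_cong p m a a"
  by (rule rat_congI[of _ _ _ 0]) (auto intro: padic_0)

lemma rat_cong_uminus:
  assumes "rat_cong p m a b"
  shows "rat_cong p m (- a) (- b)"
proof -
  obtain z where "a = b + of_nat p ^ m * z" "rat_padic_integer p z" using assms by (rule rat_congE)
  then show ?thesis by (intro rat_congI[of _ _ _ "- z"]) (simp_all add: padic_uminus)
qed

lemma rat_cong_add:
  assumes "rat_cong p m a b" "rat_cong p m c d"
  shows "rat_cong p m (a + c) (b + d)"
proof -
  obtain z where "a = b + of_nat p ^ m * z" "rat_padic_integer p z" using assms(1) by (rule rat_congE)
  moreover obtain w where "c = d + of_nat p ^ m * w" "rat_padic_integer p w"
    using assms(2) by (rule rat_congE)
  ultimately show ?thesis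
    by (intro rat_congI[of _ _ _ "z + w"]) (simp_all add: padic_add algebra_simps)
qed

lemma rat_cong_diff:
  "rat_cong p m a b \<Longrightarrow> rat_cong p m c d \<Longrightarrow> rat_cong p m (a - c) (b - d)"
  using rat_cong_add[OF _ rat_cong_uminus, of m a b c d] by simp

lemma rat_cong_sym: "rat_cong p m a b \<Longrightarrow> rat_cong p m b a"
  using rat_cong_add[OF rat_cong_uminus rat_cong_refl, of m a b "a + b"] by simp

lemma rat_cong_trans [trans]:
  assumes "rat_cong p m a b" "rat_cong p m b c"
  shows "rat_cong p m a c"
  using rat_cong_add[OF assms(1) rat_cong_diff[OF assms(2) rat_cong_refl[of m b]]] by simp

lemma rat_cong_eq_trans [trans]:
  "rat_cong p m a b \<Longrightarrow> b = c \<Longrightarrow> rat_cong p m a c"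
  "a = b \<Longrightarrow> rat_cong p m b c \<Longrightarrow> rat_cong p m a c"
  by simp_all

lemma rat_cong_mult_left:
  assumes "rat_padic_integer p c" "rat_cong p m a b"
  shows "rat_cong p m (c * a) (c * b)"
proof -
  obtain z where "a = b + of_nat p ^ m * z" "rat_padic_integer p z" using assms(2) by (rule rat_congE)
  then show ?thesis
    using assms(1) by (intro rat_congI[of _ _ _ "c * z"]) (simp_all add: padic_mult algebra_simps)
qed

lemma rat_cong_mult_right:
  "rat_padic_integer p c \<Longrightarrow> rat_cong p m a b \<Longrightarrow> rat_cong p m (a * c) (b * c)"
  using rat_cong_mult_left[of c m a b] by (simp add: mult.commute)

lemma rat_cong_padic: "rat_cong p m a b \<Longrightarrow> rat_padic_integer p b \<Longrightarrow> rat_padic_integer p a"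
  by (elim rat_congE) (auto intro!: padic_intros)

lemma rat_cong_mult:
  assumes "rat_cong p m a b" "rat_cong p m c d" "rat_padic_integer p b" "rat_padic_integer p d"
  shows "rat_cong p m (a * c) (b * d)"
  using rat_cong_trans[OF rat_cong_mult_right[OF rat_cong_padic[OF assms(2,4)] assms(1)]
      rat_cong_mult_left[OF assms(3,2)]] .

lemma rat_cong_power:
  "rat_cong p m a b \<Longrightarrow> rat_padic_integer p b \<Longrightarrow> rat_cong p m (a ^ n) (b ^ n)"
  by (induction n) (auto intro!: rat_cong_mult padic_intros)

lemma rat_cong_sum:
  "(\<And>i. i \<in> A \<Longrightarrow> rat_cong p m (f i) (g i)) \<Longrightarrow> rat_cong p m (sum f A) (sum g A)"
  by (induction A rule: infinite_finite_induct) (auto intro: rat_cong_add)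

lemma rat_cong_weaken:
  assumes "rat_cong p m a b" "n \<le> m"
  shows "rat_cong p n a b"
proof -
  obtain z where z: "a = b + of_nat p ^ m * z" "rat_padic_integer p z" using assms(1) by (rule rat_congE)
  have "of_nat p ^ m = (of_nat p ^ n * of_nat p ^ (m - n) :: rat)"
    using assms(2) by (simp flip: power_add)
  with z show ?thesis
    by (intro rat_congI[of _ _ _ "of_nat p ^ (m - n) * z"]) (auto intro!: padic_intros)
qed

text \<open>Multiplying by \<open>p ^ k\<close> gains \<open>k\<close> powers in the modulus. This is how low-order information about
harmonic sums is enough for congruences modulo \<open>p ^ 4\<close> and \<open>p ^ 5\<close>.\<close>

lemma rat_cong_mult_p_power:
  assumes "rat_cong p m a b" "n = k + m"
  shows "rat_cong p n (of_nat p ^ k * a) (of_nat p ^ k * b)"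
proof -
  obtain z where "a = b + of_nat p ^ m * z" "rat_padic_integer p z" using assms(1) by (rule rat_congE)
  then show ?thesis using assms(2)
    by (intro rat_congI[of _ _ _ z]) (simp_all add: algebra_simps power_add)
qed

lemma rat_cong_cancel_p_power:
  "rat_cong p n (of_nat p ^ k * a) (of_nat p ^ k * b) \<Longrightarrow> n = k + m \<Longrightarrow> rat_cong p m a b"
  unfolding rat_cong_def by (simp add: power_add flip: right_diff_distrib)

lemma rat_cong_p_power_mult:
  "rat_padic_integer p a \<Longrightarrow> m \<le> k \<Longrightarrow> rat_cong p m (of_nat p ^ k * a) 0"
  by (rule rat_cong_weaken[of k]) (auto intro: rat_congI[where z = a])

lemma rat_cong_cancel_of_nat:
  assumes "rat_cong p m (of_nat c * a) (of_nat c * b)" "\<not> p dvd c"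
  shows "rat_cong p m a b"
proof -
  have "rat_padic_integer p (1 / of_nat c)" using assms(2) by (intro padic_intros)
  from rat_cong_mult_left[OF this assms(1)] show ?thesis
    using assms(2) by (cases "c = 0") auto
qed

lemma rat_cong_of_int_iff: "rat_cong p m (of_int a) (of_int b) \<longleftrightarrow> [a = b] (mod int p ^ m)"
proof
  assume "[a = b] (mod int p ^ m)"
  then obtain z where "a = b + int p ^ m * z"
    by (metis cong_iff_lin cong_sym mult.commute)
  then have "(of_int a :: rat) = of_int b + of_nat p ^ m * of_int z" by simp
  then show "rat_cong p m (of_int a) (of_int b)" by (rule rat_congI) (rule padic_of_int)
next
  assume "rat_cong p m (of_int a) (of_int b)"
  then obtain z where z: "of_int a = of_int b + of_nat p ^ m * z" "rat_padic_integer p z"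
    by (rule rat_congE)
  then obtain u v where v: "z = of_int u / of_int v" "\<not> int p dvd v" unfolding padic_iff by blast
  then have "v \<noteq> 0" by auto
  with v z have "(of_int ((a - b) * v) :: rat) = of_int (int p ^ m * u)"
    by (simp add: field_simps)
  then have "(a - b) * v = int p ^ m * u" by (simp only: of_int_eq_iff)
  then have "int p ^ m dvd (a - b) * v" by simp
  moreover have "coprime (int p ^ m) v"
    using v(2) prime_int by (simp add: prime_imp_coprime)
  ultimately have "int p ^ m dvd a - b"
    using coprime_dvd_mult_left_iff by blast
  then show "[a = b] (mod int p ^ m)" by (simp add: cong_iff_dvd_diff)
qed

end

section \<open>Coefficients of the polynomials and the telescoping identity\<close>

lemma coeff_sum_monom_atMost:
  "coeff (\<Sum>k\<le>n. monom (c k) k) j = (if j \<le> n then c j else 0)"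
  by (simp add: coeff_sum coeff_monom)

lemma coeff_sum_monom_lessThan:
  "coeff (\<Sum>k<n. monom (c k) k) j = (if j < n then c j else 0)"
  by (simp add: coeff_sum coeff_monom)

lemma choose_mult_choose_add:
  "(n choose j) * ((n + j) choose j) = ((n + j) choose (2 * j)) * ((2 * j) choose j)"
proof (cases "j \<le> n")
  case True
  then show ?thesis using choose_mult[of j "2 * j" "n + j"] by (simp add: mult.commute)
qed (simp add: binomial_eq_0)

lemma choose_mult_choose_diff:
  "(n choose j) * ((n - j) choose j) = (n choose (2 * j)) * ((2 * j) choose j)"
proof (cases "2 * j \<le> n")
  case True
  then show ?thesis using choose_mult[of j "2 * j" n] by simp
next
  case False
  then show ?thesis by (cases "j \<le> n") (simp_all add: binomial_eq_0)
qed

lemma coeff_Apery_poly: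
  "coeff (Apery_poly n) j = of_nat ((((n + j) choose (2 * j)) * ((2 * j) choose j))\<^sup>2)"
  unfolding Apery_poly_def coeff_sum_monom_atMost
  by (simp only: power_mult_distrib[symmetric] choose_mult_choose_add) (simp add: binomial_eq_0)

lemma coeff_Apery_poly': "coeff (Apery_poly n) j = of_nat (((n choose j) * ((n + j) choose j))\<^sup>2)"
  unfolding coeff_Apery_poly choose_mult_choose_add ..

lemma coeff_W_poly:
  "coeff (W_poly n) j = of_nat (((n choose (2 * j)) * ((2 * j) choose j))\<^sup>2)"
  unfolding W_poly_def coeff_sum_monom_atMost
  by (simp only: power_mult_distrib[symmetric] choose_mult_choose_diff) (simp add: binomial_eq_0)

text \<open>Multiplying out the quotient of neighbouring binomial coefficients avoids divisions; over the
integers the identity also holds where the binomial coefficients vanish.\<close>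

lemma choose_shift:
  "(int n + 1 - int j) * int ((n + 1 + j) choose (2 * j)) = (int n + 1 + int j) * int ((n + j) choose (2 * j))"
proof (cases "j \<le> n + 1")
  case True
  have "((n + 1 + j) - 2 * j) * ((n + 1 + j) choose (2 * j)) = (n + 1 + j) * ((n + 1 + j - 1) choose (2 * j))"
    by (rule binomial_absorb_comp)
  then have "int (((n + 1 + j) - 2 * j) * ((n + 1 + j) choose (2 * j))) = int ((n + 1 + j) * ((n + j) choose (2 * j)))"
    by simp
  moreover have "int ((n + 1 + j) - 2 * j) = int n + 1 - int j" using True by simp
  ultimately show ?thesis by (simp only: of_nat_mult of_nat_add of_nat_1)
qed (simp add: binomial_eq_0)

lemma choose_shift_square:
  "(int n + 1 - int j)\<^sup>2 * int ((Suc n + j) choose (2 * j)) ^ 2 =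
   (int n + 1 + int j)\<^sup>2 * int ((n + j) choose (2 * j)) ^ 2"
  using choose_shift[of n j] by (simp flip: power_mult_distrib)

text \<open>The right-hand side telescopes, because
\<open>(n + 1 + j) ^ 2 - (n - j) ^ 2 = (2 * n + 1) * (2 * j + 1)\<close>.\<close>

lemma sum_odd_mult_choose_square:
  "(2 * int j + 1) * (\<Sum>k<n. (2 * int k + 1) * int ((k + j) choose (2 * j)) ^ 2) =
   (int n - int j)\<^sup>2 * int ((n + j) choose (2 * j)) ^ 2"
proof (induction n)
  case (Suc n)
  have "(2 * int j + 1) * (\<Sum>k<Suc n. (2 * int k + 1) * int ((k + j) choose (2 * j)) ^ 2) =
    (int n - int j)\<^sup>2 * int ((n + j) choose (2 * j)) ^ 2 +
      (2 * int j + 1) * ((2 * int n + 1) * int ((n + j) choose (2 * j)) ^ 2)"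
    using Suc by (simp add: distrib_left)
  also have "\<dots> = (int n + 1 + int j)\<^sup>2 * int ((n + j) choose (2 * j)) ^ 2"
    by (simp add: algebra_simps power2_eq_square)
  also have "\<dots> = (int (Suc n) - int j)\<^sup>2 * int ((Suc n + j) choose (2 * j)) ^ 2"
    using choose_shift_square[of n j] by (simp add: algebra_simps)
  finally show ?case .
qed (cases "j = 0"; simp add: binomial_eq_0)

lemma choose_odd_step:
  "(2 * int j + 1) * int ((n + j) choose (2 * j + 1)) = (int n - int j) * int ((n + j) choose (2 * j))"
proof (cases "j \<le> n")
  case True
  have "Suc (2 * j) * ((n + j) choose Suc (2 * j)) = ((n + j) - 2 * j) * ((n + j) choose (2 * j))"
    unfolding binomial_absorption binomial_absorb_comp ..
  then have "int (Suc (2 * j) * ((n + j) choose Suc (2 * j))) = int (((n + j) - 2 * j) * ((n + j) choose (2 * j)))"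
    by simp
  moreover have "int ((n + j) - 2 * j) = int n - int j" using True by simp
  ultimately show ?thesis by (simp only: of_nat_mult) (simp add: algebra_simps)
qed (simp add: binomial_eq_0)

lemma choose_absorb_diff:
  assumes "n \<ge> 1"
  shows "int n * int ((n - 1) choose j) = (int n - int j) * int (n choose j)"
proof (cases "j \<le> n")
  case True
  then show ?thesis using binomial_absorb_comp[of n j]
    by (metis of_nat_diff of_nat_mult)
qed (use assms in \<open>simp add: binomial_eq_0\<close>)

lemma odd_mult_choose_central:
  assumes "n \<ge> 1"
  shows "(2 * int j + 1) * (int ((n + j) choose (2 * j + 1)) * int ((2 * j) choose j)) =
    int n * (int ((n - 1) choose j) * int ((n + j) choose j))"
proof -
  have "(2 * int j + 1) * (int ((n + j) choose (2 * j + 1)) * int ((2 * j) choose j)) =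
      (int n - int j) * int (((n + j) choose (2 * j)) * ((2 * j) choose j))"
    using choose_odd_step[of j n] by (simp add: mult_ac)
  also have "\<dots> = (int n * int ((n - 1) choose j)) * int ((n + j) choose j)"
    unfolding choose_absorb_diff[OF assms] choose_mult_choose_add[symmetric] by (simp add: mult_ac)
  finally show ?thesis by (simp only: mult.assoc)
qed

lemma coeff_sum_odd_Apery:
  assumes "n \<ge> 1"
  shows "coeff (\<Sum>k<n. smult (of_nat (2 * k + 1)) (Apery_poly k)) j =
    (of_nat (n * (((n - 1) choose j) * ((n + j) choose j) * ((n + j) choose (2 * j + 1)) * ((2 * j) choose j))) :: rat)"
    (is "?L = of_nat ?R")
proof -
  let ?c = "int ((n + j) choose (2 * j))" and ?b = "int ((2 * j) choose j)"
  let ?S = "\<Sum>k<n. (2 * int k + 1) * int ((k + j) choose (2 * j)) ^ 2"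
  have "?L = of_int (?S * ?b\<^sup>2)"
    by (simp add: coeff_sum coeff_Apery_poly power_mult_distrib sum_distrib_right)
       (intro sum.cong, simp_all add: algebra_simps)
  moreover have "?S * ?b\<^sup>2 = int ?R"
  proof -
    have "(2 * int j + 1) * int ?R = (int n * int ((n - 1) choose j)) * int ((n + j) choose j) *
        ((2 * int j + 1) * int ((n + j) choose (2 * j + 1))) * ?b"
      by (simp add: mult_ac)
    also have "\<dots> = (int n - int j)\<^sup>2 * int ((n choose j) * ((n + j) choose j)) * ?c * ?b"
      unfolding choose_absorb_diff[OF assms] choose_odd_step by (simp add: power2_eq_square mult_ac)
    also have "\<dots> = (int n - int j)\<^sup>2 * ?c\<^sup>2 * ?b\<^sup>2"
      unfolding choose_mult_choose_add by (simp add: power2_eq_square mult_ac)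
    also have "\<dots> = (2 * int j + 1) * (?S * ?b\<^sup>2)"
      unfolding sum_odd_mult_choose_square[symmetric] by (simp only: mult_ac)
    finally show ?thesis by simp
  qed
  ultimately show ?thesis by simp
qed

lemma sum_odd_Apery_poly:
  assumes "n \<ge> 1"
  shows "smult (1 / of_nat n) (\<Sum>k<n. smult (of_nat (2 * k + 1)) (Apery_poly k)) =
    (\<Sum>k<n. monom (of_nat (((n - 1) choose k) * ((n + k) choose k)
       * ((n + k) choose (2 * k + 1)) * ((2 * k) choose k)) :: rat) k)"
proof (rule poly_eqI)
  fix j
  have "coeff (smult (1 / of_nat n) (\<Sum>k<n. smult (of_nat (2 * k + 1)) (Apery_poly k))) j =
    (of_nat (((n - 1) choose j) * ((n + j) choose j) * ((n + j) choose (2 * j + 1)) * ((2 * j) choose j)) :: rat)"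
    using assms unfolding coeff_smult coeff_sum_odd_Apery[OF assms] by simp
  then show "coeff (smult (1 / of_nat n) (\<Sum>k<n. smult (of_nat (2 * k + 1)) (Apery_poly k))) j =
    coeff (\<Sum>k<n. monom (of_nat (((n - 1) choose k) * ((n + k) choose k)
       * ((n + k) choose (2 * k + 1)) * ((2 * k) choose k)) :: rat) k) j"
    using assms unfolding coeff_sum_monom_lessThan by simp
qed

section \<open>Binomial coefficients modulo p\<close>

text \<open>Clearing the factorial leaves a product of linear factors, in which congruences modulo \<open>p\<close> can be
applied factor by factor; the factorial is a unit as long as \<open>j < p\<close>.\<close>

lemma fact_mult_choose_eq_prod: "fact j * int (n choose j) = (\<Prod>i<j. int n - int i)"
proof -
  have "of_int (fact j * int (n choose j)) = (fact j * (of_nat n gchoose j) :: rat)"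
    by (simp add: binomial_gbinomial)
  also have "\<dots> = of_int (\<Prod>i<j. int n - int i)"
    by (simp add: gbinomial_prod_rev atLeast0LessThan)
  finally show ?thesis by (simp only: of_int_eq_iff)
qed

lemma fact_mult_choose_add_eq_prod: "fact j * int ((k + j) choose j) = (\<Prod>i<j. int k + 1 + int i)"
proof -
  have "(\<Prod>i<j. int (k + j) - int i) = (\<Prod>i<j. int k + 1 + int i)"
    by (rule prod.reindex_bij_witness[of _ "\<lambda>i. j - 1 - i" "\<lambda>i. j - 1 - i"]) auto
  then show ?thesis unfolding fact_mult_choose_eq_prod .
qed

lemma central_choose_Suc:
  "int (Suc j) * int ((2 * Suc j) choose Suc j) = 2 * (2 * int j + 1) * int ((2 * j) choose j)"
proof -
  have "Suc j * ((2 * Suc j) choose Suc j) = 2 * Suc j * ((2 * j + 1) choose j)"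
    using Suc_times_binomial[of j "2 * j + 1"] by (simp del: binomial_Suc_Suc)
  moreover have "Suc j * ((2 * j + 1) choose j) = (2 * j + 1) * ((2 * j) choose j)"
    using binomial_absorb_comp[of "2 * j + 1" j] by (simp del: binomial_Suc_Suc)
  ultimately have "Suc j * ((2 * Suc j) choose Suc j) = 2 * (2 * j + 1) * ((2 * j) choose j)"
    by (simp only: mult.assoc)
  from arg_cong[OF this, of int]
  show "int (Suc j) * int ((2 * Suc j) choose Suc j) = 2 * (2 * int j + 1) * int ((2 * j) choose j)"
    by (simp only: of_nat_mult of_nat_add of_nat_numeral of_nat_1)
qed

lemma fact_mult_central_choose: "fact j * int ((2 * j) choose j) = 2 ^ j * (\<Prod>i<j. 2 * int i + 1)"
proof (induction j)
  case (Suc j)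
  have "fact (Suc j) * int ((2 * Suc j) choose Suc j) = fact j * (int (Suc j) * int ((2 * Suc j) choose Suc j))"
    by (simp only: fact_Suc of_nat_mult of_nat_fact mult_ac)
  also have "\<dots> = 2 * (2 * int j + 1) * (fact j * int ((2 * j) choose j))"
    unfolding central_choose_Suc by (simp only: mult_ac)
  finally show ?case unfolding Suc by simp
qed simp

context prime_modulus
begin

lemma coprime_fact: "j < p \<Longrightarrow> coprime (fact j) (int p ^ m)"
proof -
  assume "j < p"
  then have "\<not> p dvd fact j" using prime by (simp add: prime_dvd_fact_iff)
  then have "\<not> int p dvd fact j" by (metis int_dvd_int_iff of_nat_fact)
  then have "coprime (int p) (fact j)" using prime_int by (simp add: prime_imp_coprime)
  then show ?thesis by (simp add: coprime_commute)
qed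

lemma coprime_int: "0 < j \<Longrightarrow> j < p \<Longrightarrow> coprime (int j) (int p ^ m)"
  using not_dvd_less[of j] prime prime_imp_coprime coprime_commute by auto

lemma cong_cancel_fact:
  assumes "[fact j * a = fact j * b] (mod int p ^ m)" "j < p"
  shows "[a = b] (mod int p ^ m)"
  using assms coprime_fact cong_mult_lcancel by blast

text \<open>The linear factors satisfy \<open>p - 1 - k - i \<equiv> - (k + 1 + i)\<close> modulo \<open>p\<close>.\<close>

lemma choose_reflect:
  assumes "k < p" "j < p"
  shows "[int ((p - 1 - k) choose j) = (- 1) ^ j * int ((k + j) choose j)] (mod int p)"
proof -
  have "int (p - 1 - k) = int p - 1 - int k" using assms by simp
  then have "fact j * int ((p - 1 - k) choose j) = (\<Prod>i<j. int p - 1 - int k - int i)"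
    unfolding fact_mult_choose_eq_prod by simp
  also have "[\<dots> = (\<Prod>i<j. - 1 * (int k + 1 + int i))] (mod int p)"
    by (rule cong_prod) (simp add: cong_iff_dvd_diff)
  also have "(\<Prod>i<j. - 1 * (int k + 1 + int i)) = (- 1) ^ j * (\<Prod>i<j. int k + 1 + int i)"
    unfolding prod.distrib by simp
  also have "\<dots> = fact j * ((- 1) ^ j * int ((k + j) choose j))"
    by (simp flip: fact_mult_choose_add_eq_prod)
  finally show ?thesis using cong_cancel_fact[of j _ _ 1] assms(2) by simp
qed

text \<open>Reflection exchanges the two binomial coefficients in \<open>(k choose j) * (k + j choose j)\<close>, up to
signs that cancel.\<close>

lemma coeff_Apery_poly_reflect:
  assumes "k < p"
  shows "[coeff (Apery_poly (p - 1 - k)) j = coeff (Apery_poly k) j] (mod int p)"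
proof (cases "j < p")
  case True
  have 1: "[int ((p - 1 - k) choose j) = (- 1) ^ j * int ((k + j) choose j)] (mod int p)"
    using choose_reflect assms True .
  have "[int ((p - 1 - (p - 1 - k)) choose j) = (- 1) ^ j * int ((p - 1 - k + j) choose j)] (mod int p)"
    using assms True by (intro choose_reflect) auto
  then have "[int (k choose j) = (- 1) ^ j * int ((p - 1 - k + j) choose j)] (mod int p)"
    using assms by simp
  from cong_mult[OF 1 cong_sym[OF this]]
  have "[(- 1) ^ j * int (((p - 1 - k) choose j) * ((p - 1 - k + j) choose j)) =
    (- 1) ^ j * int ((k choose j) * ((k + j) choose j))] (mod int p)" by (simp add: mult_ac)
  from cong_pow[OF this, of 2] show ?thesis
    unfolding coeff_Apery_poly' by (simp add: power_mult_distrib flip: power_mult)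
qed (use assms in \<open>simp add: coeff_Apery_poly' binomial_eq_0\<close>)

lemma poly_Apery_reflect:
  assumes "k < p"
  shows "[poly (Apery_poly (p - 1 - k)) x = poly (Apery_poly k) x] (mod int p)"
proof -
  have deg: "degree (Apery_poly n :: int poly) \<le> n" for n
    by (rule degree_le) (simp add: coeff_Apery_poly' binomial_eq_0)
  have poly: "poly (Apery_poly n) x = (\<Sum>j<p. coeff (Apery_poly n) j * x ^ j)" if "n < p" for n
  proof -
    have "poly (Apery_poly n) x = (\<Sum>j\<le>p - 1. coeff (Apery_poly n) j * x ^ j)"
      unfolding poly_altdef using deg[of n] that
      by (intro sum.mono_neutral_left) (auto intro: coeff_eq_0)
    moreover have "{..p - 1} = {..<p}" using p_pos by auto
    ultimately show ?thesis by simp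
  qed
  have "p - 1 - k < p" using p_pos by linarith
  then show ?thesis unfolding poly[OF assms] poly[OF \<open>p - 1 - k < p\<close>]
    using assms by (intro cong_sum cong_mult coeff_Apery_poly_reflect) auto
qed

text \<open>Under \<open>k \<mapsto> p - 1 - k\<close> the Apery numbers and the sign are unchanged and \<open>2 * k + 1\<close> changes sign.
Twice the sum is therefore zero, which settles odd \<open>p\<close>; for \<open>p = 2\<close> both summands are odd.\<close>

lemma sum_odd_Apery_num_power_cong_0:
  assumes "\<epsilon> \<in> {1, - 1 :: int}" "m \<ge> 1"
  shows "[(\<Sum>k<p. int (2 * k + 1) * \<epsilon> ^ k * Apery_num k ^ m) = 0] (mod int p)"
proof (cases "p = 2")
  case True
  have "Apery_num 0 = 1" "Apery_num 1 = 5"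
    by (simp_all add: Apery_num_def Apery_poly_def poly_monom power2_eq_square)
  then have "(\<Sum>k<p. int (2 * k + 1) * \<epsilon> ^ k * Apery_num k ^ m) = 1 + 3 * \<epsilon> * 5 ^ m"
    unfolding True numeral_2_eq_2 sum.lessThan_Suc by simp
  moreover have "odd (3 * \<epsilon> * 5 ^ m)" using assms(1) by auto
  ultimately show ?thesis unfolding True cong_0_iff by simp
next
  case False
  then have odd: "odd p" using prime primes_dvd_imp_eq two_is_prime_nat by blast
  let ?f = "\<lambda>k. int (2 * k + 1) * \<epsilon> ^ k * Apery_num k ^ m"
  have "(\<Sum>k<p. ?f k) = (\<Sum>k<p. ?f (p - 1 - k))"
    by (rule sum.reindex_bij_witness[of _ "\<lambda>k. p - 1 - k" "\<lambda>k. p - 1 - k"]) auto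
  also have "[\<dots> = (\<Sum>k<p. - ?f k)] (mod int p)"
  proof (rule cong_sum)
    fix k assume "k \<in> {..<p}"
    then have k: "k < p" by simp
    have "int (2 * (p - 1 - k) + 1) - - int (2 * k + 1) = int p * 2"
      using k by (simp add: of_nat_diff)
    then have "[int (2 * (p - 1 - k) + 1) = - int (2 * k + 1)] (mod int p)"
      unfolding cong_iff_dvd_diff by simp
    moreover have "\<epsilon> ^ (p - 1 - k) = \<epsilon> ^ k"
    proof -
      have "even (p - 1 - k) = even k" using odd k by presburger
      then have "(- 1 :: int) ^ (p - 1 - k) = (- 1) ^ k" by (simp only: minus_one_power_iff)
      then show ?thesis using assms(1) by force
    qed
    moreover have "[Apery_num (p - 1 - k) ^ m = Apery_num k ^ m] (mod int p)"
      unfolding Apery_num_def using k by (intro cong_pow poly_Apery_reflect)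
    ultimately have "[int (2 * (p - 1 - k) + 1) * \<epsilon> ^ (p - 1 - k) * Apery_num (p - 1 - k) ^ m =
      - int (2 * k + 1) * \<epsilon> ^ k * Apery_num k ^ m] (mod int p)"
      by (metis cong_mult cong_refl)
    then show "[?f (p - 1 - k) = - ?f k] (mod int p)" by (simp only: mult_minus_left)
  qed
  also have "(\<Sum>k<p. - ?f k) = - (\<Sum>k<p. ?f k)" by (rule sum_negf)
  finally have "int p dvd 2 * (\<Sum>k<p. ?f k)"
    unfolding cong_iff_dvd_diff by simp
  moreover have "\<not> int p dvd 2"
    using False prime by (metis int_dvd_int_iff of_nat_numeral primes_dvd_imp_eq two_is_prime_nat)
  ultimately have "int p dvd (\<Sum>k<p. ?f k)" using prime_dvd_mult_iff[OF prime_int] by blast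
  then show ?thesis by (simp only: cong_0_iff)
qed

end

section \<open>Alternating and plain sums of squared binomial coefficients\<close>

text \<open>The certificate was found by creative telescoping: apart from \<open>(-1) ^ k\<close>, the summand on the left is
\<open>- (g (k + 1) + g k)\<close> for \<open>g k = (k - j) ^ 2 * q k * c k\<close> with an even quadratic polynomial \<open>q\<close>,
so the alternating sum collapses to \<open>(-1) ^ n * g n\<close>, because \<open>g 0 = 0\<close>. The factor in front clears the denominators of \<open>q\<close>.\<close>

lemma sum_alternating_choose_square_step:
  fixes j n :: nat
  defines "c \<equiv> \<lambda>k. int ((k + j) choose (2 * j)) ^ 2"
    and "c' \<equiv> \<lambda>k. int ((k + Suc j) choose (2 * Suc j)) ^ 2"
  shows "(2 * int j + 1)\<^sup>2 * (int j + 1) *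
      (8 * (int j + 1) * (\<Sum>k<n. (- 1) ^ k * c' k) - (2 * int j + 1) * (\<Sum>k<n. (- 1) ^ k * c k)) =
    (- 1) ^ n * ((int n - int j)\<^sup>2 * ((3 * int j + 2) * (int j + 1) - int n ^ 2) * c n)"
proof (induction n)
  case 0
  show ?case by (cases "j = 0") (simp_all add: c_def binomial_eq_0)
next
  case (Suc n)
  let ?D = "(2 * int j + 1)\<^sup>2 * (int j + 1)"
  have "(2 * int j + 1) * (2 * int j + 2) * int ((n + Suc j) choose (2 * Suc j)) =
      (int n + int j + 1) * (int n - int j) * int ((n + j) choose (2 * j))"
  proof -
    have "Suc (2 * j + 1) * ((n + Suc j) choose (Suc (2 * j + 1))) = (n + Suc j) * ((n + j) choose (2 * j + 1))"
      using Suc_times_binomial[of "2 * j + 1" "n + j"] by simp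
    from arg_cong[OF this, of int]
    have "(2 * int j + 2) * int ((n + Suc j) choose (2 * Suc j)) = (int n + int j + 1) * int ((n + j) choose (2 * j + 1))"
      by (simp del: binomial_Suc_Suc add: algebra_simps)
    then have "(2 * int j + 1) * (2 * int j + 2) * int ((n + Suc j) choose (2 * Suc j)) =
        (int n + int j + 1) * ((2 * int j + 1) * int ((n + j) choose (2 * j + 1)))"
      by (simp only: mult_ac)
    then show ?thesis unfolding choose_odd_step by (simp only: mult_ac)
  qed
  from arg_cong[OF this, of "\<lambda>x. x\<^sup>2"]
  \<comment> \<open>Both squares are expressed by \<open>c n\<close>, which reduces the claim to a polynomial identity in \<open>n\<close> and \<open>j\<close>.\<close>
  have c': "4 * ((2 * int j + 1)\<^sup>2 * (int j + 1)\<^sup>2 * c' n) = ((int n + int j + 1)\<^sup>2 * (int n - int j)\<^sup>2) * c n"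
    by (simp add: c_def c'_def power_mult_distrib algebra_simps power2_eq_square)
  have c: "(int n + 1 - int j)\<^sup>2 * c (Suc n) = (int n + 1 + int j)\<^sup>2 * c n"
    unfolding c_def using choose_shift_square[of n j] by simp
  let ?R = "\<lambda>n. (int n - int j)\<^sup>2 * ((3 * int j + 2) * (int j + 1) - int n ^ 2) * c n"
  have "?R (Suc n) = ((int n + 1 - int j)\<^sup>2 * c (Suc n)) * ((3 * int j + 2) * (int j + 1) - (int n + 1) ^ 2)"
    by (simp add: algebra_simps)
  also have "\<dots> = (int n + 1 + int j)\<^sup>2 * ((3 * int j + 2) * (int j + 1) - (int n + 1) ^ 2) * c n"
    unfolding c by (simp only: mult_ac)
  finally have R: "?R (Suc n) = (int n + 1 + int j)\<^sup>2 * ((3 * int j + 2) * (int j + 1) - (int n + 1) ^ 2) * c n" .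
  have D: "?D * (8 * (int j + 1) * c' n - (2 * int j + 1) * c n) =
      (2 * ((int n + int j + 1)\<^sup>2 * (int n - int j)\<^sup>2) - ?D * (2 * int j + 1)) * c n"
  proof -
    have "?D * (8 * (int j + 1) * c' n) = 2 * (4 * ((2 * int j + 1)\<^sup>2 * (int j + 1)\<^sup>2 * c' n))"
      by (simp add: algebra_simps power2_eq_square)
    then show ?thesis unfolding c' by (simp add: algebra_simps)
  qed
  have "?D * (8 * (int j + 1) * c' n - (2 * int j + 1) * c n) + ?R n + ?R (Suc n) = 0"
  proof -
    have "2 * ((int n + int j + 1)\<^sup>2 * (int n - int j)\<^sup>2) - ?D * (2 * int j + 1)
       + (int n - int j)\<^sup>2 * ((3 * int j + 2) * (int j + 1) - int n ^ 2)
       + (int n + 1 + int j)\<^sup>2 * ((3 * int j + 2) * (int j + 1) - (int n + 1) ^ 2) = 0"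
    proof -
      have "2 * ((x + y + 1)\<^sup>2 * (x - y)\<^sup>2) - (2 * y + 1)\<^sup>2 * (y + 1) * (2 * y + 1)
         + (x - y)\<^sup>2 * ((3 * y + 2) * (y + 1) - x ^ 2)
         + (x + 1 + y)\<^sup>2 * ((3 * y + 2) * (y + 1) - (x + 1) ^ 2) = 0" for x y :: int
        by (simp add: power2_eq_square algebra_simps)
      then show ?thesis .
    qed
    then have "(2 * ((int n + int j + 1)\<^sup>2 * (int n - int j)\<^sup>2) - ?D * (2 * int j + 1)
       + (int n - int j)\<^sup>2 * ((3 * int j + 2) * (int j + 1) - int n ^ 2)
       + (int n + 1 + int j)\<^sup>2 * ((3 * int j + 2) * (int j + 1) - (int n + 1) ^ 2)) * c n = 0"
      by simp
    then show ?thesis unfolding D R by (simp only: distrib_right)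
  qed
  then have step: "?R (Suc n) = - (?D * (8 * (int j + 1) * c' n - (2 * int j + 1) * c n) + ?R n)"
    by linarith
  have "?D * (8 * (int j + 1) * (\<Sum>k<Suc n. (- 1) ^ k * c' k) - (2 * int j + 1) * (\<Sum>k<Suc n. (- 1) ^ k * c k))
    = ?D * (8 * (int j + 1) * (\<Sum>k<n. (- 1) ^ k * c' k) - (2 * int j + 1) * (\<Sum>k<n. (- 1) ^ k * c k))
      + (- 1) ^ n * (?D * (8 * (int j + 1) * c' n - (2 * int j + 1) * c n))"
    unfolding sum.lessThan_Suc by (simp only: distrib_left right_diff_distrib) (simp add: mult_ac)
  also have "\<dots> = (- 1) ^ n * ?R n + (- 1) ^ n * (?D * (8 * (int j + 1) * c' n - (2 * int j + 1) * c n))"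
    unfolding Suc.IH ..
  also have "\<dots> = (- 1) ^ Suc n * ?R (Suc n)" unfolding step by (simp add: algebra_simps)
  finally show ?case .
qed

text \<open>Vandermonde's identity for \<open>n = m + (n - m)\<close> followed by regrouping; it expands the square in the
basis whose sums over \<open>n\<close> are single binomial coefficients.\<close>

lemma choose_square_eq_sum:
  "((n choose m) ^ 2 :: nat) = (\<Sum>i\<le>m. (m choose i) * ((m + i) choose m) * (n choose (m + i)))"
proof (cases "m \<le> n")
  case True
  have "n choose m = (\<Sum>i\<le>m. (m choose i) * ((n - m) choose (m - i)))"
    using vandermonde[of m "n - m" m] True by simp
  also have "\<dots> = (\<Sum>i\<le>m. (m choose i) * ((n - m) choose i))"
    by (rule sum.reindex_bij_witness[of _ "\<lambda>i. m - i" "\<lambda>i. m - i"])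
       (auto simp: binomial_symmetric[symmetric])
  finally have "(n choose m)\<^sup>2 = (\<Sum>i\<le>m. (m choose i) * ((n choose m) * ((n - m) choose i)))"
    by (simp add: power2_eq_square sum_distrib_left mult_ac)
  also have "\<dots> = (\<Sum>i\<le>m. (m choose i) * ((m + i) choose m) * (n choose (m + i)))"
  proof (rule sum.cong)
    fix i
    show "(m choose i) * ((n choose m) * ((n - m) choose i)) = (m choose i) * ((m + i) choose m) * (n choose (m + i))"
    proof (cases "m + i \<le> n")
      case True
      then show ?thesis using choose_mult[of m "m + i" n] by (simp add: mult_ac)
    next
      case False
      then have "(n - m) choose i = 0" "n choose (m + i) = 0" using \<open>m \<le> n\<close>
        by (simp_all add: binomial_eq_0)
      then show ?thesis by (simp only: mult_0_right)
    qed
  qed simp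
  finally show ?thesis .
qed (simp add: binomial_eq_0)

lemma multinomial4_eq: "multinomial4 k = ((2 * k) choose k)\<^sup>2 * ((4 * k) choose (2 * k))"
proof -
  have 2: "fact k * fact k * ((2 * k) choose k) = fact (2 * k)"
    using binomial_fact_lemma[of k "2 * k"] by simp
  have 4: "fact (2 * k) * fact (2 * k) * ((4 * k) choose (2 * k)) = fact (4 * k)"
    using binomial_fact_lemma[of "2 * k" "4 * k"] by simp
  have "multinomial4 k * fact k ^ 4 = (((2 * k) choose k)\<^sup>2 * ((4 * k) choose (2 * k))) * fact k ^ 4"
    unfolding multinomial4_exact 4[symmetric] 2[symmetric]
    by (simp add: power2_eq_square power4_eq_xxxx mult_ac)
  then show ?thesis by simp
qed

context prime_modulus
begin

text \<open>The numerator contains the factor \<open>p\<close>, the denominator does not.\<close>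

lemma dvd_choose:
  assumes "i < p + m" "p \<le> i" "m < p"
  shows "p dvd i choose m"
proof (cases "m \<le> i")
  case True
  have "p dvd fact m * fact (i - m) * (i choose m)"
    using binomial_fact_lemma[OF True] assms(2) prime by (simp add: prime_dvd_fact_iff)
  moreover have "\<not> p dvd fact m" "\<not> p dvd fact (i - m)"
    using assms prime True by (simp_all add: prime_dvd_fact_iff less_diff_conv2)
  ultimately show ?thesis using prime by (simp add: prime_dvd_mult_iff)
qed (simp add: binomial_eq_0)

lemma square_cong_0: "p dvd n \<Longrightarrow> [int n ^ 2 = 0] (mod int p ^ 2)"
  unfolding cong_0_iff by (simp add: dvd_power_same)

lemma central_choose_square_cong_0: "p \<le> 2 * j \<Longrightarrow> j < p \<Longrightarrow> [int ((2 * j) choose j) ^ 2 = 0] (mod int p ^ 2)"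
  by (intro square_cong_0 dvd_choose) auto

text \<open>The shifted sum gains only terms with \<open>p \<le> i < p + j\<close>, where \<open>p\<close> divides \<open>i choose 2 * j\<close>, and
loses only terms with \<open>i < j\<close>, which are zero.\<close>

lemma sum_choose_square_shift:
  assumes "\<epsilon> \<in> {1, - 1 :: int}" "2 * j < p"
  shows "[(\<Sum>k<p. \<epsilon> ^ k * int ((k + j) choose (2 * j)) ^ 2) = \<epsilon> ^ j * (\<Sum>k<p. \<epsilon> ^ k * int (k choose (2 * j)) ^ 2)] (mod int p ^ 2)"
proof -
  let ?f = "\<lambda>i. \<epsilon> ^ i * int (i choose (2 * j)) ^ 2"
  have \<epsilon>: "\<epsilon> ^ k = \<epsilon> ^ j * \<epsilon> ^ (k + j)" for k
    using assms(1) by (auto simp: power_add simp flip: power_mult_distrib)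
  have "(\<Sum>k<p. \<epsilon> ^ k * int ((k + j) choose (2 * j)) ^ 2) = \<epsilon> ^ j * (\<Sum>k<p. ?f (k + j))"
    unfolding sum_distrib_left by (rule sum.cong[OF refl], subst \<epsilon>) (simp only: mult.assoc)
  also have "(\<Sum>k<p. ?f (k + j)) = (\<Sum>i\<in>{j..<p + j}. ?f i)"
    using sum.shift_bounds_nat_ivl[of ?f 0 j p] by (simp add: atLeast0LessThan)
  also have "\<dots> = (\<Sum>i\<in>{0..<p + j}. ?f i)"
    by (rule sum.mono_neutral_left) (auto simp: binomial_eq_0)
  also have "\<dots> = (\<Sum>i<p. ?f i) + (\<Sum>i\<in>{p..<p + j}. ?f i)"
    by (subst sum.atLeastLessThan_concat[of 0 p "p + j", symmetric]) (auto simp: atLeast0LessThan)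
  also have "[\<epsilon> ^ j * ((\<Sum>i<p. ?f i) + (\<Sum>i\<in>{p..<p + j}. ?f i)) = \<epsilon> ^ j * ((\<Sum>i<p. ?f i) + (\<Sum>i\<in>{p..<p + j}. 0))] (mod int p ^ 2)"
  proof (intro cong_scalar_left cong_add cong_refl cong_sum)
    fix i assume i: "i \<in> {p..<p + j}"
    have "[\<epsilon> ^ i * int (i choose (2 * j)) ^ 2 = \<epsilon> ^ i * 0] (mod int p ^ 2)"
      using i assms by (intro cong_scalar_left square_cong_0 dvd_choose) auto
    then show "[?f i = 0] (mod int p ^ 2)" by simp
  qed
  finally show ?thesis by simp
qed

lemma choose_p_minus_1_cong:
  assumes "j < p"
  shows "[int ((p - 1) choose j) = (- 1) ^ j] (mod int p)"
  using choose_reflect[of 0 j] assms p_pos by simp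

text \<open>The sum of \<open>k choose r\<close> over \<open>k < p\<close> is \<open>p choose (r + 1)\<close>, which is divisible by \<open>p\<close> unless
\<open>r = p - 1\<close>.\<close>

lemma sum_choose_square_cong:
  assumes "m < p"
  shows "[(\<Sum>k<p. int (k choose m) ^ 2) = int (m choose (p - 1 - m)) * int ((p - 1) choose m)] (mod int p)"
proof -
  let ?c = "\<lambda>i. int (m choose i) * int ((m + i) choose m)"
  have "(\<Sum>k<p. int (k choose m) ^ 2) = (\<Sum>k<p. \<Sum>i\<le>m. ?c i * int (k choose (m + i)))"
    by (rule sum.cong) (simp_all only: choose_square_eq_sum of_nat_sum of_nat_mult flip: of_nat_power)
  also have "\<dots> = (\<Sum>i\<le>m. ?c i * (\<Sum>k<p. int (k choose (m + i))))"
    by (subst sum.swap) (simp only: sum_distrib_left)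
  also have "\<dots> = (\<Sum>i\<le>m. ?c i * int (p choose Suc (m + i)))"
  proof -
    have "(\<Sum>k<p. int (k choose r)) = int (p choose Suc r)" for r
    proof -
      have "{..<p} = {..p - 1}" using p_pos by auto
      then show ?thesis using sum_choose_upper[of r "p - 1"] p_pos by (simp flip: of_nat_sum)
    qed
    then show ?thesis by simp
  qed
  also have "[\<dots> = (\<Sum>i\<le>m. if i = p - 1 - m then ?c i else 0)] (mod int p)"
  proof (rule cong_sum)
    fix i
    show "[?c i * int (p choose Suc (m + i)) = (if i = p - 1 - m then ?c i else 0)] (mod int p)"
    proof (cases "i = p - 1 - m")
      case True
      then have "Suc (m + i) = p" using assms by simp
      then show ?thesis using True by simp
    next
      case False
      have "p dvd p choose Suc (m + i)"
      proof (cases "Suc (m + i) < p")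
        case True
        then show ?thesis by (intro dvd_choose) auto
      next
        case f: False
        then have "p < Suc (m + i)" using False by simp
        then show ?thesis by (simp add: binomial_eq_0)
      qed
      then show ?thesis using False by (simp add: cong_0_iff)
    qed
  qed
  also have "(\<Sum>i\<le>m. if i = p - 1 - m then ?c i else 0) = ?c (p - 1 - m)"
    by (auto simp: binomial_eq_0)
  also have "\<dots> = int (m choose (p - 1 - m)) * int ((p - 1) choose m)" using assms by simp
  finally show ?thesis .
qed

end

locale odd_prime = prime_modulus +
  fixes h :: nat
  assumes p_eq: "p = 2 * h + 1"
begin

lemma h_pos: "h > 0"
  using p_gt_1 p_eq by simp

lemma p_gt_2: "p > 2"
  using h_pos p_eq by simp

lemma odd_p: "odd p" using p_eq by simp

text \<open>Both sides satisfy the recurrence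
\<open>8 * (j + 1) * T (j + 1) \<equiv> (2 * j + 1) * T j\<close>, up to the factor \<open>16 ^ j\<close>. The boundary term at
\<open>n = p\<close> is a multiple of the square of \<open>(p - j) * (p + j choose 2 * j)\<close>, and that number is
divisible by \<open>p\<close>: for \<open>j = 0\<close> because of the first factor, otherwise because of the second.\<close>

lemma sum_alternating_choose_square:
  "2 * j < p \<Longrightarrow> [16 ^ j * (\<Sum>k<p. (- 1) ^ k * int ((k + j) choose (2 * j)) ^ 2) = int ((2 * j) choose j)] (mod int p ^ 2)"
proof (induction j)
  case 0
  have "(\<Sum>k<2 * h + 1. (- 1 :: int) ^ k) = 1" by (induction h) simp_all
  then show ?case by (simp add: p_eq del: sum.lessThan_Suc)
next
  case (Suc j)
  let ?T = "\<lambda>j. \<Sum>k<p. (- 1) ^ k * int ((k + j) choose (2 * j)) ^ 2"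
  have lt: "2 * j + 1 < p" "j + 1 < p" using Suc.prems by auto
  have "int p dvd (int p - int j) * int ((p + j) choose (2 * j))"
  proof (cases "j = 0")
    case False
    then have "p dvd (p + j) choose (2 * j)" using lt by (intro dvd_choose) auto
    then show ?thesis by simp
  qed simp
  then have "int p ^ 2 dvd ((int p - int j) * int ((p + j) choose (2 * j)))\<^sup>2"
    by (rule dvd_power_same)
  from dvd_mult[OF this, of "(- 1) ^ p * ((3 * int j + 2) * (int j + 1) - int p ^ 2)"]
  have "int p ^ 2 dvd (- 1) ^ p * ((int p - int j)\<^sup>2 * ((3 * int j + 2) * (int j + 1) - int p ^ 2) * int ((p + j) choose (2 * j)) ^ 2)"
    by (simp only: power_mult_distrib mult_ac)
  then have "int p ^ 2 dvd (2 * int j + 1)\<^sup>2 * (int j + 1) * (8 * (int j + 1) * ?T (Suc j) - (2 * int j + 1) * ?T j)"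
    unfolding sum_alternating_choose_square_step .
  moreover have "coprime (int p ^ 2) ((2 * int j + 1)\<^sup>2 * (int j + 1))"
  proof -
    have "coprime (int (2 * j + 1)) (int p ^ 2)" "coprime (int (j + 1)) (int p ^ 2)"
      using lt coprime_int[of "2 * j + 1" 2] coprime_int[of "j + 1" 2] by simp_all
    then have "coprime ((2 * int j + 1)\<^sup>2 * (int j + 1)) (int p ^ 2)"
      by (simp add: add.commute)
    then show ?thesis by (simp only: coprime_commute)
  qed
  ultimately have step: "[8 * (int j + 1) * ?T (Suc j) = (2 * int j + 1) * ?T j] (mod int p ^ 2)"
    unfolding cong_iff_dvd_diff using coprime_dvd_mult_right_iff by blast
  have eq: "2 * 16 ^ j * (8 * (int j + 1) * a) = int (Suc j) * (16 ^ Suc j * a)"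
    "2 * 16 ^ j * ((2 * int j + 1) * a) = 2 * (2 * int j + 1) * (16 ^ j * a)" for a
    by (simp_all add: algebra_simps)
  from cong_scalar_left[OF step, of "2 * 16 ^ j"]
  have "[int (Suc j) * (16 ^ Suc j * ?T (Suc j)) = 2 * (2 * int j + 1) * (16 ^ j * ?T j)] (mod int p ^ 2)"
    unfolding eq .
  also have "[2 * (2 * int j + 1) * (16 ^ j * ?T j) = 2 * (2 * int j + 1) * int ((2 * j) choose j)] (mod int p ^ 2)"
    using lt by (intro cong_scalar_left Suc.IH) auto
  also have "2 * (2 * int j + 1) * int ((2 * j) choose j) = int (Suc j) * int ((2 * Suc j) choose Suc j)"
    by (simp only: central_choose_Suc)
  finally show ?case
    using coprime_int[of "Suc j" 2] lt cong_mult_lcancel[of "int (Suc j)" "int p ^ 2"] by simp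
qed

text \<open>This is \<open>(2 * j choose j) = (-4) ^ j * (-1/2 choose j)\<close> with \<open>h\<close> in place of \<open>-1/2\<close>, to which it is
congruent modulo \<open>p\<close>.\<close>

lemma central_choose_cong:
  assumes "j < p"
  shows "[int ((2 * j) choose j) = (- 4) ^ j * int (h choose j)] (mod int p)"
proof -
  have "fact j * ((- 4) ^ j * int (h choose j)) = (- 4) ^ j * (\<Prod>i<j. int h - int i)"
    by (simp flip: fact_mult_choose_eq_prod)
  also have "\<dots> = (\<Prod>i<j. 2 * (2 * int i + 1 - int p))"
  proof -
    have "2 * (2 * int i + 1 - int p) = - 4 * (int h - int i)" for i by (simp add: p_eq)
    then show ?thesis by (simp only: prod.distrib prod_constant card_lessThan)
  qed
  also have "[\<dots> = (\<Prod>i<j. 2 * (2 * int i + 1))] (mod int p)"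
    by (rule cong_prod) (simp add: cong_iff_dvd_diff)
  also have "(\<Prod>i<j. 2 * (2 * int i + 1)) = fact j * int ((2 * j) choose j)"
    unfolding fact_mult_central_choose prod.distrib by simp
  finally show ?thesis using cong_sym[OF cong_cancel_fact[of j _ _ 1]] assms by simp
qed

text \<open>By the preceding congruence both sides are multiples of \<open>h choose k = h choose (h - k)\<close>.\<close>

lemma central_choose_reflect:
  assumes "k \<le> h"
  shows "[16 ^ k * int ((2 * (h - k)) choose (h - k)) = (- 4) ^ h * int ((2 * k) choose k)] (mod int p)"
proof -
  have h: "h < p" by (simp add: p_eq)
  have "[int ((2 * (h - k)) choose (h - k)) = (- 4) ^ (h - k) * int (h choose (h - k))] (mod int p)"
    using h assms by (intro central_choose_cong) auto
  from cong_scalar_left[OF this, of "16 ^ k"]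
  have "[16 ^ k * int ((2 * (h - k)) choose (h - k)) = 16 ^ k * (- 4) ^ (h - k) * int (h choose k)] (mod int p)"
    using assms by (simp add: mult.assoc flip: binomial_symmetric)
  also have "16 ^ k * (- 4) ^ (h - k) * int (h choose k) = (- 4) ^ h * ((- 4) ^ k * int (h choose k))"
  proof -
    have "(16 :: int) ^ k = (- 4) ^ k * (- 4) ^ k" by (simp flip: power_mult_distrib)
    moreover have "(- 4 :: int) ^ h = (- 4) ^ k * (- 4) ^ (h - k)" using assms by (simp flip: power_add)
    ultimately show ?thesis by (simp only: mult_ac)
  qed
  also have "[\<dots> = (- 4) ^ h * int ((2 * k) choose k)] (mod int p)"
    using assms h by (intro cong_scalar_left cong_sym[OF central_choose_cong]) auto
  finally show ?thesis .
qed

lemma sixteen_power_h: "[16 ^ h = 1] (mod int p)"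
proof -
  have "\<not> int p dvd 2"
    using p_gt_2 prime by (metis int_dvd_int_iff of_nat_numeral nat_dvd_not_less zero_less_numeral)
  have "\<not> int p dvd 4"
    using \<open>\<not> int p dvd 2\<close> prime_int prime_dvd_mult_iff[of "int p" 2 2] by simp
  then have "[4 ^ (p - 1) = 1] (mod int p)"
    using prime fermat_theorem[of p 4] by (metis cong_int_iff int_dvd_int_iff of_nat_1 of_nat_numeral of_nat_power)
  moreover have "(4 :: int) ^ (p - 1) = 16 ^ h" by (simp add: p_eq power_mult)
  ultimately show ?thesis by simp
qed

lemma multinomial4_cong_0:
  assumes "h < k" "k < p"
  shows "[int (multinomial4 k) = 0] (mod int p)"
proof -
  have "p dvd (2 * k) choose k" using assms p_eq by (intro dvd_choose) auto
  then show ?thesis unfolding multinomial4_eq cong_0_iff by (simp add: power2_eq_square)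
qed

lemma multinomial4_cong:
  assumes "k \<le> h"
  shows "[256 ^ k * (int ((2 * (h - k)) choose (h - k)) ^ 2 * int ((2 * (h - k)) choose (2 * k))) = int (multinomial4 k)] (mod int p)"
proof -
  let ?a = "int ((2 * (h - k)) choose (h - k))" and ?b = "int ((2 * (h - k)) choose (2 * k))"
  have "256 ^ k * (?a ^ 2 * ?b) = (16 ^ k * ?a) ^ 2 * ?b"
  proof -
    have "(256 :: int) ^ k = (16 ^ 2) ^ k" by simp
    also have "\<dots> = (16 ^ k) ^ 2" by (simp only: mult.commute flip: power_mult)
    finally show ?thesis by (simp only: power_mult_distrib mult.assoc)
  qed
  also have "[\<dots> = ((- 4) ^ h * int ((2 * k) choose k)) ^ 2 * int ((4 * k) choose (2 * k))] (mod int p)"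
  proof (rule cong_mult)
    have "2 * (h - k) = p - 1 - 2 * k" using p_eq by simp
    moreover have "[int ((p - 1 - 2 * k) choose (2 * k)) = (- 1) ^ (2 * k) * int ((2 * k + 2 * k) choose (2 * k))] (mod int p)"
      using assms p_eq by (intro choose_reflect) auto
    ultimately show "[?b = int ((4 * k) choose (2 * k))] (mod int p)" by simp
  qed (intro cong_pow central_choose_reflect assms)
  also have "((- 4) ^ h * int ((2 * k) choose k)) ^ 2 * int ((4 * k) choose (2 * k)) = 16 ^ h * int (multinomial4 k)"
  proof -
    have "((- 4 :: int) ^ h) ^ 2 = ((- 4) ^ 2) ^ h" by (simp only: mult.commute flip: power_mult)
    then have "((- 4 :: int) ^ h) ^ 2 = 16 ^ h" by simp
    then show ?thesis unfolding multinomial4_eq power_mult_distrib by simp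
  qed
  also have "[\<dots> = 1 * int (multinomial4 k)] (mod int p)"
    by (intro cong_scalar_right sixteen_power_h)
  finally show ?thesis by simp
qed

end

section \<open>Sums of Apery polynomials modulo the square of a prime\<close>

lemma poly_cong_coeff:
  fixes f g :: "int poly"
  assumes "\<And>j. [coeff f j = coeff g j] (mod m)"
  shows "[poly f x = poly g x] (mod m)"
proof -
  have "poly f x = (\<Sum>j\<le>max (degree f) (degree g). coeff f j * x ^ j)"
    unfolding poly_altdef by (rule sum.mono_neutral_left) (auto intro: coeff_eq_0)
  moreover have "poly g x = (\<Sum>j\<le>max (degree f) (degree g). coeff g j * x ^ j)"
    unfolding poly_altdef by (rule sum.mono_neutral_left) (auto intro: coeff_eq_0)
  ultimately show ?thesis by (simp only:) (intro cong_sum cong_mult assms cong_refl)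
qed

context odd_prime
begin

lemma coeff_sum_smult_Apery:
  "coeff (\<Sum>k<p. smult (\<epsilon> ^ k) (Apery_poly k)) j =
    (of_nat ((2 * j) choose j))\<^sup>2 * (\<Sum>k<p. \<epsilon> ^ k * of_nat ((k + j) choose (2 * j)) ^ 2)"
  by (simp add: coeff_sum coeff_Apery_poly sum_distrib_left power_mult_distrib mult_ac)

lemma coeff_sum_smult_W:
  "coeff (\<Sum>k<p. smult (\<epsilon> ^ k) (W_poly k)) j =
    (of_nat ((2 * j) choose j))\<^sup>2 * (\<Sum>k<p. \<epsilon> ^ k * of_nat (k choose (2 * j)) ^ 2)"
  by (simp add: coeff_sum coeff_W_poly sum_distrib_left power_mult_distrib mult_ac)

text \<open>Both coefficients are zero for \<open>p \<le> j\<close> and divisible by \<open>p ^ 2\<close> for \<open>p \<le> 2 * j < 2 * p\<close>, through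
the central binomial coefficient, so the shift is needed only for \<open>2 * j < p\<close>.\<close>

lemma coeff_sum_cong:
  assumes "\<epsilon> \<in> {1, - 1 :: int}"
  shows "[coeff (\<Sum>k<p. smult (\<epsilon> ^ k) (Apery_poly k)) j = \<epsilon> ^ j * coeff (\<Sum>k<p. smult (\<epsilon> ^ k) (W_poly k)) j] (mod int p ^ 2)"
proof -
  let ?b = "int ((2 * j) choose j)"
  let ?A = "\<Sum>k<p. \<epsilon> ^ k * int ((k + j) choose (2 * j)) ^ 2"
  let ?W = "\<Sum>k<p. \<epsilon> ^ k * int (k choose (2 * j)) ^ 2"
  have "[?b\<^sup>2 * ?A = ?b\<^sup>2 * (\<epsilon> ^ j * ?W)] (mod int p ^ 2)"
  proof (cases "2 * j < p")
    case True
    then show ?thesis using assms by (intro cong_scalar_left sum_choose_square_shift)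
  next
    case False
    show ?thesis
    proof (cases "j < p")
      case True
      then have "int p ^ 2 dvd ?b\<^sup>2" using False central_choose_square_cong_0 unfolding cong_0_iff by simp
      then show ?thesis by (simp add: cong_iff_dvd_diff flip: right_diff_distrib)
    next
      case False
      then have "?A = 0" "?W = 0" by (auto intro!: sum.neutral simp: binomial_eq_0)
      then show ?thesis by simp
    qed
  qed
  then show ?thesis unfolding coeff_sum_smult_Apery coeff_sum_smult_W by (simp only: mult_ac)
qed

lemma two_not_dvd: "\<not> p dvd 2 ^ k"
  using prime p_gt_2 by (metis nat_dvd_not_less prime_dvd_power zero_less_numeral)

lemma alternating_sum_Apery_cong:
  "rat_poly_cong p 2
     (\<Sum>k<p. smult ((-1) ^ k) (Apery_poly k))
     (\<Sum>k<p. smult ((-1) ^ k) (pcompose (W_poly k) [:0, -1:]))"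
  unfolding rat_poly_cong_def
proof
  fix j
  have "[coeff (\<Sum>k<p. smult ((- 1 :: int) ^ k) (Apery_poly k)) j =
      (- 1) ^ j * coeff (\<Sum>k<p. smult ((- 1) ^ k) (W_poly k)) j] (mod int p ^ 2)"
    by (rule coeff_sum_cong) simp
  then have "rat_cong p 2 (of_int (coeff (\<Sum>k<p. smult ((- 1 :: int) ^ k) (Apery_poly k)) j))
      (of_int ((- 1) ^ j * coeff (\<Sum>k<p. smult ((- 1) ^ k) (W_poly k)) j))"
    by (simp only: rat_cong_of_int_iff)
  moreover have "(of_int (coeff (\<Sum>k<p. smult ((- 1 :: int) ^ k) (Apery_poly k)) j) :: rat) =
      coeff (\<Sum>k<p. smult ((-1) ^ k) (Apery_poly k)) j"
    unfolding coeff_sum_smult_Apery by simp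
  moreover have "(of_int ((- 1) ^ j * coeff (\<Sum>k<p. smult ((- 1 :: int) ^ k) (W_poly k)) j) :: rat) =
      coeff (\<Sum>k<p. smult ((-1) ^ k) (pcompose (W_poly k) [:0, -1:])) j"
    by (simp add: coeff_sum coeff_pcompose_linear coeff_W_poly sum_distrib_left mult_ac)
  ultimately show "rat_cong p 2 (coeff (\<Sum>k<p. smult ((-1) ^ k) (Apery_poly k)) j)
      (coeff (\<Sum>k<p. smult ((-1) ^ k) (pcompose (W_poly k) [:0, -1:])) j)" by simp
qed

lemma alternating_sum_Apery_cong_central:
  "rat_poly_cong p 2
     (\<Sum>k<p. smult ((-1) ^ k) (Apery_poly k))
     (\<Sum>k<p. monom (of_nat ((2 * k) choose k) ^ 3 / 16 ^ k) k)"
  unfolding rat_poly_cong_def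
proof
  fix j
  let ?b = "int ((2 * j) choose j)"
  let ?A = "\<Sum>k<p. (- 1) ^ k * int ((k + j) choose (2 * j)) ^ 2"
  have A: "coeff (\<Sum>k<p. smult ((-1) ^ k) (Apery_poly k)) j = (of_int (?b\<^sup>2 * ?A) :: rat)"
    unfolding coeff_sum_smult_Apery by simp
  show "rat_cong p 2 (coeff (\<Sum>k<p. smult ((-1) ^ k) (Apery_poly k)) j)
      (coeff (\<Sum>k<p. monom (of_nat ((2 * k) choose k) ^ 3 / 16 ^ k) k) j)"
  proof (cases "j < p")
    case True
    have "[16 ^ j * (?b\<^sup>2 * ?A) = ?b ^ 3] (mod int p ^ 2)"
    proof (cases "2 * j < p")
      case True
      from cong_scalar_left[OF sum_alternating_choose_square[OF this], of "?b\<^sup>2"] show ?thesis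
        by (simp only: power2_eq_square power3_eq_cube mult_ac)
    next
      case False
      then have "int p ^ 2 dvd ?b\<^sup>2" using True central_choose_square_cong_0 unfolding cong_0_iff by simp
      moreover have "16 ^ j * (?b\<^sup>2 * ?A) - ?b ^ 3 = ?b\<^sup>2 * (16 ^ j * ?A - ?b)"
        by (simp only: power2_eq_square power3_eq_cube right_diff_distrib mult_ac)
      ultimately show ?thesis by (simp only: cong_iff_dvd_diff dvd_mult2)
    qed
    then have "rat_cong p 2 (of_int (16 ^ j * (?b\<^sup>2 * ?A))) (of_int (?b ^ 3))"
      by (simp only: rat_cong_of_int_iff)
    moreover have "of_int (?b ^ 3) = of_nat (16 ^ j) * (of_nat ((2 * j) choose j) ^ 3 / 16 ^ j :: rat)" by simp
    moreover have "of_int (16 ^ j * (?b\<^sup>2 * ?A)) = (of_nat (16 ^ j) * of_int (?b\<^sup>2 * ?A) :: rat)" by simp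
    ultimately have "rat_cong p 2 (of_nat (16 ^ j) * of_int (?b\<^sup>2 * ?A))
        (of_nat (16 ^ j) * (of_nat ((2 * j) choose j) ^ 3 / 16 ^ j :: rat))" by (simp only:)
    moreover have "\<not> p dvd 16 ^ j" using two_not_dvd[of "4 * j"] by (simp add: power_mult)
    ultimately have "rat_cong p 2 (of_int (?b\<^sup>2 * ?A)) (of_nat ((2 * j) choose j) ^ 3 / 16 ^ j)"
      by (rule rat_cong_cancel_of_nat)
    then show ?thesis unfolding A coeff_sum_monom_lessThan using True by simp
  next
    case False
    then have "?A = 0" by (auto intro!: sum.neutral simp: binomial_eq_0)
    then show ?thesis unfolding A coeff_sum_monom_lessThan using False by simp
  qed
qed

lemma alternating_sum_W_cong_central:
  "rat_poly_cong p 2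
     (\<Sum>k<p. smult ((-1) ^ k) (pcompose (W_poly k) [:0, -1:]))
     (\<Sum>k<p. monom (of_nat ((2 * k) choose k) ^ 3 / 16 ^ k) k)"
  using alternating_sum_Apery_cong alternating_sum_Apery_cong_central
  unfolding rat_poly_cong_def by (meson rat_cong_sym rat_cong_trans)

lemma sum_poly_Apery_cong_W:
  "[(\<Sum>k<p. poly (Apery_poly k) x) = (\<Sum>k<p. poly (W_poly k) x)] (mod int p ^ 2)"
proof -
  have "[poly (\<Sum>k<p. smult (1 ^ k) (Apery_poly k)) x = poly (\<Sum>k<p. smult (1 ^ k) (W_poly k)) x] (mod int p ^ 2)"
    using coeff_sum_cong[of 1] by (intro poly_cong_coeff) simp
  then show ?thesis by (simp add: poly_sum)
qed

text \<open>The coefficient of \<open>x ^ j\<close> survives only for \<open>j \<le> h\<close>; writing \<open>j = h - k\<close> and using that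
\<open>y ^ k\<close> is inverse to \<open>(256 * x) ^ k\<close> extracts the common factor \<open>x ^ h\<close>.\<close>

lemma sum_poly_Apery_cong_multinomial4:
  assumes y: "[256 * x * y = 1] (mod int p)"
  shows "[(\<Sum>k<p. poly (Apery_poly k) x) = x ^ h * (\<Sum>k<p. int (multinomial4 k) * y ^ k)] (mod int p)"
proof -
  let ?b = "\<lambda>j. int ((2 * j) choose j)" and ?c = "\<lambda>j. int ((2 * j) choose (p - 1 - 2 * j))"
  define f :: "int poly" where "f = (\<Sum>j\<le>h. monom ((?b j)\<^sup>2 * ?c j) j)"
  have "[coeff (\<Sum>k<p. Apery_poly k) j = coeff f j] (mod int p)" for j
  proof -
    have "[coeff (\<Sum>k<p. smult (1 ^ k) (Apery_poly k)) j = 1 ^ j * coeff (\<Sum>k<p. smult (1 ^ k) (W_poly k)) j] (mod int p ^ 2)"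
      by (rule coeff_sum_cong) simp
    then have "[coeff (\<Sum>k<p. Apery_poly k) j = coeff (\<Sum>k<p. smult (1 ^ k) (W_poly k)) j] (mod int p)"
      by (simp add: cong_dvd_modulus[of _ _ "int p ^ 2"])
    also have "coeff (\<Sum>k<p. smult (1 ^ k) (W_poly k)) j = (?b j)\<^sup>2 * (\<Sum>k<p. int (k choose (2 * j)) ^ 2)"
      unfolding coeff_sum_smult_W by simp
    also have "[\<dots> = coeff f j] (mod int p)"
    proof (cases "j \<le> h")
      case True
      then have "2 * j < p" using p_eq by simp
      then have "[int ((p - 1) choose (2 * j)) = 1] (mod int p)"
        using choose_p_minus_1_cong[of "2 * j"] by simp
      then have "[?c j * int ((p - 1) choose (2 * j)) = ?c j * 1] (mod int p)"
        by (rule cong_scalar_left)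
      with sum_choose_square_cong[OF \<open>2 * j < p\<close>] have "[(\<Sum>k<p. int (k choose (2 * j)) ^ 2) = ?c j] (mod int p)"
        using cong_trans by fastforce
      then show ?thesis unfolding f_def coeff_sum_monom_atMost using True
        by (simp add: cong_scalar_left)
    next
      case False
      then have "(\<Sum>k<p. int (k choose (2 * j)) ^ 2) = 0"
        using p_eq by (auto intro!: sum.neutral simp: binomial_eq_0)
      then show ?thesis unfolding f_def coeff_sum_monom_atMost using False by simp
    qed
    finally show ?thesis .
  qed
  from poly_cong_coeff[OF this, where x = x] have "[(\<Sum>k<p. poly (Apery_poly k) x) = poly f x] (mod int p)"
    by (simp add: poly_sum)
  also have "poly f x = (\<Sum>j\<le>h. (?b j)\<^sup>2 * ?c j * x ^ j)"
    unfolding f_def by (simp add: poly_sum poly_monom)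
  also have "\<dots> = (\<Sum>k\<le>h. (?b (h - k))\<^sup>2 * ?c (h - k) * x ^ (h - k))"
    by (rule sum.reindex_bij_witness[of _ "\<lambda>i. h - i" "\<lambda>i. h - i"]) auto
  also have "[\<dots> = (\<Sum>k\<le>h. x ^ h * (int (multinomial4 k) * y ^ k))] (mod int p)"
  proof (rule cong_sum)
    fix k assume "k \<in> {..h}"
    then have k: "k \<le> h" by simp
    then have "p - 1 - 2 * (h - k) = 2 * k" using p_eq by simp
    then have "[256 ^ k * ((?b (h - k))\<^sup>2 * ?c (h - k)) = int (multinomial4 k)] (mod int p)"
      using multinomial4_cong[OF k] by simp
    from cong_scalar_right[OF this, of "x ^ h * y ^ k"]
    have a: "[256 ^ k * ((?b (h - k))\<^sup>2 * ?c (h - k)) * (x ^ h * y ^ k) = x ^ h * (int (multinomial4 k) * y ^ k)] (mod int p)"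
      by (simp only: mult_ac)
    have eq: "256 ^ k * ((?b (h - k))\<^sup>2 * ?c (h - k)) * (x ^ h * y ^ k) =
        (256 * x * y) ^ k * ((?b (h - k))\<^sup>2 * ?c (h - k) * x ^ (h - k))"
    proof -
      have "x ^ h = x ^ k * x ^ (h - k)" using k by (simp flip: power_add)
      then show ?thesis by (simp only: power_mult_distrib mult_ac)
    qed
    have c: "[(256 * x * y) ^ k * ((?b (h - k))\<^sup>2 * ?c (h - k) * x ^ (h - k)) = 1 ^ k * ((?b (h - k))\<^sup>2 * ?c (h - k) * x ^ (h - k))] (mod int p)"
      by (intro cong_scalar_right cong_pow y)
    show "[(?b (h - k))\<^sup>2 * ?c (h - k) * x ^ (h - k) = x ^ h * (int (multinomial4 k) * y ^ k)] (mod int p)"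
      using cong_trans[OF cong_sym[OF c] a[unfolded eq]] by (simp only: power_one mult_1)
  qed
  also have "[(\<Sum>k\<le>h. x ^ h * (int (multinomial4 k) * y ^ k)) = (\<Sum>k<p. x ^ h * (int (multinomial4 k) * y ^ k))] (mod int p)"
  proof -
    have "(\<Sum>k<p. x ^ h * (int (multinomial4 k) * y ^ k)) =
       (\<Sum>k\<le>h. x ^ h * (int (multinomial4 k) * y ^ k)) + (\<Sum>k\<in>{h<..<p}. x ^ h * (int (multinomial4 k) * y ^ k))"
    proof -
      have split: "{..<p} = {..h} \<union> {h<..<p}" using p_eq by auto
      show ?thesis unfolding split by (rule sum.union_disjoint) auto
    qed
    moreover have "[(\<Sum>k\<in>{h<..<p}. x ^ h * (int (multinomial4 k) * y ^ k)) = (\<Sum>k\<in>{h<..<p}. 0)] (mod int p)"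
    proof (rule cong_sum)
      fix k assume "k \<in> {h<..<p}"
      then have "[x ^ h * (int (multinomial4 k) * y ^ k) = x ^ h * (0 * y ^ k)] (mod int p)"
        by (intro cong_scalar_left cong_scalar_right multinomial4_cong_0) auto
      then show "[x ^ h * (int (multinomial4 k) * y ^ k) = 0] (mod int p)" by simp
    qed
    ultimately show ?thesis by (simp add: cong_iff_dvd_diff dvd_diff_commute)
  qed
  finally show ?thesis by (simp only: sum_distrib_left)
qed

end

section \<open>Evaluation in the p-adic integers\<close>

context prime_modulus
begin

sublocale Zp: cring "Zp p"
  by (rule cring_Zp)

lemma Zp_apply_cong: "a \<in> carrier (Zp p) \<Longrightarrow> [a (n + m) = a m] (mod int p ^ m)"
proof (induction n)
  case (Suc n)
  have "[a (Suc (n + m)) = a (n + m)] (mod int p ^ m)"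
    using Zp_cong[OF Suc.prems] by (rule cong_dvd_modulus) (simp add: le_imp_power_dvd)
  then show ?case using Suc by (simp add: cong_trans)
qed simp

text \<open>Equality of the \<open>m\<close>-th residues suffices: every residue of the difference \<open>d\<close> beyond the \<open>m\<close>-th is
then divisible by \<open>p ^ m\<close>, and the shifted quotients \<open>d (n + m) / p ^ m\<close> form a coherent sequence.\<close>

lemma Zp_cong_modI:
  assumes a: "a \<in> carrier (Zp p)" and b: "b \<in> carrier (Zp p)" and eq: "[a m = b m] (mod int p ^ m)"
  shows "Zp_cong_mod p m a b"
proof -
  define d where "d = a \<ominus>\<^bsub>Zp p\<^esub> b"
  have d: "d \<in> carrier (Zp p)" unfolding d_def using a b by simp
  have "d \<oplus>\<^bsub>Zp p\<^esub> b = a" unfolding d_def using a b by (simp add: Zp.minus_eq Zp.a_assoc Zp.l_neg)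
  from fun_cong[OF this, of m] have "(d m + b m) mod int p ^ m = a m" by (simp add: Zp_simps)
  then have "[d m + b m = 0 + b m] (mod int p ^ m)"
    using eq Zp_mod[OF b, of m] Zp_mod[OF a, of m] by (simp add: cong_def)
  then have "[d m = 0] (mod int p ^ m)" by (simp only: cong_add_rcancel)
  then have "int p ^ m dvd d (n + m)" for n
    using Zp_apply_cong[OF d, of n m] by (metis cong_0_iff cong_trans)
  then have "\<forall>n. \<exists>u. d (n + m) = int p ^ m * u" by (simp add: dvd_def)
  then obtain z where z: "\<And>n. d (n + m) = int p ^ m * z n" by metis
  have "z \<in> carrier (Zp p)"
  proof -
    have "int p ^ m * (z (Suc n) mod int p ^ n) = int p ^ m * z n" for n
    proof -
      have "int p ^ m * (z (Suc n) mod int p ^ n) = d (Suc (n + m)) mod int p ^ (n + m)"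
      proof -
        have "d (Suc (n + m)) = int p ^ m * z (Suc n)" using z[of "Suc n"] by simp
        moreover have "int p ^ (n + m) = int p ^ m * int p ^ n" by (simp add: power_add)
        ultimately show ?thesis by (simp only: mult_mod_right)
      qed
      also have "\<dots> = d (n + m)" using d unfolding Zp_simps by simp
      finally show ?thesis using z by simp
    qed
    then show ?thesis by (simp add: Zp_simps)
  qed
  moreover have "d = ([(p ^ m)] \<cdot>\<^bsub>Zp p\<^esub> \<one>\<^bsub>Zp p\<^esub>) \<otimes>\<^bsub>Zp p\<^esub> z"
  proof
    fix n
    have "d n = d (m + n) mod int p ^ n"
      using Zp_apply_cong[OF d, of m n] Zp_mod[OF d, of n] by (simp add: cong_def)
    also have "\<dots> = int p ^ m * z n mod int p ^ n" using z[of n] by (simp add: add.commute)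
    finally show "d n = (([(p ^ m)] \<cdot>\<^bsub>Zp p\<^esub> \<one>\<^bsub>Zp p\<^esub>) \<otimes>\<^bsub>Zp p\<^esub> z) n"
      unfolding Zp_of_nat Zp_simps(2) by (simp add: mod_mult_left_eq)
  qed
  ultimately show ?thesis unfolding Zp_cong_mod_def d_def[symmetric] by blast
qed

lemma Zp_int_mult_apply:
  assumes "y \<in> carrier (Zp p)"
  shows "([(k :: int)] \<cdot>\<^bsub>Zp p\<^esub> y) n = (k * y n) mod int p ^ n"
proof -
  have "[k] \<cdot>\<^bsub>Zp p\<^esub> y = ([k] \<cdot>\<^bsub>Zp p\<^esub> \<one>\<^bsub>Zp p\<^esub>) \<otimes>\<^bsub>Zp p\<^esub> y"
    using Zp.add_pow_ldistr_int[OF Zp.one_closed assms, of k] assms by simp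
  then show ?thesis unfolding Zp_of_int Zp_simps(2) by (simp add: mod_mult_left_eq)
qed

lemma Zp_nat_mult_apply:
  assumes "y \<in> carrier (Zp p)"
  shows "([(k :: nat)] \<cdot>\<^bsub>Zp p\<^esub> y) n = (int k * y n) mod int p ^ n"
proof -
  have "[k] \<cdot>\<^bsub>Zp p\<^esub> y = ([k] \<cdot>\<^bsub>Zp p\<^esub> \<one>\<^bsub>Zp p\<^esub>) \<otimes>\<^bsub>Zp p\<^esub> y"
    using Zp.add_pow_ldistr[OF Zp.one_closed assms, of k] assms by simp
  then show ?thesis unfolding Zp_of_nat Zp_simps(2) by (simp add: mod_mult_left_eq)
qed

lemma Zp_pow_apply: "(x [^]\<^bsub>Zp p\<^esub> (i :: nat)) n = x n ^ i mod int p ^ n"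
  by (induction i) (simp_all add: Zp_simps mod_simps mult.commute)

lemma Zp_finsum_apply:
  assumes "finite A" "\<And>i. i \<in> A \<Longrightarrow> f i \<in> carrier (Zp p)"
  shows "(\<Oplus>\<^bsub>Zp p\<^esub>i\<in>A. f i) n = (\<Sum>i\<in>A. f i n) mod int p ^ n"
  using assms
proof (induction A rule: finite_induct)
  case empty
  show ?case by (simp add: Zp_simps)
next
  case (insert a A)
  then have "(\<Oplus>\<^bsub>Zp p\<^esub>i\<in>insert a A. f i) = f a \<oplus>\<^bsub>Zp p\<^esub> (\<Oplus>\<^bsub>Zp p\<^esub>i\<in>A. f i)"
    by (intro Zp.finsum_insert) auto
  then show ?case using insert by (simp add: Zp_simps(5) mod_add_right_eq)
qed

lemma ring_eval_closed: "x \<in> carrier (Zp p) \<Longrightarrow> ring_eval (Zp p) f x \<in> carrier (Zp p)"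
  unfolding ring_eval_def by (intro Zp.finsum_closed) auto

lemma ring_eval_apply:
  assumes "x \<in> carrier (Zp p)"
  shows "[ring_eval (Zp p) f x n = poly f (x n)] (mod int p ^ n)"
proof -
  have "ring_eval (Zp p) f x n = (\<Sum>i\<le>degree f. ([coeff f i] \<cdot>\<^bsub>Zp p\<^esub> (x [^]\<^bsub>Zp p\<^esub> i)) n) mod int p ^ n"
    unfolding ring_eval_def using assms by (intro Zp_finsum_apply) auto
  also have "\<dots> = (\<Sum>i\<le>degree f. coeff f i * x n ^ i) mod int p ^ n"
    using assms by (simp add: Zp_int_mult_apply Zp_pow_apply mod_simps mod_sum_eq)
  finally show ?thesis by (simp add: poly_altdef cong_def)
qed

lemma finsum_ring_eval_apply:
  assumes "x \<in> carrier (Zp p)" "finite A"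
  shows "[(\<Oplus>\<^bsub>Zp p\<^esub>k\<in>A. ring_eval (Zp p) (f k) x) n = (\<Sum>k\<in>A. poly (f k) (x n))] (mod int p ^ n)"
proof -
  have "(\<Oplus>\<^bsub>Zp p\<^esub>k\<in>A. ring_eval (Zp p) (f k) x) n = (\<Sum>k\<in>A. ring_eval (Zp p) (f k) x n) mod int p ^ n"
    using assms ring_eval_closed by (intro Zp_finsum_apply) auto
  moreover have "[(\<Sum>k\<in>A. ring_eval (Zp p) (f k) x n) = (\<Sum>k\<in>A. poly (f k) (x n))] (mod int p ^ n)"
    using assms by (intro cong_sum ring_eval_apply)
  ultimately show ?thesis by (simp add: cong_def)
qed

end

context odd_prime
begin

lemma Zp_residue_nonzero:
  assumes "x \<in> carrier (Zp p)" "\<not> Zp_cong_mod p 1 x \<zero>\<^bsub>Zp p\<^esub>"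
  shows "\<not> int p dvd x 1"
proof
  assume "int p dvd x 1"
  then have "[x 1 = \<zero>\<^bsub>Zp p\<^esub> 1] (mod int p ^ 1)" by (simp add: Zp_simps cong_0_iff)
  then show False using assms Zp_cong_modI[OF _ Zp.zero_closed] by blast
qed

lemma Zp_sum_Apery_cong_W:
  assumes "x \<in> carrier (Zp p)"
  shows "Zp_cong_mod p 2
    (\<Oplus>\<^bsub>Zp p\<^esub>k\<in>{..<p}. ring_eval (Zp p) (Apery_poly k) x)
    (\<Oplus>\<^bsub>Zp p\<^esub>k\<in>{..<p}. ring_eval (Zp p) (W_poly k) x)"
proof (rule Zp_cong_modI)
  show "[(\<Oplus>\<^bsub>Zp p\<^esub>k\<in>{..<p}. ring_eval (Zp p) (Apery_poly k) x) 2 =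
      (\<Oplus>\<^bsub>Zp p\<^esub>k\<in>{..<p}. ring_eval (Zp p) (W_poly k) x) 2] (mod int p ^ 2)"
    using finsum_ring_eval_apply[OF assms finite_lessThan, where f = Apery_poly and n = 2]
      sum_poly_Apery_cong_W[of "x 2"]
      cong_sym[OF finsum_ring_eval_apply[OF assms finite_lessThan, where f = W_poly and n = 2]]
    by (blast intro: cong_trans)
qed (use assms ring_eval_closed in \<open>auto intro!: Zp.finsum_closed\<close>)

text \<open>Only residues modulo \<open>p\<close> matter, and there the inverse powers become the powers of an integer \<open>y\<close>
inverse to \<open>256 * x 1\<close>.\<close>

lemma Zp_sum_Apery_cong_multinomial4:
  assumes x: "x \<in> carrier (Zp p)" and nz: "\<not> int p dvd x 1"
  shows "Zp_cong_mod p 1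
    (\<Oplus>\<^bsub>Zp p\<^esub>k\<in>{..<p}. ring_eval (Zp p) (Apery_poly k) x)
    ([Legendre (x 1) (int p)] \<cdot>\<^bsub>Zp p\<^esub>
      (\<Oplus>\<^bsub>Zp p\<^esub>k\<in>{..<p}. [multinomial4 k] \<cdot>\<^bsub>Zp p\<^esub>
         (inv\<^bsub>Zp p\<^esub> (([(256::nat)] \<cdot>\<^bsub>Zp p\<^esub> x) [^]\<^bsub>Zp p\<^esub> k))))"
    (is "Zp_cong_mod p 1 ?A ([?L] \<cdot>\<^bsub>Zp p\<^esub> ?M)")
proof -
  let ?u = "\<lambda>k. ([(256::nat)] \<cdot>\<^bsub>Zp p\<^esub> x) [^]\<^bsub>Zp p\<^esub> (k :: nat)"
  have nz256: "\<not> int p dvd 256 * x 1"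
  proof -
    have "\<not> int p dvd 256"
      using two_not_dvd[of 8] int_dvd_int_iff[of p 256] by simp
    then show ?thesis using nz prime_dvd_mult_iff[OF prime_int] by blast
  qed
  then have "coprime (256 * x 1) (int p)"
    using prime_imp_coprime[OF prime_int] coprime_commute by blast
  then obtain y where y: "[256 * x 1 * y = 1] (mod int p)" using cong_solve_coprime_int by blast
  have u1: "?u k 1 = (256 * x 1) ^ k mod int p" for k
    using x by (simp add: Zp_pow_apply Zp_nat_mult_apply mod_simps)
  have unit: "?u k \<in> Units (Zp p)" for k
  proof (rule Zp_UnitsI[OF prime])
    show "?u k 1 \<noteq> 0" unfolding u1 using nz256 prime_dvd_power[OF prime_int] by (auto simp: dvd_eq_mod_eq_0[symmetric])
  qed (use x in simp)
  have inv1: "[(inv\<^bsub>Zp p\<^esub> (?u k)) 1 = y ^ k] (mod int p)" for k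
  proof -
    let ?w = "(inv\<^bsub>Zp p\<^esub> (?u k)) 1"
    have "(?u k \<otimes>\<^bsub>Zp p\<^esub> inv\<^bsub>Zp p\<^esub> (?u k)) 1 = \<one>\<^bsub>Zp p\<^esub> 1"
      unfolding Zp.Units_r_inv[OF unit] ..
    then have "[(256 * x 1) ^ k * ?w = 1] (mod int p)"
      unfolding Zp_simps u1 by (simp add: cong_def mod_simps)
    from cong_scalar_right[OF this, of "y ^ k"]
    have 1: "[(256 * x 1 * y) ^ k * ?w = y ^ k] (mod int p)" by (simp add: power_mult_distrib mult_ac)
    have "[(256 * x 1 * y) ^ k * ?w = 1 ^ k * ?w] (mod int p)"
      by (intro cong_scalar_right cong_pow y)
    from cong_trans[OF cong_sym[OF this] 1] show ?thesis by simp
  qed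
  have invc: "inv\<^bsub>Zp p\<^esub> (?u k) \<in> carrier (Zp p)" for k
    using Zp.Units_inv_closed[OF unit] .
  have Mc: "?M \<in> carrier (Zp p)" using invc by (intro Zp.finsum_closed) auto
  have "?M 1 = (\<Sum>k<p. ([multinomial4 k] \<cdot>\<^bsub>Zp p\<^esub> (inv\<^bsub>Zp p\<^esub> (?u k))) 1) mod int p ^ 1"
    using invc by (intro Zp_finsum_apply) auto
  also have "\<dots> = (\<Sum>k<p. int (multinomial4 k) * (inv\<^bsub>Zp p\<^esub> (?u k)) 1) mod int p"
    using invc by (simp add: Zp_nat_mult_apply mod_sum_eq)
  finally have "[?M 1 = (\<Sum>k<p. int (multinomial4 k) * (inv\<^bsub>Zp p\<^esub> (?u k)) 1)] (mod int p)"
    by (simp add: cong_def)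
  also have "[(\<Sum>k<p. int (multinomial4 k) * (inv\<^bsub>Zp p\<^esub> (?u k)) 1) =
      (\<Sum>k<p. int (multinomial4 k) * y ^ k)] (mod int p)"
    by (intro cong_sum cong_scalar_left inv1)
  finally have M: "[?M 1 = (\<Sum>k<p. int (multinomial4 k) * y ^ k)] (mod int p)" .
  have "h = (p - 1) div 2" using p_eq by simp
  then have L: "[?L = x 1 ^ h] (mod int p)"
    using euler_criterion[OF prime p_gt_2, of "x 1"] by simp
  have "[?A 1 = (\<Sum>k<p. poly (Apery_poly k) (x 1))] (mod int p ^ 1)"
    by (rule finsum_ring_eval_apply[OF x finite_lessThan])
  then have "[?A 1 = (\<Sum>k<p. poly (Apery_poly k) (x 1))] (mod int p)" by simp
  also have "[(\<Sum>k<p. poly (Apery_poly k) (x 1)) = x 1 ^ h * (\<Sum>k<p. int (multinomial4 k) * y ^ k)] (mod int p)"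
    by (rule sum_poly_Apery_cong_multinomial4[OF y])
  also have "[x 1 ^ h * (\<Sum>k<p. int (multinomial4 k) * y ^ k) = ?L * ?M 1] (mod int p)"
    by (rule cong_mult[OF cong_sym[OF L] cong_sym[OF M]])
  also have "[?L * ?M 1 = ([?L] \<cdot>\<^bsub>Zp p\<^esub> ?M) 1] (mod int p)"
    unfolding Zp_int_mult_apply[OF Mc] by (simp add: cong_def)
  finally have "[?A 1 = ([?L] \<cdot>\<^bsub>Zp p\<^esub> ?M) 1] (mod int p ^ 1)" by simp
  then show ?thesis
    using x ring_eval_closed Mc by (intro Zp_cong_modI) (auto intro!: Zp.finsum_closed)
qed

end

section \<open>Appell sequences: Bernoulli and Euler polynomials\<close>

text \<open>Applied to the Bernoulli numbers this is the Bernoulli polynomial. Applied to the Euler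
numbers \<open>E\<close> it is \<open>2 ^ n\<close> times the Euler polynomial at \<open>(x + 1) / 2\<close>, a normalization with integer
coefficients and centre of symmetry \<open>0\<close>.\<close>

definition appell :: "(nat \<Rightarrow> 'a :: comm_ring_1) \<Rightarrow> nat \<Rightarrow> 'a \<Rightarrow> 'a" where
  "appell a n x = (\<Sum>i\<le>n. of_nat (n choose i) * a i * x ^ (n - i))"

lemma appell_0 [simp]: "appell a 0 x = a 0"
  by (simp add: appell_def)

lemma appell_at_0: "appell a n 0 = a n"
proof -
  have "appell a n 0 = (\<Sum>i\<le>n. if i = n then a n else 0)"
    unfolding appell_def by (rule sum.cong) (auto simp: zero_power)
  then show ?thesis by simp
qed

lemma appell_sum: "appell (\<lambda>i. a i + b i) n x = appell a n x + appell b n x"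
  by (simp add: appell_def algebra_simps sum.distrib)

lemma appell_delta: "m \<le> n \<Longrightarrow> appell (\<lambda>i. if i = m then c else 0) n x = of_nat (n choose m) * c * x ^ (n - m)"
  by (simp add: appell_def if_distrib[of "\<lambda>y. _ * y"] if_distrib[of "\<lambda>y. y * _"] cong: if_cong)

text \<open>The Appell property: translating the argument amounts to replacing the sequence by its values at
the translation. All evaluations below come from it, since a special value at one point
determines the behaviour under translation by that point.\<close>

lemma appell_add: "appell a n (x + y) = appell (\<lambda>k. appell a k y) n x"
proof -
  have inner: "(\<Sum>k\<le>n. of_nat ((n choose k) * (k choose i)) * y ^ (k - i) * x ^ (n - k)) =
      of_nat (n choose i) * (x + y) ^ (n - i)" if i: "i \<le> n" for i
  proof -
    have "(\<Sum>k\<le>n. of_nat ((n choose k) * (k choose i)) * y ^ (k - i) * x ^ (n - k)) =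
      (\<Sum>k\<in>{i..n}. of_nat ((n choose k) * (k choose i)) * y ^ (k - i) * x ^ (n - k))"
      by (rule sum.mono_neutral_right) (auto simp: binomial_eq_0)
    also have "\<dots> = (\<Sum>m\<le>n - i. of_nat ((n choose i) * ((n - i) choose m)) * y ^ m * x ^ (n - i - m))"
      by (rule sum.reindex_bij_witness[of _ "\<lambda>m. i + m" "\<lambda>k. k - i"]) (use i in \<open>auto simp: choose_mult\<close>)
    also have "\<dots> = of_nat (n choose i) * (y + x) ^ (n - i)"
      unfolding binomial_ring sum_distrib_left by (rule sum.cong) (simp_all add: mult_ac)
    finally show ?thesis by (simp add: add.commute)
  qed
  have "appell (\<lambda>k. appell a k y) n x =
    (\<Sum>k\<le>n. \<Sum>i\<le>k. a i * (of_nat ((n choose k) * (k choose i)) * y ^ (k - i) * x ^ (n - k)))"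
    unfolding appell_def sum_distrib_left sum_distrib_right
    by (intro sum.cong refl) (simp add: mult_ac)
  also have "\<dots> = (\<Sum>k\<le>n. \<Sum>i\<le>n. a i * (of_nat ((n choose k) * (k choose i)) * y ^ (k - i) * x ^ (n - k)))"
    by (intro sum.cong refl sum.mono_neutral_left) (auto simp: binomial_eq_0)
  also have "\<dots> = (\<Sum>i\<le>n. a i * (\<Sum>k\<le>n. of_nat ((n choose k) * (k choose i)) * y ^ (k - i) * x ^ (n - k)))"
    by (subst sum.swap) (simp only: sum_distrib_left)
  also have "\<dots> = appell a n (x + y)"
    unfolding appell_def
  proof (rule sum.cong)
    fix i assume "i \<in> {..n}"
    then have "i \<le> n" by simp
    show "a i * (\<Sum>k\<le>n. of_nat ((n choose k) * (k choose i)) * y ^ (k - i) * x ^ (n - k)) =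
        of_nat (n choose i) * a i * (x + y) ^ (n - i)"
      unfolding inner[OF \<open>i \<le> n\<close>] by (simp only: mult_ac)
  qed simp
  finally show ?thesis ..
qed

abbreviation bernoulli_poly :: "nat \<Rightarrow> rat \<Rightarrow> rat" where
  "bernoulli_poly \<equiv> appell bernoulli_num"

lemma bernoulli_poly_at_1: "bernoulli_poly n 1 = bernoulli_num n + (if n = 1 then 1 else 0)"
proof (cases n)
  case (Suc m)
  show ?thesis
  proof (cases "m = 0")
    case True
    then show ?thesis using Suc by (simp add: appell_def bernoulli_num_0)
  next
    case False
    have "bernoulli_poly n 1 = (\<Sum>i\<le>m. of_nat (Suc m choose i) * bernoulli_num i) + bernoulli_num n"
      unfolding appell_def Suc by simp
    then show ?thesis using bernoulli_num_rec[of m] False Suc by simp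
  qed
qed simp

lemma bernoulli_poly_plus_1:
  "bernoulli_poly (Suc m) (x + 1) = bernoulli_poly (Suc m) x + of_nat (Suc m) * x ^ m"
proof -
  have "bernoulli_poly (Suc m) (x + 1) = appell (\<lambda>k. bernoulli_num k + (if k = 1 then 1 else 0)) (Suc m) x"
    unfolding appell_add bernoulli_poly_at_1 ..
  then show ?thesis unfolding appell_sum by (simp add: appell_delta)
qed

lemma sum_power_eq_bernoulli_poly:
  "of_nat (Suc m) * (\<Sum>j<n. of_nat j ^ m) = bernoulli_poly (Suc m) (of_nat n) - bernoulli_num (Suc m)"
proof (induction n)
  case (Suc n)
  have "bernoulli_poly (Suc m) (of_nat (Suc n)) = bernoulli_poly (Suc m) (of_nat n) + of_nat (Suc m) * of_nat n ^ m"
    using bernoulli_poly_plus_1[of m "of_nat n"] by (simp add: add.commute)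
  with Suc show ?case by (simp only: sum.lessThan_Suc distrib_left)
qed (simp add: appell_at_0)

text \<open>The left-hand side satisfies the recurrence that defines the Bernoulli numbers. Indeed its binomial
transform is a multiple of the sum of the Bernoulli polynomials at \<open>1 / 2\<close> and at
\<open>1 / 2 + 1 / 2 = 1\<close>, and the value at \<open>1\<close> is again a Bernoulli number.\<close>

lemma bernoulli_poly_half_aux: "2 ^ n * (bernoulli_num n + bernoulli_poly n (1 / 2)) / 2 = bernoulli_num n"
proof (induction n rule: less_induct)
  case (less n)
  define c where "c = (\<lambda>n. 2 ^ n * (bernoulli_num n + bernoulli_poly n (1 / 2)) / 2)"
  show ?case
  proof (cases "n = 0")
    case True
    then show ?thesis by (simp add: bernoulli_num_0)
  next
    case False
    have scale: "of_nat (Suc n choose k) * c k = 2 ^ Suc n / 2 *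
        (of_nat (Suc n choose k) * (bernoulli_num k + bernoulli_poly k (1 / 2)) * (1 / 2) ^ (Suc n - k))"
      if "k \<le> Suc n" for k
    proof -
      have "(2 :: rat) ^ Suc n * (1 / 2) ^ (Suc n - k) = 2 ^ k"
        using that by (simp add: power_one_over power_diff field_simps del: power_Suc)
      then show ?thesis unfolding c_def by (simp del: power_Suc add: algebra_simps)
    qed
    have "(\<Sum>k\<le>Suc n. of_nat (Suc n choose k) * c k) = 2 ^ Suc n / 2 *
        appell (\<lambda>k. bernoulli_num k + bernoulli_poly k (1 / 2)) (Suc n) (1 / 2)"
      unfolding appell_def[of "\<lambda>k. bernoulli_num k + bernoulli_poly k (1 / 2)"] sum_distrib_left
      by (intro sum.cong refl scale) simp
    also have "appell (\<lambda>k. bernoulli_num k + bernoulli_poly k (1 / 2)) (Suc n) (1 / 2) =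
        bernoulli_poly (Suc n) (1 / 2) + bernoulli_poly (Suc n) (1 / 2 + 1 / 2)"
      unfolding appell_sum appell_add ..
    also have "2 ^ Suc n / 2 * \<dots> = c (Suc n)"
      unfolding c_def using False by (simp add: bernoulli_poly_at_1)
    finally have "(\<Sum>k\<le>n. of_nat (Suc n choose k) * c k) = 0" by simp
    then have "of_nat (Suc n) * c n = - (\<Sum>k<n. of_nat (Suc n choose k) * c k)"
      by (simp flip: lessThan_Suc_atMost)
    also have "(\<Sum>k<n. of_nat (Suc n choose k) * c k) = (\<Sum>k<n. of_nat (Suc n choose k) * bernoulli_num k)"
      using less.IH unfolding c_def by (intro sum.cong) auto
    finally have "c n = bernoulli_num n"
      using False by (subst bernoulli_num.simps) (simp add: field_simps del: of_nat_Suc)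
    then show ?thesis by (simp add: c_def)
  qed
qed

lemma bernoulli_poly_half: "bernoulli_poly n (1 / 2) = (2 / 2 ^ n - 1) * bernoulli_num n"
  using bernoulli_poly_half_aux[of n] by (simp add: field_simps)

text \<open>By the Appell property only the sum of the values at \<open>1\<close> and \<open>-1\<close> matters; in it the terms of odd
distance cancel, and the others are the defining recurrence of the Euler numbers.\<close>

lemma euler_poly_sum: "appell euler_num m (y + 1) + appell euler_num m (y - 1) = 2 * y ^ m"
proof -
  have 1: "appell euler_num k 1 + appell euler_num k (- 1) = (if k = 0 then 2 else 0)" for k
  proof (cases "k = 0")
    case True
    then show ?thesis by (simp add: euler_num_0)
  next
    case False
    have "appell euler_num k 1 + appell euler_num k (- 1) = (\<Sum>i\<le>k. int (k choose i) * euler_num i * (1 + (- 1) ^ (k - i)))"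
      by (simp add: appell_def algebra_simps sum.distrib)
    also have "\<dots> = (\<Sum>i\<le>k. int (k choose i) * euler_num (k - i) * (1 + (- 1) ^ i))"
      by (rule sum.reindex_bij_witness[of _ "\<lambda>i. k - i" "\<lambda>i. k - i"]) (auto simp: binomial_symmetric[symmetric])
    also have "\<dots> = (\<Sum>i\<le>k. if even i then 2 * (int (k choose i) * euler_num (k - i)) else 0)"
      by (rule sum.cong) auto
    also have "\<dots> = (\<Sum>i | i \<le> k \<and> even i. 2 * (int (k choose i) * euler_num (k - i)))"
      by (subst sum.inter_filter[symmetric]) auto
    also have "\<dots> = 2 * (\<Sum>i | i \<le> k \<and> even i. int (k choose i) * euler_num (k - i))"
      by (simp only: sum_distrib_left)
    finally show ?thesis using euler_num_rec[of k] False by simp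
  qed
  have "appell euler_num m (y + 1) + appell euler_num m (y - 1) =
      appell (\<lambda>k. appell euler_num k 1 + appell euler_num k (- 1)) m y"
    unfolding appell_sum using appell_add[of euler_num m y 1] appell_add[of euler_num m y "- 1"] by simp
  also have "\<dots> = 2 * y ^ m" unfolding 1 using appell_delta[of 0 m "2 :: int" y] by simp
  finally show ?thesis .
qed

lemma alternating_sum_odd_power:
  "2 * (\<Sum>k<n. (- 1) ^ k * (2 * int k + 1) ^ m) = euler_num m - (- 1) ^ n * appell euler_num m (2 * int n)"
proof (induction n)
  case (Suc n)
  have "2 * (2 * int n + 1) ^ m = appell euler_num m (2 * int (Suc n)) + appell euler_num m (2 * int n)"
    using euler_poly_sum[of m "2 * int n + 1"] by (simp add: algebra_simps)
  then have "(- 1) ^ n * (2 * (2 * int n + 1) ^ m) =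
      (- 1) ^ n * (appell euler_num m (2 * int (Suc n)) + appell euler_num m (2 * int n))" by simp
  with Suc show ?case by (simp add: algebra_simps)
qed (simp add: appell_at_0)

section \<open>Power sums and harmonic sums modulo p\<close>

definition harmonic :: "nat \<Rightarrow> nat \<Rightarrow> rat" where
  "harmonic a n = (\<Sum>j=1..n. 1 / of_nat j ^ a)"

lemma harmonic_0 [simp]: "harmonic a 0 = 0"
  by (simp add: harmonic_def)

lemma harmonic_Suc: "harmonic a (Suc n) = harmonic a n + 1 / of_nat (Suc n) ^ a"
  by (simp add: harmonic_def)

locale prime_gt_3 = odd_prime +
  assumes p_gt_3: "p > 3"
begin

lemma p_ge_5: "p \<ge> 5"
  using p_gt_3 p_eq by presburger

lemma not_dvd_2: "\<not> p dvd 2" and not_dvd_3: "\<not> p dvd 3"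
  using p_gt_3 by (auto dest: dvd_imp_le)

lemma padic_half: "rat_padic_integer p (1 / 2)"
  using padic_divide_of_nat[OF padic_1 not_dvd_2] by simp

text \<open>The recurrence for the \<open>n\<close>-th Bernoulli number divides by \<open>n + 1\<close>, which stays below \<open>p\<close>.\<close>

lemma padic_bernoulli: "n < p - 1 \<Longrightarrow> rat_padic_integer p (bernoulli_num n)"
proof (induction n rule: less_induct)
  case (less n)
  have "\<not> p dvd Suc n" using less.prems by (intro not_dvd_less) auto
  moreover have "rat_padic_integer p (bernoulli_num k)" if "k < n" for k
    using less that by auto
  ultimately show ?case
    by (subst bernoulli_num.simps) (auto intro!: padic_intros simp del: of_nat_Suc)
qed

lemma padic_appell:
  "(\<And>i. i \<le> n \<Longrightarrow> rat_padic_integer p (a i)) \<Longrightarrow> rat_padic_integer p x \<Longrightarrow> rat_padic_integer p (appell a n x)"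
  unfolding appell_def by (intro padic_intros) auto

lemma padic_bernoulli_poly: "n < p - 1 \<Longrightarrow> rat_padic_integer p x \<Longrightarrow> rat_padic_integer p (bernoulli_poly n x)"
  by (intro padic_appell padic_bernoulli) auto

lemma bernoulli_poly_cong:
  assumes "n < p - 1" "rat_cong p m x y" "rat_padic_integer p y"
  shows "rat_cong p m (bernoulli_poly n x) (bernoulli_poly n y)"
  unfolding appell_def using assms
  by (intro rat_cong_sum rat_cong_mult_left rat_cong_power padic_intros padic_bernoulli) auto

lemma fermat_rat:
  assumes "\<not> p dvd k"
  shows "rat_cong p 1 (of_nat k ^ (p - 1)) 1"
proof -
  have "[int k ^ (p - 1) = int 1] (mod int p)"
    using fermat_theorem[OF prime assms] by (metis cong_int_iff of_nat_power)
  then have "rat_cong p 1 (of_int (int k ^ (p - 1))) (of_int 1)"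
    by (simp only: rat_cong_of_int_iff) simp
  then show ?thesis by simp
qed

lemma inverse_power_cong:
  assumes "\<not> p dvd k" "a \<le> p - 1"
  shows "rat_cong p 1 (1 / of_nat k ^ a) (of_nat k ^ (p - 1 - a))"
proof -
  have k: "k \<noteq> 0" using assms(1) by (metis dvd_0_right)
  have "rat_cong p 1 ((1 / of_nat k ^ a) * of_nat k ^ (p - 1)) ((1 / of_nat k ^ a) * 1)"
    using assms by (intro rat_cong_mult_left fermat_rat padic_intros)
  moreover have "(1 / of_nat k ^ a) * of_nat k ^ (p - 1) = (of_nat k ^ (p - 1 - a) :: rat)"
    using power_diff[of "of_nat k :: rat" a "p - 1"] assms(2) k by simp
  ultimately show ?thesis using rat_cong_sym by simp
qed

text \<open>For \<open>e < p - 1\<close> Faulhaber's formula shows it, since every term contains a power of \<open>p\<close> and the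
Bernoulli numbers involved are \<open>p\<close>-integral. Larger exponents are reduced by Fermat's theorem.\<close>

lemma power_sum_cong_0:
  assumes "0 < e" "e < 2 * (p - 1)" "e \<noteq> p - 1"
  shows "rat_cong p 1 (\<Sum>k<p. of_nat k ^ e) 0"
proof -
  have small: "rat_cong p 1 (\<Sum>k<p. of_nat k ^ e) 0" if e: "0 < e" "e < p - 1" for e
  proof -
    have "of_nat (Suc e) * (\<Sum>k<p. of_nat k ^ e) = bernoulli_poly (Suc e) (of_nat p) - bernoulli_num (Suc e)"
      by (rule sum_power_eq_bernoulli_poly)
    also have "\<dots> = (\<Sum>i\<le>e. of_nat (Suc e choose i) * bernoulli_num i * of_nat p ^ (Suc e - i))"
      unfolding appell_def by simp
    also have "rat_cong p 1 \<dots> (\<Sum>i\<le>e. of_nat (Suc e choose i) * bernoulli_num i * 0)"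
    proof (intro rat_cong_sum rat_cong_mult_left)
      fix i assume "i \<in> {..e}"
      then show "rat_padic_integer p (of_nat (Suc e choose i) * bernoulli_num i)"
        using e by (intro padic_intros padic_bernoulli) auto
      show "rat_cong p 1 (of_nat p ^ (Suc e - i)) 0"
        using rat_cong_p_power_mult[OF padic_1, of 1 "Suc e - i"] \<open>i \<in> {..e}\<close> by simp
    qed
    finally have "rat_cong p 1 (of_nat (Suc e) * (\<Sum>k<p. of_nat k ^ e)) (of_nat (Suc e) * 0)"
      by (simp only: mult_zero_right sum.neutral_const)
    then show ?thesis by (rule rat_cong_cancel_of_nat) (use e in \<open>intro not_dvd_less, auto\<close>)
  qed
  show ?thesis
  proof (cases "e < p - 1")
    case True
    then show ?thesis using assms small by simp
  next
    case False
    define e' where "e' = e - (p - 1)"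
    have e': "0 < e'" "e' < p - 1" "e = e' + (p - 1)" using assms False by (auto simp: e'_def)
    have "rat_cong p 1 (\<Sum>k<p. of_nat k ^ e) (\<Sum>k<p. of_nat k ^ e')"
    proof (rule rat_cong_sum)
      fix k assume "k \<in> {..<p}"
      show "rat_cong p 1 (of_nat k ^ e) (of_nat k ^ e')"
      proof (cases "k = 0")
        case True
        then show ?thesis using e'(1) assms(1) by (simp add: zero_power)
      next
        case False
        then have "rat_cong p 1 (of_nat k ^ e' * of_nat k ^ (p - 1)) (of_nat k ^ e' * 1)"
          using \<open>k \<in> {..<p}\<close> by (intro rat_cong_mult_left fermat_rat padic_intros not_dvd_less) auto
        then show ?thesis unfolding e'(3) by (simp add: power_add)
      qed
    qed
    then show ?thesis using small[OF e'(1,2)] rat_cong_trans by blast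
  qed
qed

lemma power_sum_p_minus_1_cong: "rat_cong p 1 (\<Sum>k<p. of_nat k ^ (p - 1)) (- 1)"
proof -
  have "rat_cong p 1 (\<Sum>k<p. of_nat k ^ (p - 1)) (\<Sum>k<p. if k = 0 then 0 else 1)"
  proof (rule rat_cong_sum)
    fix k assume k: "k \<in> {..<p}"
    show "rat_cong p 1 (of_nat k ^ (p - 1)) (if k = 0 then 0 else 1)"
    proof (cases "k = 0")
      case False
      then have "\<not> p dvd k" using k by (intro not_dvd_less) auto
      then show ?thesis using fermat_rat False by simp
    qed (use p_gt_1 in \<open>simp add: zero_power\<close>)
  qed
  also have "(\<Sum>k<p. if k = 0 then 0 else 1 :: rat) = of_nat p - 1"
  proof -
    have "{..<p} = insert 0 {1..<p}" using p_pos by auto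
    then show ?thesis using p_pos by (simp add: of_nat_diff)
  qed
  also have "rat_cong p 1 (of_nat p - 1) (- 1)" by (rule rat_congI[of _ _ _ 1]) (auto intro: padic_1)
  finally show ?thesis .
qed

lemma harmonic_cong_sum:
  assumes "n < p" "0 < a" "a < p - 1"
  shows "rat_cong p 1 (harmonic a n) (\<Sum>j<Suc n. of_nat j ^ (p - 1 - a))"
proof -
  have "{..<Suc n} = insert 0 {1..n}" by auto
  then have "(\<Sum>j<Suc n. of_nat j ^ (p - 1 - a) :: rat) = (\<Sum>j=1..n. of_nat j ^ (p - 1 - a))"
    using assms by (simp add: zero_power)
  moreover have "rat_cong p 1 (harmonic a n) (\<Sum>j=1..n. of_nat j ^ (p - 1 - a))"
    unfolding harmonic_def using assms by (intro rat_cong_sum inverse_power_cong not_dvd_less) auto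
  ultimately show ?thesis by simp
qed

lemma padic_harmonic: "n < p \<Longrightarrow> rat_padic_integer p (harmonic a n)"
  unfolding harmonic_def by (intro padic_intros not_dvd_less) auto

lemma harmonic_p_minus_1_cong_0:
  assumes "0 < a" "a < p - 1"
  shows "rat_cong p 1 (harmonic a (p - 1)) 0"
proof -
  have "rat_cong p 1 (harmonic a (p - 1)) (\<Sum>j<p. of_nat j ^ (p - 1 - a))"
    using harmonic_cong_sum[of "p - 1" a] assms p_pos by simp
  also have "rat_cong p 1 \<dots> 0" using assms by (intro power_sum_cong_0) auto
  finally show ?thesis .
qed

text \<open>Expanding the Bernoulli polynomial in powers of \<open>k\<close> gives power sums with exponents from \<open>p - 2\<close>
to \<open>2 * p - 4\<close>. Among these only the exponent \<open>p - 1\<close> contributes, which selects the Bernoulli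
polynomial of index \<open>p - 3\<close> at \<open>c\<close> with coefficient \<open>- (p - 2)\<close>. The constant term of the
polynomial is subtracted because that difference is what Faulhaber's formula produces.\<close>

lemma sum_power_mult_bernoulli_poly_cong:
  assumes c: "rat_padic_integer p c"
  shows "rat_cong p 1 (\<Sum>k<p. of_nat k ^ (p - 2) * (bernoulli_poly (p - 2) (of_nat k + c) - bernoulli_num (p - 2)))
    (2 * bernoulli_poly (p - 3) c)"
proof -
  let ?b = "\<lambda>i. of_nat ((p - 2) choose i) * bernoulli_poly i c"
  have pb: "rat_padic_integer p (?b i)" if "i \<le> p - 2" for i
    using that c p_ge_5 by (intro padic_intros padic_bernoulli_poly) auto
  have "(\<Sum>k<p. of_nat k ^ (p - 2) * bernoulli_poly (p - 2) (of_nat k + c)) =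
    (\<Sum>k<p. \<Sum>i\<le>p - 2. ?b i * of_nat k ^ (p - 2 + (p - 2 - i)))"
    unfolding appell_add appell_def[of "\<lambda>k. bernoulli_poly k c"] sum_distrib_left power_add
    by (intro sum.cong refl) (simp only: mult_ac)
  also have "\<dots> = (\<Sum>i\<le>p - 2. ?b i * (\<Sum>k<p. of_nat k ^ (p - 2 + (p - 2 - i))))"
    by (subst sum.swap) (simp only: sum_distrib_left)
  also have "rat_cong p 1 \<dots> (\<Sum>i\<le>p - 2. ?b i * (if i = p - 3 then - 1 else 0))"
  proof (intro rat_cong_sum rat_cong_mult_left pb)
    fix i assume i: "i \<in> {..p - 2}"
    show "rat_cong p 1 (\<Sum>k<p. of_nat k ^ (p - 2 + (p - 2 - i))) (if i = p - 3 then - 1 else 0)"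
    proof (cases "i = p - 3")
      case True
      then have "p - 2 + (p - 2 - i) = p - 1" using p_ge_5 by simp
      then show ?thesis using power_sum_p_minus_1_cong True by simp
    next
      case False
      then have "p - 2 + (p - 2 - i) \<noteq> p - 1" using p_ge_5 i by auto
      then have "rat_cong p 1 (\<Sum>k<p. of_nat k ^ (p - 2 + (p - 2 - i))) 0"
        using p_ge_5 i by (intro power_sum_cong_0) auto
      then show ?thesis using False by (simp only: if_False)
    qed
  qed auto
  also have "(\<Sum>i\<le>p - 2. ?b i * (if i = p - 3 then - 1 else 0)) = - ?b (p - 3)"
    using p_ge_5 by (simp add: if_distrib[of "\<lambda>y. _ * y"] cong: if_cong)
  also have "- ?b (p - 3) = - (of_nat (p - 2) * bernoulli_poly (p - 3) c)"
  proof -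
    have "(p - 2) choose (p - 3) = p - 2"
      using binomial_symmetric[of 1 "p - 2"] p_ge_5 by (simp add: numeral_3_eq_3 numeral_2_eq_2)
    then show ?thesis by (simp only:)
  qed
  also have "rat_cong p 1 (- (of_nat (p - 2) * bernoulli_poly (p - 3) c)) (2 * bernoulli_poly (p - 3) c)"
    using p_ge_5 c
    by (intro rat_congI[of _ _ _ "- bernoulli_poly (p - 3) c"] padic_uminus padic_bernoulli_poly)
       (auto simp: of_nat_diff algebra_simps)
  finally have 1: "rat_cong p 1 (\<Sum>k<p. of_nat k ^ (p - 2) * bernoulli_poly (p - 2) (of_nat k + c)) (2 * bernoulli_poly (p - 3) c)" .
  have "rat_cong p 1 (bernoulli_num (p - 2) * (\<Sum>k<p. of_nat k ^ (p - 2))) (bernoulli_num (p - 2) * 0)"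
    using p_ge_5 by (intro rat_cong_mult_left power_sum_cong_0 padic_bernoulli) auto
  from rat_cong_diff[OF 1 this] show ?thesis
    by (simp add: right_diff_distrib sum_subtractf sum_distrib_left mult.commute)
qed

lemma sum_shift_cong:
  assumes "\<And>k. rat_cong p m (f (k + p)) (f k)"
  shows "rat_cong p m (\<Sum>k<p. f (k + c)) (\<Sum>k<p. f k)"
proof (induction c)
  case (Suc c)
  have "(\<Sum>k<p. f (k + Suc c)) = (\<Sum>k<p. f (Suc k + c))" by simp
  also have "\<dots> = (\<Sum>k<Suc p. f (k + c)) - f c"
    using sum.lessThan_Suc_shift[of "\<lambda>k. f (k + c)" p] by (simp del: sum.lessThan_Suc)
  also have "\<dots> = (\<Sum>k<p. f (k + c)) + (f (p + c) - f c)" by simp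
  also have "rat_cong p m \<dots> ((\<Sum>k<p. f k) + (f c - f c))"
    using assms[of c] by (intro rat_cong_add rat_cong_diff Suc.IH rat_cong_refl) (simp add: add.commute)
  finally show ?case by simp
qed simp

end

section \<open>Harmonic sums and Bernoulli numbers\<close>

lemma poly_Apery_of_int: "of_int (poly (Apery_poly k) x) = poly (Apery_poly k) (of_int x :: rat)"
  by (simp add: Apery_poly_def poly_sum poly_monom)

text \<open>For \<open>j < n\<close> this is, up to the sign \<open>(-1) ^ j\<close>, the product of \<open>1 - n ^ 2 / i ^ 2\<close> over \<open>1 \<le> i \<le> j\<close>.\<close>

definition choose_pair :: "nat \<Rightarrow> nat \<Rightarrow> rat" where
  "choose_pair n j = of_nat (((n - 1) choose j) * ((n + j) choose j))"

lemma choose_pair_0: "choose_pair n 0 = 1"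
  by (simp add: choose_pair_def)

lemma choose_pair_Suc:
  assumes "j < n"
  shows "choose_pair n (Suc j) = - (1 - of_nat n ^ 2 / of_nat (Suc j) ^ 2) * choose_pair n j"
proof -
  have 1: "of_nat (Suc j) * of_nat ((n - 1) choose Suc j) = (of_nat n - 1 - of_nat j) * (of_nat ((n - 1) choose j) :: rat)"
  proof -
    have "Suc j * ((n - 1) choose Suc j) = (n - 1 - j) * ((n - 1) choose j)"
      unfolding binomial_absorption binomial_absorb_comp ..
    from arg_cong[OF this, of "of_nat :: nat \<Rightarrow> rat"] show ?thesis
      using assms by (simp only: of_nat_mult) (simp add: of_nat_diff)
  qed
  have 2: "of_nat (Suc j) * of_nat ((n + Suc j) choose Suc j) = (of_nat n + 1 + of_nat j) * (of_nat ((n + j) choose j) :: rat)"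
  proof -
    have "Suc j * ((n + Suc j) choose Suc j) = (n + Suc j) * ((n + j) choose j)"
      using Suc_times_binomial[of j "n + j"] by simp
    from arg_cong[OF this, of "of_nat :: nat \<Rightarrow> rat"] show ?thesis
      by (simp only: of_nat_mult) (simp add: algebra_simps)
  qed
  have "of_nat (Suc j) ^ 2 * choose_pair n (Suc j) =
      (of_nat (Suc j) * of_nat ((n - 1) choose Suc j)) * (of_nat (Suc j) * of_nat ((n + Suc j) choose Suc j))"
    unfolding choose_pair_def by (simp only: of_nat_mult power2_eq_square mult_ac)
  also have "\<dots> = ((of_nat n - 1 - of_nat j) * (of_nat n + 1 + of_nat j)) * choose_pair n j"
    unfolding 1 2 choose_pair_def by (simp only: of_nat_mult mult_ac)
  also have "(of_nat n - 1 - of_nat j) * (of_nat n + 1 + of_nat j) = (of_nat n ^ 2 - of_nat (Suc j) ^ 2 :: rat)"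
    by (simp add: power2_eq_square algebra_simps)
  finally have "choose_pair n (Suc j) = (of_nat n ^ 2 - of_nat (Suc j) ^ 2) * choose_pair n j / of_nat (Suc j) ^ 2"
    by (simp add: eq_divide_eq mult.commute del: of_nat_Suc)
  also have "\<dots> = - (1 - of_nat n ^ 2 / of_nat (Suc j) ^ 2) * choose_pair n j"
    by (simp add: field_simps del: of_nat_Suc)
  finally show ?thesis .
qed

lemma sum_odd_poly_Apery_eq:
  assumes "n \<ge> 1"
  shows "(\<Sum>k<n. of_nat (2 * k + 1) * poly (Apery_poly k) x) =
    of_nat n ^ 2 * (\<Sum>j<n. x ^ j * choose_pair n j ^ 2 / of_nat (2 * j + 1))"
proof -
  let ?c = "\<lambda>k. of_nat (((n - 1) choose k) * ((n + k) choose k) * ((n + k) choose (2 * k + 1)) * ((2 * k) choose k)) :: rat"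
  have c: "?c j = of_nat n * choose_pair n j ^ 2 / of_nat (2 * j + 1)" for j
  proof -
    have "of_nat (2 * j + 1) * ?c j = choose_pair n j * of_int ((2 * int j + 1) * (int ((n + j) choose (2 * j + 1)) * int ((2 * j) choose j)))"
      unfolding choose_pair_def by simp
    also have "\<dots> = choose_pair n j * (of_nat n * choose_pair n j)"
      unfolding odd_mult_choose_central[OF assms] by (simp add: choose_pair_def)
    finally show ?thesis by (simp add: eq_divide_eq power2_eq_square mult_ac del: of_nat_add of_nat_mult)
  qed
  have "(\<Sum>k<n. of_nat (2 * k + 1) * poly (Apery_poly k) x) = poly (\<Sum>k<n. smult (of_nat (2 * k + 1)) (Apery_poly k)) x"
    by (simp add: poly_sum)
  also have "(\<Sum>k<n. smult (of_nat (2 * k + 1)) (Apery_poly k)) = smult (of_nat n) (\<Sum>k<n. monom (?c k) k)"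
    unfolding sum_odd_Apery_poly[OF assms, symmetric] using assms by simp
  also have "poly \<dots> x = of_nat n * (\<Sum>k<n. ?c k * x ^ k)"
    by (simp only: poly_smult poly_sum poly_monom)
  also have "\<dots> = of_nat n ^ 2 * (\<Sum>j<n. x ^ j * choose_pair n j ^ 2 / of_nat (2 * j + 1))"
    unfolding c sum_distrib_left by (rule sum.cong) (simp_all add: power2_eq_square del: of_nat_add of_nat_mult)
  finally show ?thesis .
qed

text \<open>Induction on \<open>n\<close>: Pascal's rule leaves the increment \<open>1 / (n + 1)\<close>, because
\<open>(n choose k) / (k + 1) = (n + 1 choose k + 1) / (n + 1)\<close> and alternating sums of binomial
coefficients vanish.\<close>

lemma sum_alternating_choose_div:
  "(\<Sum>k<n. (- 1) ^ k * of_nat (n choose Suc k) / of_nat (Suc k)) = harmonic 1 n"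
proof (induction n)
  case (Suc n)
  have "(\<Sum>k<Suc n. (- 1) ^ k * of_nat (n choose k) / of_nat (Suc k)) = (1 / of_nat (Suc n) :: rat)"
  proof -
    have "(\<Sum>k<Suc n. (- 1) ^ k * of_nat (n choose k) / of_nat (Suc k)) =
        (\<Sum>k<Suc n. (- 1) ^ k * (of_nat (Suc n choose Suc k) / of_nat (Suc n)) :: rat)"
    proof (rule sum.cong)
      fix k
      have "of_nat (Suc k) * of_nat (Suc n choose Suc k) = (of_nat (Suc n) * of_nat (n choose k) :: rat)"
        using arg_cong[OF Suc_times_binomial[of k n], of "of_nat :: nat \<Rightarrow> rat"] by (simp only: of_nat_mult)
      then have "of_nat (n choose k) / of_nat (Suc k) = (of_nat (Suc n choose Suc k) / of_nat (Suc n) :: rat)"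
        by (simp add: frac_eq_eq mult.commute del: of_nat_Suc binomial_Suc_Suc)
      then show "(- 1) ^ k * of_nat (n choose k) / of_nat (Suc k) = (- 1) ^ k * (of_nat (Suc n choose Suc k) / of_nat (Suc n) :: rat)"
        by (simp only: times_divide_eq_right[symmetric])
    qed simp
    also have "\<dots> = (\<Sum>k\<le>n. (- 1) ^ k * of_nat (Suc n choose Suc k)) / of_nat (Suc n)"
      by (simp only: lessThan_Suc_atMost sum_divide_distrib times_divide_eq_right)
    also have "(\<Sum>k\<le>n. (- 1) ^ k * of_nat (Suc n choose Suc k)) = (1 :: rat)"
    proof -
      have "(\<Sum>i\<le>Suc n. (- 1) ^ i * of_nat (Suc n choose i)) = (0 :: rat)"
        by (rule choose_alternating_sum) simp
      then have "1 - (\<Sum>k\<le>n. (- 1) ^ k * of_nat (Suc n choose Suc k)) = (0 :: rat)"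
        unfolding sum.atMost_Suc_shift by (simp add: sum_negf del: binomial_Suc_Suc)
      then show ?thesis by simp
    qed
    finally show ?thesis .
  qed
  moreover have "(\<Sum>k<Suc n. (- 1) ^ k * of_nat (n choose Suc k) / of_nat (Suc k)) = harmonic 1 n"
    using Suc by (simp add: binomial_eq_0)
  ultimately show ?case unfolding harmonic_Suc
    by (simp add: sum.distrib distrib_left add_divide_distrib del: sum.lessThan_Suc of_nat_Suc)
qed simp

text \<open>Summation by parts. It relates the two double harmonic sums in which the square sits on the outer
and on the inner index.\<close>

lemma harmonic_product:
  "(\<Sum>k<n. harmonic 1 k / of_nat (Suc k) ^ 2 + harmonic 2 k / of_nat (Suc k) + 1 / of_nat (Suc k) ^ 3) =
    harmonic 1 n * harmonic 2 n"
  by (induction n) (simp_all add: harmonic_Suc power2_eq_square power3_eq_cube algebra_simps del: of_nat_Suc)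

text \<open>The first two terms of the expansion of \<open>1 / (q - 2 * x) ^ 2\<close> in powers of \<open>q\<close>, with exact
remainder.\<close>

lemma inverse_square_expansion:
  fixes q x :: rat
  assumes "x \<noteq> 0" "q - 2 * x \<noteq> 0"
  shows "4 / (q - 2 * x) ^ 2 = 1 / x ^ 2 + q * (1 / x ^ 3) + q ^ 2 * ((3 * x - q) / x ^ 3 / (q - 2 * x) ^ 2)"
proof -
  define y where "y = q - 2 * x"
  have num: "4 * x ^ 3 = x * y ^ 2 + q * y ^ 2 + q ^ 2 * (3 * x - q)"
    by (simp add: y_def algebra_simps power2_eq_square power3_eq_cube)
  have "4 / y ^ 2 = (4 * x ^ 3) / (x ^ 3 * y ^ 2)" using assms(1) by simp
  also have "\<dots> = 1 / x ^ 2 + q * (1 / x ^ 3) + q ^ 2 * ((3 * x - q) / x ^ 3 / y ^ 2)"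
    unfolding num using assms by (simp add: add_divide_distrib y_def[symmetric] power2_eq_square power3_eq_cube)
  finally show ?thesis unfolding y_def .
qed

lemma harmonic_eq_sum_lessThan: "harmonic a n = (\<Sum>k<n. 1 / of_nat (Suc k) ^ a)"
  by (induction n) (simp_all add: harmonic_Suc del: of_nat_Suc)

context prime_gt_3
begin

lemma padic_B: "rat_padic_integer p (bernoulli_num (p - 3))"
  using p_ge_5 by (intro padic_bernoulli) simp

lemma rat_cong_p_minus:
  assumes "rat_padic_integer p x" "a \<le> p"
  shows "rat_cong p 1 (of_nat (p - a) * x) (- (of_nat a * x))"
  using assms by (intro rat_congI[of _ _ _ x]) (simp_all add: of_nat_diff algebra_simps)

lemma harmonic_2_cong:
  assumes "n < p"
  shows "rat_cong p 1 (of_nat (p - 2) * harmonic 2 n) (bernoulli_poly (p - 2) (of_nat n + 1) - bernoulli_num (p - 2))"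
proof -
  have e: "p - 1 - 2 = p - 3" "Suc (p - 3) = p - 2" using p_ge_5 by auto
  have "rat_cong p 1 (of_nat (p - 2) * harmonic 2 n) (of_nat (p - 2) * (\<Sum>j<Suc n. of_nat j ^ (p - 3)))"
    using harmonic_cong_sum[OF assms, of 2] p_ge_5 unfolding e by (intro rat_cong_mult_left padic_of_nat) auto
  also have "of_nat (p - 2) * (\<Sum>j<Suc n. of_nat j ^ (p - 3)) = bernoulli_poly (p - 2) (of_nat (Suc n)) - bernoulli_num (p - 2)"
    using sum_power_eq_bernoulli_poly[of "p - 3" "Suc n"] unfolding e .
  finally show ?thesis by (simp add: add.commute)
qed

text \<open>By Fermat's theorem and Faulhaber's formula the inner sum is a Bernoulli polynomial and the outer
reciprocal is a power, so the sum over the residues modulo \<open>p\<close> applies with \<open>c = 0\<close>.\<close>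

lemma sum_harmonic_2_div_cong:
  "rat_cong p 1 (\<Sum>k<p - 1. harmonic 2 k / of_nat (Suc k)) (- bernoulli_num (p - 3))"
proof -
  let ?X = "\<Sum>k<p - 1. harmonic 2 k / of_nat (Suc k)"
  let ?b = "\<lambda>x. bernoulli_poly (p - 2) x - bernoulli_num (p - 2)"
  have X: "rat_padic_integer p ?X"
    by (intro padic_sum padic_divide_of_nat padic_harmonic not_dvd_less) auto
  have "of_nat (p - 2) * ?X = (\<Sum>k<p - 1. (of_nat (p - 2) * harmonic 2 k) * (1 / of_nat (Suc k) ^ 1))"
    by (simp add: sum_distrib_left)
  also have "rat_cong p 1 \<dots> (\<Sum>k<p - 1. ?b (of_nat k + 1) * of_nat (Suc k) ^ (p - 1 - 1))"
  proof (rule rat_cong_sum)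
    fix k assume "k \<in> {..<p - 1}"
    then have k: "k < p" "\<not> p dvd Suc k" using not_dvd_less[of "Suc k"] by auto
    then show "rat_cong p 1 ((of_nat (p - 2) * harmonic 2 k) * (1 / of_nat (Suc k) ^ 1)) (?b (of_nat k + 1) * of_nat (Suc k) ^ (p - 1 - 1))"
      using p_ge_5
      by (intro rat_cong_mult harmonic_2_cong inverse_power_cong padic_diff padic_bernoulli_poly padic_bernoulli
          padic_add padic_of_nat padic_1 padic_power) auto
  qed
  also have "(\<Sum>k<p - 1. ?b (of_nat k + 1) * of_nat (Suc k) ^ (p - 1 - 1)) = (\<Sum>k<p. of_nat k ^ (p - 2) * ?b (of_nat k + 0))"
  proof -
    have "(\<Sum>k<Suc (p - 1). of_nat k ^ (p - 2) * ?b (of_nat k + 0)) = (\<Sum>k<p - 1. of_nat (Suc k) ^ (p - 2) * ?b (of_nat (Suc k) + 0))"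
      using p_ge_5 by (subst sum.lessThan_Suc_shift) (simp add: zero_power)
    moreover have "Suc (p - 1) = p" "p - 1 - 1 = p - 2" using p_ge_5 by auto
    ultimately show ?thesis by (simp add: mult.commute add.commute)
  qed
  also have "rat_cong p 1 \<dots> (2 * bernoulli_poly (p - 3) 0)"
    by (rule sum_power_mult_bernoulli_poly_cong[OF padic_0])
  also have "2 * bernoulli_poly (p - 3) 0 = 2 * bernoulli_num (p - 3)" by (simp only: appell_at_0)
  finally have "rat_cong p 1 (of_nat (p - 2) * ?X) (2 * bernoulli_num (p - 3))" .
  from rat_cong_trans[OF rat_cong_sym[OF rat_cong_p_minus[OF X]] this]
  have "rat_cong p 1 (- (of_nat 2 * ?X)) (2 * bernoulli_num (p - 3))" using p_ge_5 by simp
  from rat_cong_uminus[OF this] have "rat_cong p 1 (of_nat 2 * ?X) (of_nat 2 * (- bernoulli_num (p - 3)))" by simp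
  then show ?thesis by (rule rat_cong_cancel_of_nat[OF _ not_dvd_2])
qed

lemma sum_harmonic_1_div_square_cong:
  "rat_cong p 1 (\<Sum>k<p - 1. harmonic 1 k / of_nat (Suc k) ^ 2) (bernoulli_num (p - 3))"
proof -
  let ?S = "\<Sum>k<p - 1. harmonic 1 k / of_nat (Suc k) ^ 2"
  let ?X = "\<Sum>k<p - 1. harmonic 2 k / of_nat (Suc k)"
  have "?S = harmonic 1 (p - 1) * harmonic 2 (p - 1) - ?X - harmonic 3 (p - 1)"
    unfolding harmonic_product[symmetric] harmonic_eq_sum_lessThan[of 3] sum.distrib by simp
  also have "rat_cong p 1 \<dots> (0 * 0 - (- bernoulli_num (p - 3)) - 0)"
    using p_ge_5
    by (intro rat_cong_diff rat_cong_mult sum_harmonic_2_div_cong harmonic_p_minus_1_cong_0 padic_0) auto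
  finally show ?thesis by simp
qed

lemma of_nat_p_minus: "j \<le> p \<Longrightarrow> of_nat (p - j) = (of_nat p - of_nat j :: rat)"
  by (simp add: of_nat_diff)

text \<open>Pairing \<open>j\<close> with \<open>p - j\<close> gives
\<open>1 / j + 1 / (p - j) = - p / j ^ 2 + p ^ 2 / (j ^ 2 * (p - j))\<close>, and the last terms sum to a
multiple of \<open>p\<close> because they are \<open>- 1 / j ^ 3\<close> modulo \<open>p\<close>.\<close>

lemma harmonic_1_cong: "rat_cong p 3 (2 * harmonic 1 (p - 1)) (- (of_nat p * harmonic 2 (p - 1)))"
proof -
  let ?q = "of_nat p :: rat"
  let ?z = "\<Sum>j=1..p - 1. 1 / (of_nat j ^ 2 * of_nat (p - j)) :: rat"
  have refl: "harmonic 1 (p - 1) = (\<Sum>j=1..p - 1. 1 / of_nat (p - j))"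
    unfolding harmonic_def
    by (rule sum.reindex_bij_witness[of _ "\<lambda>j. p - j" "\<lambda>j. p - j"]) auto
  have "2 * harmonic 1 (p - 1) = (\<Sum>j=1..p - 1. 1 / of_nat j + 1 / of_nat (p - j))"
    unfolding sum.distrib refl[symmetric] by (simp add: harmonic_def)
  also have "\<dots> = (\<Sum>j=1..p - 1. - (?q * (1 / of_nat j ^ 2)) + ?q ^ 2 * (1 / (of_nat j ^ 2 * of_nat (p - j))))"
  proof (rule sum.cong)
    fix j assume "j \<in> {1..p - 1}"
    then have "of_nat j \<noteq> (0 :: rat)" "of_nat (p - j) \<noteq> (0 :: rat)" "of_nat (p - j) = (?q - of_nat j :: rat)"
      by (auto simp: of_nat_p_minus)
    then show "1 / of_nat j + 1 / of_nat (p - j) = - (?q * (1 / of_nat j ^ 2)) + ?q ^ 2 * (1 / (of_nat j ^ 2 * of_nat (p - j)))"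
      by (simp add: divide_simps) (simp add: algebra_simps power2_eq_square)
  qed simp
  also have "\<dots> = - (?q * harmonic 2 (p - 1)) + ?q ^ 2 * ?z"
    unfolding harmonic_def sum.distrib sum_distrib_left sum_negf ..
  also have "rat_cong p 3 \<dots> (- (?q * harmonic 2 (p - 1)) + ?q ^ 2 * 0)"
  proof (intro rat_cong_add rat_cong_refl rat_cong_mult_p_power)
    have "rat_cong p 1 ?z (\<Sum>j=1..p - 1. - (1 / of_nat j ^ 3))"
    proof (rule rat_cong_sum)
      fix j assume "j \<in> {1..p - 1}"
      then have j: "0 < j" "j < p" by auto
      show "rat_cong p 1 (1 / (of_nat j ^ 2 * of_nat (p - j))) (- (1 / of_nat j ^ 3))"
      proof (rule rat_congI)
        have "of_nat j \<noteq> (0 :: rat)" "of_nat (p - j) \<noteq> (0 :: rat)" "of_nat (p - j) = (?q - of_nat j :: rat)"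
          using j by (auto simp: of_nat_p_minus)
        then show "1 / (of_nat j ^ 2 * of_nat (p - j)) = - (1 / of_nat j ^ 3) + ?q ^ 1 * (1 / of_nat j ^ 3 / of_nat (p - j))"
          by (simp add: divide_simps) (simp add: algebra_simps power2_eq_square power3_eq_cube)
        show "rat_padic_integer p (1 / of_nat j ^ 3 / of_nat (p - j))"
          using j by (intro padic_divide_of_nat_power padic_divide_of_nat padic_1 not_dvd_less) auto
      qed
    qed
    also have "(\<Sum>j=1..p - 1. - (1 / of_nat j ^ 3)) = - harmonic 3 (p - 1)"
      unfolding harmonic_def sum_negf ..
    also have "rat_cong p 1 \<dots> (- 0)"
      using p_ge_5 by (intro rat_cong_uminus harmonic_p_minus_1_cong_0) auto
    finally show "rat_cong p 1 ?z 0" by simp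
  qed simp
  finally show ?thesis by simp
qed

lemma choose_p_minus_1_prod:
  "k \<le> p - 1 \<Longrightarrow> (- 1) ^ k * of_nat ((p - 1) choose k) = (\<Prod>j<k. 1 - of_nat p / of_nat (Suc j) :: rat)"
proof (induction k)
  case (Suc k)
  have "Suc k * ((p - 1) choose Suc k) = (p - 1 - k) * ((p - 1) choose k)"
    unfolding binomial_absorption binomial_absorb_comp ..
  from arg_cong[OF this, of "of_nat :: nat \<Rightarrow> rat"]
  have "of_nat (Suc k) * of_nat ((p - 1) choose Suc k) = (of_nat p - of_nat (Suc k)) * (of_nat ((p - 1) choose k) :: rat)"
    using Suc.prems by (simp only: of_nat_mult) (simp add: of_nat_diff)
  then have "of_nat ((p - 1) choose Suc k) = (of_nat p - of_nat (Suc k)) * (of_nat ((p - 1) choose k) :: rat) / of_nat (Suc k)"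
    by (simp add: eq_divide_eq mult.commute del: of_nat_Suc)
  also have "\<dots> = - (1 - of_nat p / of_nat (Suc k)) * of_nat ((p - 1) choose k)"
    by (simp add: field_simps del: of_nat_Suc)
  finally have step: "of_nat ((p - 1) choose Suc k) = - (1 - of_nat p / of_nat (Suc k)) * (of_nat ((p - 1) choose k) :: rat)" .
  have "(- 1) ^ Suc k * of_nat ((p - 1) choose Suc k) =
      ((- 1) ^ k * of_nat ((p - 1) choose k)) * (1 - of_nat p / of_nat (Suc k) :: rat)"
    unfolding step by (simp add: mult_ac del: of_nat_Suc minus_diff_eq)
  then show ?case using Suc by simp
qed simp

text \<open>A second relation between the same harmonic sums, independent of the pairing \<open>j \<mapsto> p - j\<close>. Inserting
\<open>(p - 1 choose k) = (-1) ^ k * M k\<close> with \<open>M k\<close> the product of \<open>1 - p / i\<close> over \<open>1 \<le> i \<le> k\<close> into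
the binomial formula for harmonic numbers, and using that the sum of \<open>M k / (k + 1)\<close>
telescopes to zero, yields exactly \<open>p\<close> times the sum of \<open>M k / (k + 1) ^ 2\<close>.\<close>

lemma harmonic_1_cong':
  "rat_cong p 3 (harmonic 1 (p - 1))
    (of_nat p * harmonic 2 (p - 1) - of_nat p ^ 2 * (\<Sum>k<p - 1. harmonic 1 k / of_nat (Suc k) ^ 2))"
proof -
  let ?q = "of_nat p :: rat"
  define M where "M = (\<lambda>k. \<Prod>j<k. 1 - ?q / of_nat (Suc j))"
  have M_Suc: "M (Suc k) = M k - ?q * (M k / of_nat (Suc k))" for k
    by (simp add: M_def algebra_simps)
  have M_choose: "M k = (- 1) ^ k * of_nat ((p - 1) choose k)" if "k \<le> p - 1" for k
    unfolding M_def using choose_p_minus_1_prod[OF that] by simp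
  have M_cong: "rat_cong p 2 (M k) (1 - ?q * harmonic 1 k)" if "k < p" for k
    using that
  proof (induction k)
    case 0
    then show ?case by (simp add: M_def)
  next
    case (Suc k)
    have nd: "\<not> p dvd Suc k" using Suc.prems by (intro not_dvd_less) auto
    have "rat_cong p 1 (M k) 1"
    proof -
      have "rat_cong p 1 (M k) (1 - ?q * harmonic 1 k)" using rat_cong_weaken[OF Suc.IH] Suc.prems by simp
      also have "rat_cong p 1 (1 - ?q * harmonic 1 k) 1"
        using Suc.prems by (intro rat_congI[of _ _ _ "- harmonic 1 k"] padic_uminus padic_harmonic) auto
      finally show ?thesis .
    qed
    then have "rat_cong p 1 (M k * (1 / of_nat (Suc k))) (1 * (1 / of_nat (Suc k)))"
      using nd by (intro rat_cong_mult_right padic_divide_of_nat padic_1)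
    from rat_cong_mult_p_power[OF this, of 2 1]
    have "rat_cong p 2 (?q * (M k / of_nat (Suc k))) (?q * (1 / of_nat (Suc k)))" by simp
    from rat_cong_diff[OF Suc.IH this] Suc.prems
    have "rat_cong p 2 (M (Suc k)) (1 - ?q * harmonic 1 k - ?q * (1 / of_nat (Suc k)))"
      unfolding M_Suc by simp
    then show ?case unfolding harmonic_Suc by (simp add: algebra_simps del: of_nat_Suc)
  qed
  have tel: "?q * (\<Sum>k<n. M k / of_nat (Suc k)) = 1 - M n" for n
    by (induction n) (simp_all add: M_Suc distrib_left del: of_nat_Suc, simp add: M_def)
  have "even (p - 1)" using odd_p by simp
  \<comment> \<open>Telescoping uses \<open>M (p - 1) = 1\<close>, which holds because \<open>p - 1\<close> is even.\<close>
  then have "?q * (\<Sum>k<p - 1. M k / of_nat (Suc k)) = 0"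
    unfolding tel using M_choose[of "p - 1"] by simp
  then have zero: "(\<Sum>k<p - 1. M k / of_nat (Suc k)) = 0" by simp
  have "harmonic 1 (p - 1) = (\<Sum>k<p - 1. - (M (Suc k) / of_nat (Suc k)))"
    unfolding sum_alternating_choose_div[symmetric]
    by (rule sum.cong) (auto simp: M_choose simp del: of_nat_Suc)
  also have "\<dots> = (\<Sum>k<p - 1. - (M k / of_nat (Suc k)) + ?q * (M k / of_nat (Suc k) ^ 2))"
    unfolding M_Suc by (rule sum.cong) (simp_all add: diff_divide_distrib power2_eq_square del: of_nat_Suc)
  also have "\<dots> = ?q ^ 1 * (\<Sum>k<p - 1. M k / of_nat (Suc k) ^ 2)"
    unfolding sum.distrib sum_negf zero by (simp add: sum_distrib_left)
  also have "rat_cong p 3 \<dots> (?q ^ 1 * (\<Sum>k<p - 1. (1 - ?q * harmonic 1 k) * (1 / of_nat (Suc k) ^ 2)))"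
  proof (rule rat_cong_mult_p_power[of 2])
    have "rat_cong p 2 (\<Sum>k<p - 1. M k * (1 / of_nat (Suc k) ^ 2)) (\<Sum>k<p - 1. (1 - ?q * harmonic 1 k) * (1 / of_nat (Suc k) ^ 2))"
      by (intro rat_cong_sum rat_cong_mult_right M_cong padic_divide_of_nat_power padic_1 not_dvd_less) auto
    then show "rat_cong p 2 (\<Sum>k<p - 1. M k / of_nat (Suc k) ^ 2) (\<Sum>k<p - 1. (1 - ?q * harmonic 1 k) * (1 / of_nat (Suc k) ^ 2))"
      by simp
  qed simp
  also have "?q ^ 1 * (\<Sum>k<p - 1. (1 - ?q * harmonic 1 k) * (1 / of_nat (Suc k) ^ 2)) =
      ?q * harmonic 2 (p - 1) - ?q ^ 2 * (\<Sum>k<p - 1. harmonic 1 k / of_nat (Suc k) ^ 2)"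
    unfolding harmonic_eq_sum_lessThan[of 2]
    by (simp add: left_diff_distrib right_diff_distrib sum_subtractf sum_distrib_left power2_eq_square mult.assoc diff_divide_distrib del: of_nat_Suc)
  finally show ?thesis .
qed

text \<open>Eliminating the harmonic number from the two preceding relations expresses the sum of inverse
squares modulo \<open>p ^ 2\<close> by a double sum that is needed only modulo \<open>p\<close>.\<close>

lemma harmonic_2_p_minus_1_cong:
  "rat_cong p 2 (3 * harmonic 2 (p - 1)) (2 * of_nat p * bernoulli_num (p - 3))"
proof -
  let ?q = "of_nat p :: rat"
  let ?S = "\<Sum>k<p - 1. harmonic 1 k / of_nat (Suc k) ^ 2"
  have "rat_cong p 3 (2 * harmonic 1 (p - 1)) (2 * (?q * harmonic 2 (p - 1) - ?q ^ 2 * ?S))"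
    by (rule rat_cong_mult_left[OF padic_numeral harmonic_1_cong'])
  from rat_cong_diff[OF this harmonic_1_cong]
  have "rat_cong p 3 0 (2 * (?q * harmonic 2 (p - 1) - ?q ^ 2 * ?S) + ?q * harmonic 2 (p - 1))"
    by simp
  from rat_cong_add[OF this rat_cong_refl[of 3 "2 * (?q ^ 2 * ?S)"]]
  have "rat_cong p 3 (?q ^ 1 * (?q ^ 1 * (2 * ?S))) (?q ^ 1 * (3 * harmonic 2 (p - 1)))"
    by (simp add: algebra_simps power2_eq_square del: of_nat_Suc)
  from rat_cong_sym[OF rat_cong_cancel_p_power[OF this, of 2]]
  have "rat_cong p 2 (3 * harmonic 2 (p - 1)) (?q ^ 1 * (2 * ?S))" by simp
  also have "rat_cong p 2 (?q ^ 1 * (2 * ?S)) (?q ^ 1 * (2 * bernoulli_num (p - 3)))"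
    by (intro rat_cong_mult_p_power[of 1] rat_cong_mult_left padic_numeral sum_harmonic_1_div_square_cong) simp
  finally show ?thesis by (simp add: mult_ac)
qed

lemma h_plus_half: "of_nat h = (- 1 / 2 :: rat) + of_nat p ^ 1 * (1 / 2)"
  by (simp add: p_eq field_simps)

text \<open>\<open>2 / 2 ^ (p - 3) = 8 / 2 ^ (p - 1)\<close> is \<open>8\<close> modulo \<open>p\<close>.\<close>

lemma bernoulli_poly_half_cong: "rat_cong p 1 (bernoulli_poly (p - 3) (1 / 2)) (7 * bernoulli_num (p - 3))"
proof -
  have "2 / 2 ^ (p - 3) = (8 * (1 / of_nat 2 ^ (p - 1)) :: rat)"
  proof -
    have "p - 1 = Suc (Suc (p - 3))" using p_ge_5 by simp
    then show ?thesis by simp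
  qed
  also have "rat_cong p 1 \<dots> (8 * of_nat 2 ^ (p - 1 - (p - 1)))"
    using not_dvd_2 by (intro rat_cong_mult_left padic_numeral inverse_power_cong) auto
  finally have "rat_cong p 1 ((2 / 2 ^ (p - 3) - 1) * bernoulli_num (p - 3)) ((8 - 1) * bernoulli_num (p - 3))"
    by (intro rat_cong_mult_right padic_B rat_cong_diff) auto
  then show ?thesis unfolding bernoulli_poly_half by simp
qed

lemma harmonic_3_half_cong: "rat_cong p 1 (harmonic 3 h) (- (2 * bernoulli_num (p - 3)))"
proof -
  let ?B = "bernoulli_num (p - 3)"
  have e: "p - 1 - 3 = p - 4" "Suc (p - 4) = p - 3" using p_ge_5 by auto
  have h: "h < p" using p_eq by simp
  have "rat_cong p 1 (of_nat (p - 3) * harmonic 3 h) (of_nat (p - 3) * (\<Sum>j<Suc h. of_nat j ^ (p - 4)))"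
    using harmonic_cong_sum[OF h, of 3] p_ge_5 unfolding e by (intro rat_cong_mult_left padic_of_nat) auto
  also have "of_nat (p - 3) * (\<Sum>j<Suc h. of_nat j ^ (p - 4)) = bernoulli_poly (p - 3) (of_nat (Suc h)) - ?B"
    using sum_power_eq_bernoulli_poly[of "p - 4" "Suc h"] unfolding e .
  also have "rat_cong p 1 \<dots> (bernoulli_poly (p - 3) (1 / 2) - ?B)"
  proof (intro rat_cong_diff rat_cong_refl bernoulli_poly_cong)
    show "rat_cong p 1 (of_nat (Suc h)) (1 / 2)"
      by (rule rat_congI[OF _ padic_half]) (use h_plus_half in simp)
  qed (use p_ge_5 padic_half in auto)
  also have "rat_cong p 1 (bernoulli_poly (p - 3) (1 / 2) - ?B) (7 * ?B - ?B)"
    by (intro rat_cong_diff rat_cong_refl bernoulli_poly_half_cong)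
  finally have "rat_cong p 1 (of_nat (p - 3) * harmonic 3 h) (6 * ?B)" by simp
  moreover have "rat_cong p 1 (of_nat (p - 3) * harmonic 3 h) (- (of_nat 3 * harmonic 3 h))"
    using h p_ge_5 by (intro rat_cong_p_minus padic_harmonic) auto
  ultimately have "rat_cong p 1 (- (of_nat 3 * harmonic 3 h)) (6 * ?B)"
    using rat_cong_sym rat_cong_trans by blast
  from rat_cong_uminus[OF this] have "rat_cong p 1 (of_nat 3 * harmonic 3 h) (of_nat 3 * (- (2 * ?B)))" by simp
  then show ?thesis by (rule rat_cong_cancel_of_nat[OF _ not_dvd_3])
qed

lemma sum_even_odd_split:
  "(\<Sum>j=1..p - 1. f j) = (\<Sum>i=1..h. f (2 * i) + f (p - 2 * i))" for f :: "nat \<Rightarrow> rat"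
proof -
  have "{1..p - 1} = (\<lambda>i. 2 * i) ` {1..h} \<union> (\<lambda>i. p - 2 * i) ` {1..h}" (is "_ = ?A \<union> ?B")
  proof (intro equalityI subsetI)
    fix j assume j: "j \<in> {1..p - 1}"
    show "j \<in> ?A \<union> ?B"
    proof (cases "even j")
      case True
      then obtain i where "j = 2 * i" by blast
      with j p_eq show ?thesis by auto
    next
      case False
      then obtain i where "j = 2 * i + 1" by (elim oddE)
      with j p_eq have "j = p - 2 * (h - i)" "h - i \<in> {1..h}" by auto
      then show ?thesis by blast
    qed
  qed (use p_eq in auto)
  moreover have "?A \<inter> ?B = {}"
  proof -
    have "2 * i \<noteq> p - 2 * i'" if "i' \<in> {1..h}" for i i' using that p_eq by simp presburger
    then show ?thesis by blast
  qed
  moreover have "inj_on (\<lambda>i. 2 * i) {1..h}" "inj_on (\<lambda>i. p - 2 * i) {1..h}"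
    using p_eq by (auto simp: inj_on_def)
  ultimately show ?thesis by (simp add: sum.union_disjoint sum.reindex sum.distrib)
qed

lemma p_minus_even:
  assumes "i \<in> {1..h}"
  shows "of_nat (p - 2 * i) = (of_nat p - 2 * of_nat i :: rat)" "\<not> p dvd i" "\<not> p dvd (p - 2 * i)"
    "\<not> p dvd p + 2 * i" "of_nat i \<noteq> (0 :: rat)" "of_nat p - 2 * of_nat i \<noteq> (0 :: rat)"
    "of_nat p + 2 * of_nat i \<noteq> (0 :: rat)"
proof -
  have i: "0 < i" "2 * i < p" using assms p_eq by auto
  show 1: "of_nat (p - 2 * i) = (of_nat p - 2 * of_nat i :: rat)" using i by (simp add: of_nat_diff)
  show "\<not> p dvd i" "\<not> p dvd (p - 2 * i)" using i by (intro not_dvd_less; simp)+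
  show "\<not> p dvd p + 2 * i" using i not_dvd_less[of "2 * i"] by simp
  show "of_nat i \<noteq> (0 :: rat)" using i by simp
  have "of_nat (p - 2 * i) \<noteq> (0 :: rat)" using i by simp
  then show "of_nat p - 2 * of_nat i \<noteq> (0 :: rat)" unfolding 1 .
  have "of_nat (p + 2 * i) \<noteq> (0 :: rat)" unfolding of_nat_eq_0_iff by simp
  then show "of_nat p + 2 * of_nat i \<noteq> (0 :: rat)" by simp
qed

text \<open>Splitting \<open>1, ..., p - 1\<close> into the numbers \<open>2 * i\<close> and \<open>p - 2 * i\<close> gives
\<open>4 * harmonic 2 (p - 1) \<equiv> 2 * harmonic 2 h + p * harmonic 3 h\<close> modulo \<open>p ^ 2\<close>, and the other two
sums are known. Numerically, \<open>3 * (2 * x) \<equiv> 8 + 6 = 14\<close> in units of \<open>p * B (p - 3)\<close>.\<close>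

lemma harmonic_2_half_cong: "rat_cong p 2 (3 * harmonic 2 h) (7 * of_nat p * bernoulli_num (p - 3))"
proof -
  let ?q = "of_nat p :: rat" and ?B = "bernoulli_num (p - 3)"
  have "4 * harmonic 2 (p - 1) = (\<Sum>i=1..h. 1 / of_nat i ^ 2 + 4 / of_nat (p - 2 * i) ^ 2)"
    unfolding harmonic_def sum_even_odd_split sum_distrib_left
    by (rule sum.cong) (simp_all add: distrib_left power_mult_distrib)
  also have "rat_cong p 2 \<dots> (\<Sum>i=1..h. 1 / of_nat i ^ 2 + (1 / of_nat i ^ 2 + ?q * (1 / of_nat i ^ 3)))"
  proof (intro rat_cong_sum rat_cong_add rat_cong_refl)
    fix i assume i: "i \<in> {1..h}"
    note pm = p_minus_even[OF i]
    show "rat_cong p 2 (4 / of_nat (p - 2 * i) ^ 2) (1 / of_nat i ^ 2 + ?q * (1 / of_nat i ^ 3))"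
    proof (rule rat_congI)
      show "4 / of_nat (p - 2 * i) ^ 2 = 1 / of_nat i ^ 2 + ?q * (1 / of_nat i ^ 3) +
          ?q ^ 2 * ((3 * of_nat i - ?q) / of_nat i ^ 3 / of_nat (p - 2 * i) ^ 2)"
        unfolding pm(1) using inverse_square_expansion[OF pm(5,6)] .
      show "rat_padic_integer p ((3 * of_nat i - ?q) / of_nat i ^ 3 / of_nat (p - 2 * i) ^ 2)"
        by (intro padic_divide_of_nat_power padic_diff padic_mult padic_numeral padic_of_nat pm)
    qed
  qed
  also have "(\<Sum>i=1..h. 1 / of_nat i ^ 2 + (1 / of_nat i ^ 2 + ?q * (1 / of_nat i ^ 3))) = 2 * harmonic 2 h + ?q ^ 1 * harmonic 3 h"
    unfolding harmonic_def sum.distrib sum_distrib_left[symmetric] by simp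
  finally have "rat_cong p 2 (4 * harmonic 2 (p - 1)) (2 * harmonic 2 h + ?q ^ 1 * harmonic 3 h)" .
  also have "rat_cong p 2 (2 * harmonic 2 h + ?q ^ 1 * harmonic 3 h) (2 * harmonic 2 h + ?q ^ 1 * (- (2 * ?B)))"
    by (intro rat_cong_add rat_cong_refl rat_cong_mult_p_power[of 1] harmonic_3_half_cong) simp
  finally have 1: "rat_cong p 2 (3 * (4 * harmonic 2 (p - 1))) (3 * (2 * harmonic 2 h + ?q ^ 1 * (- (2 * ?B))))"
    by (rule rat_cong_mult_left[OF padic_numeral])
  have 2: "rat_cong p 2 (4 * (3 * harmonic 2 (p - 1))) (4 * (2 * ?q * ?B))"
    by (rule rat_cong_mult_left[OF padic_numeral harmonic_2_p_minus_1_cong])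
  have "3 * (4 * harmonic 2 (p - 1)) = 4 * (3 * harmonic 2 (p - 1))" by simp
  from rat_cong_trans[OF rat_cong_sym[OF 2] 1[unfolded this]]
  have "rat_cong p 2 (4 * (2 * ?q * ?B)) (3 * (2 * harmonic 2 h + ?q ^ 1 * (- (2 * ?B))))" .
  from rat_cong_sym[OF rat_cong_add[OF this rat_cong_refl[of 2 "6 * (?q * ?B)"]]]
  have "rat_cong p 2 (of_nat 2 * (3 * harmonic 2 h)) (of_nat 2 * (7 * ?q * ?B))"
    by (simp add: algebra_simps)
  then show ?thesis by (rule rat_cong_cancel_of_nat[OF _ not_dvd_2])
qed

end

section \<open>Sums of Apery polynomials at 1 and -1\<close>

context prime_gt_3
begin

lemma odd_index_not_dvd:
  assumes "k < p" "k \<noteq> h"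
  shows "\<not> p dvd 2 * k + 1"
proof
  assume "p dvd 2 * k + 1"
  then obtain c where c: "2 * k + 1 = p * c" by blast
  have "p * c < p * 2" unfolding c[symmetric] using assms(1) by simp
  then have "c < 2" by simp
  moreover have "c \<noteq> 0" using c by (intro notI) simp
  ultimately have "c = 1" by simp
  then show False using c p_eq assms(2) by simp
qed

lemma sum_split_middle:
  fixes f :: "nat \<Rightarrow> rat"
  shows "(\<Sum>k\<in>{..<p} - {h}. f k) = (\<Sum>i=1..h. f (h + i) + f (h - i))"
proof -
  have union: "{..<p} - {h} = (\<lambda>i. h + i) ` {1..h} \<union> (\<lambda>i. h - i) ` {1..h}" (is "_ = ?A \<union> ?B")
  proof (intro equalityI subsetI)
    fix k assume k: "k \<in> {..<p} - {h}"
    show "k \<in> ?A \<union> ?B"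
    proof (cases "k < h")
      case True
      then have "k = h - (h - k)" "h - k \<in> {1..h}" by auto
      then show ?thesis by blast
    next
      case False
      then have "k = h + (k - h)" "k - h \<in> {1..h}" using k p_eq by auto
      then show ?thesis by blast
    qed
  qed (use p_eq in auto)
  have "(\<Sum>k\<in>{..<p} - {h}. f k) = sum f ?A + sum f ?B"
    unfolding union by (rule sum.union_disjoint) auto
  also have "sum f ?A = (\<Sum>i=1..h. f (h + i))" by (subst sum.reindex) (simp_all add: inj_on_def)
  also have "sum f ?B = (\<Sum>i=1..h. f (h - i))" by (subst sum.reindex) (auto simp: inj_on_def)
  finally show ?thesis by (simp only: sum.distrib)
qed

lemma odd_index_shift:
  assumes "i \<in> {1..h}"
  shows "of_nat (2 * (h + i) + 1) = (of_nat (p + 2 * i) :: rat)" "of_nat (2 * (h - i) + 1) = (of_nat (p - 2 * i) :: rat)"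
proof -
  have "2 * (h + i) + 1 = p + 2 * i" "2 * (h - i) + 1 = p - 2 * i" using assms p_eq by auto
  then show "of_nat (2 * (h + i) + 1) = (of_nat (p + 2 * i) :: rat)"
    "of_nat (2 * (h - i) + 1) = (of_nat (p - 2 * i) :: rat)" by simp_all
qed

text \<open>The indices \<open>h + i\<close> and \<open>h - i\<close> have \<open>2 * k + 1 = p + 2 * i\<close> and \<open>p - 2 * i\<close>, so their reciprocals
nearly cancel.\<close>

lemma odd_reciprocal_pair_cong:
  assumes i: "i \<in> {1..h}"
  shows "rat_cong p 3 (2 * (1 / of_nat (p + 2 * i) + 1 / of_nat (p - 2 * i))) (- (of_nat p * (1 / of_nat i ^ 2)))"
proof (rule rat_congI)
  note pm = p_minus_even[OF i]
  let ?q = "of_nat p :: rat" and ?x = "of_nat i :: rat"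
  have pos: "?q + 2 * ?x \<noteq> 0" by (rule pm(7))
  show "2 * (1 / of_nat (p + 2 * i) + 1 / of_nat (p - 2 * i)) =
      - (of_nat p * (1 / of_nat i ^ 2)) + of_nat p ^ 3 * (1 / ?x ^ 2 / of_nat (p + 2 * i) / of_nat (p - 2 * i))"
    unfolding pm(1) using pm(5,6) pos
    by (simp add: divide_simps) (simp add: algebra_simps power2_eq_square power3_eq_cube)
  show "rat_padic_integer p (1 / ?x ^ 2 / of_nat (p + 2 * i) / of_nat (p - 2 * i))"
    by (intro padic_divide_of_nat padic_divide_of_nat_power padic_1 pm)
qed

lemma sum_odd_reciprocal_cong:
  "rat_cong p 3 (2 * (\<Sum>k\<in>{..<p} - {h}. 1 / of_nat (2 * k + 1))) (- (of_nat p * harmonic 2 h))"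
proof -
  have "2 * (\<Sum>k\<in>{..<p} - {h}. 1 / of_nat (2 * k + 1) :: rat) =
      (\<Sum>i=1..h. 2 * (1 / of_nat (p + 2 * i) + 1 / of_nat (p - 2 * i)))"
    unfolding sum_split_middle sum_distrib_left by (intro sum.cong refl) (simp only: odd_index_shift)
  also have "rat_cong p 3 \<dots> (\<Sum>i=1..h. - (of_nat p * (1 / of_nat i ^ 2)))"
    by (intro rat_cong_sum odd_reciprocal_pair_cong)
  also have "(\<Sum>i=1..h. - (of_nat p * (1 / of_nat i ^ 2))) = - (of_nat p * harmonic 2 h)"
    unfolding harmonic_def sum_negf sum_distrib_left ..
  finally show ?thesis .
qed

text \<open>Replacing reciprocals by powers makes the excluded middle index harmless, because its power is
divisible by \<open>p\<close>. The summand then becomes a function \<open>G\<close> of \<open>k + (h + 1)\<close> with period \<open>p\<close> modulo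
\<open>p\<close>, in view of \<open>2 * (h + 1) \<equiv> 1\<close>; moving the range back to \<open>0, ..., p - 1\<close> leaves the power sum with
\<open>c = 1 / 2\<close>.\<close>

lemma sum_harmonic_2_div_odd_cong:
  "rat_cong p 1 (2 * (\<Sum>k\<in>{..<p} - {h}. harmonic 2 k / of_nat (2 * k + 1))) (- (7 * bernoulli_num (p - 3)))"
proof -
  let ?Q = "\<Sum>k\<in>{..<p} - {h}. harmonic 2 k / of_nat (2 * k + 1)"
  let ?b = "\<lambda>x. bernoulli_poly (p - 2) x - bernoulli_num (p - 2)"
  define G where "G = (\<lambda>k. (2 * of_nat k) ^ (p - 2) * ?b (of_nat k + 1 / 2))"
  have bp: "rat_padic_integer p (?b x)" if "rat_padic_integer p x" for x
    using that p_ge_5 by (intro padic_diff padic_bernoulli_poly padic_bernoulli) auto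
  have b_cong: "rat_cong p 1 (?b x) (?b y)" if "rat_cong p 1 x y" "rat_padic_integer p y" for x y
    using that p_ge_5 by (intro rat_cong_diff bernoulli_poly_cong rat_cong_refl) auto
  have G_cong: "rat_cong p 1 ((2 * of_nat k) ^ (p - 2) * ?b (of_nat k + 1 / 2)) (y ^ (p - 2) * ?b z)"
    if "rat_cong p 1 (2 * of_nat k) y" "rat_cong p 1 (of_nat k + 1 / 2) z" "rat_padic_integer p y" "rat_padic_integer p z" for k y z
    using that by (intro rat_cong_mult rat_cong_power b_cong bp padic_power)
  have Q: "rat_padic_integer p ?Q"
    by (intro padic_sum padic_divide_of_nat padic_harmonic odd_index_not_dvd) auto
  have h: "h < p" using p_eq by simp
  have "of_nat (p - 2) * ?Q = (\<Sum>k<p. if k = h then 0 else (1 / of_nat (2 * k + 1) ^ 1) * (of_nat (p - 2) * harmonic 2 k))"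
    unfolding sum_distrib_left
    by (rule sum.mono_neutral_cong_left) auto
  also have "rat_cong p 1 \<dots> (\<Sum>k<p. G (k + (h + 1)))"
  proof (rule rat_cong_sum)
    fix k assume "k \<in> {..<p}"
    then have k: "k < p" by simp
    have pb: "rat_padic_integer p (of_nat k + 1 :: rat)" "rat_padic_integer p (of_nat (2 * k + 1) :: rat)"
      by (intro padic_intros)+
    have "rat_cong p 1 (G (k + (h + 1))) (of_nat (2 * k + 1) ^ (p - 2) * ?b (of_nat k + 1))"
      unfolding G_def
    proof (rule G_cong[OF _ _ pb(2,1)])
      show "rat_cong p 1 (2 * of_nat (k + (h + 1))) (of_nat (2 * k + 1))"
        using h_plus_half by (intro rat_congI[OF _ padic_1]) simp
      show "rat_cong p 1 (of_nat (k + (h + 1)) + 1 / 2) (of_nat k + 1)"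
        using h_plus_half by (intro rat_congI[OF _ padic_half]) simp
    qed
    moreover have "rat_cong p 1 (if k = h then 0 else (1 / of_nat (2 * k + 1) ^ 1) * (of_nat (p - 2) * harmonic 2 k))
        (of_nat (2 * k + 1) ^ (p - 2) * ?b (of_nat k + 1))"
    proof (cases "k = h")
      case True
      have "rat_cong p 1 (of_nat p ^ (p - 2) * ?b (of_nat k + 1)) 0"
        using p_ge_5 by (intro rat_cong_p_power_mult bp pb) auto
      moreover have "2 * k + 1 = p" using True p_eq by simp
      ultimately have "rat_cong p 1 (of_nat (2 * k + 1) ^ (p - 2) * ?b (of_nat k + 1)) 0" by (simp only:)
      from rat_cong_sym[OF this] show ?thesis using True by (simp only: if_True simp_thms)
    next
      case False
      have "rat_cong p 1 ((1 / of_nat (2 * k + 1) ^ 1) * (of_nat (p - 2) * harmonic 2 k))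
          (of_nat (2 * k + 1) ^ (p - 1 - 1) * ?b (of_nat k + 1))"
        using p_ge_5 k False
        by (intro rat_cong_mult inverse_power_cong odd_index_not_dvd harmonic_2_cong padic_power bp pb) auto
      moreover have "p - 1 - 1 = p - 2" by simp
      ultimately show ?thesis using False by simp
    qed
    ultimately show "rat_cong p 1 (if k = h then 0 else (1 / of_nat (2 * k + 1) ^ 1) * (of_nat (p - 2) * harmonic 2 k)) (G (k + (h + 1)))"
      using rat_cong_sym rat_cong_trans by blast
  qed
  also have "rat_cong p 1 (\<Sum>k<p. G (k + (h + 1))) (\<Sum>k<p. G k)"
  proof (rule sum_shift_cong)
    fix k
    show "rat_cong p 1 (G (k + p)) (G k)"
      unfolding G_def
    proof (rule G_cong)
      show "rat_cong p 1 (2 * of_nat (k + p)) (2 * of_nat k)"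
        by (rule rat_congI[OF _ padic_numeral]) simp
      show "rat_cong p 1 (of_nat (k + p) + 1 / 2) (of_nat k + 1 / 2)"
        by (rule rat_congI[OF _ padic_1]) simp
    qed (intro padic_mult padic_numeral padic_of_nat padic_add padic_half)+
  qed
  also have "(\<Sum>k<p. G k) = 2 ^ (p - 2) * (\<Sum>k<p. of_nat k ^ (p - 2) * ?b (of_nat k + 1 / 2))"
    unfolding G_def sum_distrib_left by (simp only: power_mult_distrib mult.assoc)
  also have "rat_cong p 1 \<dots> (2 ^ (p - 2) * (2 * bernoulli_poly (p - 3) (1 / 2)))"
    by (intro rat_cong_mult_left sum_power_mult_bernoulli_poly_cong padic_half padic_power padic_numeral)
  also have "2 ^ (p - 2) * (2 * bernoulli_poly (p - 3) (1 / 2)) = of_nat 2 ^ (p - 1) * bernoulli_poly (p - 3) (1 / 2)"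
  proof -
    have "p - 1 = Suc (p - 2)" using p_ge_5 by simp
    then show ?thesis by simp
  qed
  also have "rat_cong p 1 \<dots> (1 * (7 * bernoulli_num (p - 3)))"
    using not_dvd_2 by (intro rat_cong_mult fermat_rat bernoulli_poly_half_cong padic_1 padic_mult padic_numeral padic_B)
  finally have "rat_cong p 1 (of_nat (p - 2) * ?Q) (7 * bernoulli_num (p - 3))" by simp
  from rat_cong_trans[OF rat_cong_sym[OF rat_cong_p_minus[OF Q]] this]
  have "rat_cong p 1 (- (of_nat 2 * ?Q)) (7 * bernoulli_num (p - 3))" using p_ge_5 by simp
  from rat_cong_uminus[OF this] show ?thesis by simp
qed

text \<open>The product of the factors \<open>(1 - p ^ 2 / i ^ 2) ^ 2\<close> to first order in \<open>p ^ 2\<close>.\<close>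

lemma choose_pair_square_cong:
  "k < p \<Longrightarrow> rat_cong p 4 (choose_pair p k ^ 2) (1 - 2 * of_nat p ^ 2 * harmonic 2 k)"
proof (induction k)
  case 0
  then show ?case by (simp add: choose_pair_0)
next
  case (Suc k)
  let ?q = "of_nat p :: rat" and ?r = "1 / of_nat (Suc k) ^ 2 :: rat"
  have nd: "\<not> p dvd Suc k" using Suc.prems by (intro not_dvd_less) auto
  have r: "rat_padic_integer p ?r" by (rule padic_divide_of_nat_power[OF padic_1 nd])
  have H: "rat_padic_integer p (harmonic 2 k)" using Suc.prems by (intro padic_harmonic) simp
  have "choose_pair p (Suc k) ^ 2 = (1 - ?q ^ 2 * ?r) ^ 2 * choose_pair p k ^ 2"
    using Suc.prems by (subst choose_pair_Suc) (simp_all add: power_mult_distrib power2_commute)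
  also have "rat_cong p 4 \<dots> ((1 - ?q ^ 2 * ?r) ^ 2 * (1 - 2 * ?q ^ 2 * harmonic 2 k))"
    using Suc by (intro rat_cong_mult_left padic_intros r) auto
  also have "rat_cong p 4 \<dots> (1 - 2 * ?q ^ 2 * (harmonic 2 k + ?r))"
  proof (rule rat_congI)
    show "(1 - ?q ^ 2 * ?r) ^ 2 * (1 - 2 * ?q ^ 2 * harmonic 2 k) = 1 - 2 * ?q ^ 2 * (harmonic 2 k + ?r) +
        ?q ^ 4 * (?r ^ 2 * (1 - 2 * ?q ^ 2 * harmonic 2 k) + 4 * (?r * harmonic 2 k))"
    proof -
      have "(1 - s ^ 2 * r) ^ 2 * (1 - 2 * s ^ 2 * t) = 1 - 2 * s ^ 2 * (t + r) +
        s ^ 4 * (r ^ 2 * (1 - 2 * s ^ 2 * t) + 4 * (r * t))" for s r t :: rat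
        by (simp add: algebra_simps power2_eq_square power4_eq_xxxx)
      then show ?thesis .
    qed
    show "rat_padic_integer p (?r ^ 2 * (1 - 2 * ?q ^ 2 * harmonic 2 k) + 4 * (?r * harmonic 2 k))"
      by (intro padic_add padic_mult padic_power padic_diff padic_1 padic_numeral padic_of_nat r H)
  qed
  finally show ?case unfolding harmonic_Suc .
qed

lemma sum_odd_Apery_split:
  assumes x: "x = of_int y"
  shows "rat_cong p 5 (\<Sum>k<p. of_nat (2 * k + 1) * poly (Apery_poly k) x)
    (of_nat p * (x ^ h * (1 - 2 * of_nat p ^ 2 * harmonic 2 h)) +
     of_nat p ^ 2 * (\<Sum>k\<in>{..<p} - {h}. x ^ k * (1 - 2 * of_nat p ^ 2 * harmonic 2 k) * (1 / of_nat (2 * k + 1))))"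
proof -
  let ?q = "of_nat p :: rat"
  have h: "h < p" using p_eq by simp
  have px: "rat_padic_integer p x" unfolding x by (rule padic_of_int)
  \<comment> \<open>The denominator at \<open>k = h\<close> is \<open>p\<close>; every other denominator is a unit.\<close>
  have middle: "(\<Sum>k<p. x ^ k * choose_pair p k ^ 2 / of_nat (2 * k + 1)) =
    x ^ h * choose_pair p h ^ 2 / ?q + (\<Sum>k\<in>{..<p} - {h}. x ^ k * choose_pair p k ^ 2 / of_nat (2 * k + 1))"
    using h by (subst sum.remove[of _ h]) (simp_all add: p_eq)
  have "(\<Sum>k<p. of_nat (2 * k + 1) * poly (Apery_poly k) x) =
    ?q ^ 2 * (\<Sum>k<p. x ^ k * choose_pair p k ^ 2 / of_nat (2 * k + 1))"
    using p_pos by (intro sum_odd_poly_Apery_eq) simp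
  also have "\<dots> = ?q ^ 1 * (x ^ h * choose_pair p h ^ 2) +
      ?q ^ 2 * (\<Sum>k\<in>{..<p} - {h}. x ^ k * choose_pair p k ^ 2 * (1 / of_nat (2 * k + 1)))"
    unfolding middle by (simp add: distrib_left power2_eq_square)
  also have "rat_cong p 5 \<dots> (?q ^ 1 * (x ^ h * (1 - 2 * ?q ^ 2 * harmonic 2 h)) +
     ?q ^ 2 * (\<Sum>k\<in>{..<p} - {h}. x ^ k * (1 - 2 * ?q ^ 2 * harmonic 2 k) * (1 / of_nat (2 * k + 1))))"
  proof (intro rat_cong_add)
    show "rat_cong p 5 (?q ^ 1 * (x ^ h * choose_pair p h ^ 2)) (?q ^ 1 * (x ^ h * (1 - 2 * ?q ^ 2 * harmonic 2 h)))"
      by (intro rat_cong_mult_p_power[of 4] rat_cong_mult_left padic_power px choose_pair_square_cong h) simp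
    have "rat_cong p 6 (?q ^ 2 * (\<Sum>k\<in>{..<p} - {h}. x ^ k * choose_pair p k ^ 2 * (1 / of_nat (2 * k + 1))))
       (?q ^ 2 * (\<Sum>k\<in>{..<p} - {h}. x ^ k * (1 - 2 * ?q ^ 2 * harmonic 2 k) * (1 / of_nat (2 * k + 1))))"
      by (intro rat_cong_mult_p_power[of 4] rat_cong_sum rat_cong_mult_right rat_cong_mult_left padic_power px choose_pair_square_cong
          padic_divide_of_nat padic_1 odd_index_not_dvd) auto
    then show "rat_cong p 5 (?q ^ 2 * (\<Sum>k\<in>{..<p} - {h}. x ^ k * choose_pair p k ^ 2 * (1 / of_nat (2 * k + 1))))
       (?q ^ 2 * (\<Sum>k\<in>{..<p} - {h}. x ^ k * (1 - 2 * ?q ^ 2 * harmonic 2 k) * (1 / of_nat (2 * k + 1))))"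
      by (rule rat_cong_weaken) simp
  qed
  finally show ?thesis by simp
qed

text \<open>With \<open>x = 1\<close> the contributions in units of \<open>p ^ 4 * B (p - 3)\<close> are \<open>- 14 / 3\<close> from the main term,
\<open>- 7 / 6\<close> from the sum of odd reciprocals and \<open>7\<close> from the double sum. The computation
is carried out after multiplication by \<open>6\<close>.\<close>

lemma sum_odd_Apery_num_cong:
  "rat_cong p 5
    (\<Sum>k<p. of_nat (2 * k + 1) * of_int (Apery_num k))
    (of_nat p + 7 / 6 * of_nat p ^ 4 * bernoulli_num (p - 3))"
proof -
  let ?q = "of_nat p :: rat" and ?B = "bernoulli_num (p - 3)"
  let ?O = "\<Sum>k\<in>{..<p} - {h}. 1 / of_nat (2 * k + 1) :: rat"
  let ?Q = "\<Sum>k\<in>{..<p} - {h}. harmonic 2 k / of_nat (2 * k + 1)"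
  let ?T = "\<Sum>k<p. of_nat (2 * k + 1) * poly (Apery_poly k) (1 :: rat)"
  have "rat_cong p 5 ?T
    (?q * (1 ^ h * (1 - 2 * ?q ^ 2 * harmonic 2 h)) +
     ?q ^ 2 * (\<Sum>k\<in>{..<p} - {h}. 1 ^ k * (1 - 2 * ?q ^ 2 * harmonic 2 k) * (1 / of_nat (2 * k + 1))))"
    by (rule sum_odd_Apery_split[of _ 1]) simp
  also have "?q * (1 ^ h * (1 - 2 * ?q ^ 2 * harmonic 2 h)) +
     ?q ^ 2 * (\<Sum>k\<in>{..<p} - {h}. 1 ^ k * (1 - 2 * ?q ^ 2 * harmonic 2 k) * (1 / of_nat (2 * k + 1))) =
     ?q - 2 * ?q ^ 3 * harmonic 2 h + ?q ^ 2 * ?O - 2 * ?q ^ 4 * ?Q"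
  proof -
    have sums: "(\<Sum>k\<in>{..<p} - {h}. 1 ^ k * (1 - 2 * ?q ^ 2 * harmonic 2 k) * (1 / of_nat (2 * k + 1))) = ?O - 2 * ?q ^ 2 * ?Q"
      by (simp add: diff_divide_distrib sum_subtractf sum_distrib_left mult.assoc del: of_nat_add of_nat_mult)
    show ?thesis unfolding sums by (simp add: algebra_simps power2_eq_square power3_eq_cube power4_eq_xxxx)
  qed
  finally have "rat_cong p 5 (6 * ?T) (6 * (?q - 2 * ?q ^ 3 * harmonic 2 h + ?q ^ 2 * ?O - 2 * ?q ^ 4 * ?Q))"
    by (rule rat_cong_mult_left[OF padic_numeral])
  also have "6 * (?q - 2 * ?q ^ 3 * harmonic 2 h + ?q ^ 2 * ?O - 2 * ?q ^ 4 * ?Q) =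
      6 * ?q - 12 * ?q ^ 3 * harmonic 2 h + 3 * (?q ^ 2 * (2 * ?O)) - 6 * (?q ^ 4 * (2 * ?Q))"
    by (simp add: algebra_simps del: of_nat_add of_nat_mult)
  also have "rat_cong p 5 \<dots> (6 * ?q - 12 * ?q ^ 3 * harmonic 2 h + 3 * (?q ^ 2 * (- (?q * harmonic 2 h))) - 6 * (?q ^ 4 * (- (7 * ?B))))"
    by (intro rat_cong_add rat_cong_diff rat_cong_refl rat_cong_mult_left[OF padic_numeral]
      rat_cong_mult_p_power[OF sum_odd_reciprocal_cong] rat_cong_mult_p_power[OF sum_harmonic_2_div_odd_cong]) auto
  also have "6 * ?q - 12 * ?q ^ 3 * harmonic 2 h + 3 * (?q ^ 2 * (- (?q * harmonic 2 h))) - 6 * (?q ^ 4 * (- (7 * ?B))) =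
      6 * ?q + 42 * ?q ^ 4 * ?B - 5 * (?q ^ 3 * (3 * harmonic 2 h))"
    by (simp add: algebra_simps power2_eq_square power3_eq_cube)
  also have "rat_cong p 5 \<dots> (6 * ?q + 42 * ?q ^ 4 * ?B - 5 * (?q ^ 3 * (7 * ?q * ?B)))"
    by (intro rat_cong_diff rat_cong_refl rat_cong_mult_left[OF padic_numeral]
      rat_cong_mult_p_power[OF harmonic_2_half_cong]) simp
  also have "6 * ?q + 42 * ?q ^ 4 * ?B - 5 * (?q ^ 3 * (7 * ?q * ?B)) = of_nat 6 * (?q + 7 / 6 * ?q ^ 4 * ?B)"
    by (simp add: algebra_simps power3_eq_cube power4_eq_xxxx)
  finally have "rat_cong p 5 (of_nat 6 * ?T) (of_nat 6 * (?q + 7 / 6 * ?q ^ 4 * ?B))" by simp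
  moreover have "\<not> p dvd 6"
    using not_dvd_2 not_dvd_3 prime_dvd_mult_iff[OF prime, of 2 3] by simp
  ultimately have "rat_cong p 5 ?T (?q + 7 / 6 * ?q ^ 4 * ?B)" by (rule rat_cong_cancel_of_nat)
  then show ?thesis by (simp add: Apery_num_def poly_Apery_of_int)
qed

text \<open>Euler's criterion gives congruence modulo \<open>p\<close>, and both sides are too small to be congruent without
being equal.\<close>

lemma Legendre_minus_1: "Legendre (- 1) (int p) = (- 1) ^ h"
proof -
  have "h = (p - 1) div 2" using p_eq by simp
  then have "[Legendre (- 1) (int p) = (- 1) ^ h] (mod int p)"
    using euler_criterion[OF prime p_gt_2, of "- 1"] by simp
  then have dvd: "int p dvd Legendre (- 1) (int p) - (- 1) ^ h" by (simp add: cong_iff_dvd_diff)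
  have "\<bar>Legendre (- 1) (int p)\<bar> \<le> 1" by (auto simp: Legendre_def)
  moreover have "\<bar>(- 1 :: int) ^ h\<bar> = 1" by simp
  ultimately have "\<bar>Legendre (- 1) (int p) - (- 1) ^ h\<bar> < int p" using p_gt_2 by linarith
  with dvd show ?thesis using zdvd_imp_le[of "int p" "\<bar>Legendre (- 1) (int p) - (- 1) ^ h\<bar>"] by fastforce
qed

lemma alternating_sum_odd_power_cong:
  "[(\<Sum>k<p. (- 1) ^ k * (2 * int k + 1) ^ m) = euler_num m] (mod int p)"
proof -
  have "2 * (\<Sum>k<p. (- 1) ^ k * (2 * int k + 1) ^ m) = euler_num m + appell euler_num m (2 * int p)"
    using alternating_sum_odd_power[where n = p and m = m] odd_p by simp
  moreover have "[appell euler_num m (2 * int p) = appell euler_num m 0] (mod int p)"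
    unfolding appell_def by (intro cong_sum cong_mult cong_refl cong_pow) (simp add: cong_0_iff)
  ultimately have "[2 * (\<Sum>k<p. (- 1) ^ k * (2 * int k + 1) ^ m) = 2 * euler_num m] (mod int p)"
    unfolding appell_at_0 by (simp add: cong_iff_dvd_diff)
  moreover have "coprime 2 (int p)"
    using coprime_int[of 2 1] p_gt_2 by simp
  ultimately show ?thesis by (simp add: cong_mult_lcancel)
qed

text \<open>Fermat's theorem turns \<open>(2 * k + 1) ^ (p - 3)\<close> into an inverse square, except at the middle index,
where it vanishes modulo \<open>p\<close>; then indices are paired around the middle.\<close>

lemma euler_num_cong:
  "rat_cong p 1 (2 * of_int (euler_num (p - 3))) (\<Sum>i=1..h. (- 1) ^ (h + i) / of_nat i ^ 2)"
proof -
  let ?q = "of_nat p :: rat"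
  have e: "p - 1 - 2 = p - 3" by simp
  have "rat_cong p 1 (of_int (\<Sum>k<p. (- 1) ^ k * (2 * int k + 1) ^ (p - 3))) (of_int (euler_num (p - 3)))"
    unfolding rat_cong_of_int_iff using alternating_sum_odd_power_cong by simp
  from rat_cong_sym[OF this]
  have "rat_cong p 1 (of_int (euler_num (p - 3))) (\<Sum>k<p. (- 1) ^ k * of_nat (2 * k + 1) ^ (p - 3))"
    by (simp add: add.commute)
  also have "rat_cong p 1 (\<Sum>k<p. (- 1) ^ k * of_nat (2 * k + 1) ^ (p - 3))
      (\<Sum>k<p. (- 1) ^ k * (if k = h then 0 else 1 / of_nat (2 * k + 1) ^ 2))"
  proof (intro rat_cong_sum rat_cong_mult_left)
    fix k assume "k \<in> {..<p}"
    show "rat_padic_integer p ((- 1) ^ k)" by (intro padic_power padic_uminus padic_1)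
    show "rat_cong p 1 (of_nat (2 * k + 1) ^ (p - 3)) (if k = h then 0 else 1 / of_nat (2 * k + 1) ^ 2)"
    proof (cases "k = h")
      case True
      then have "rat_cong p 1 (of_nat (2 * k + 1) ^ (p - 3) * 1) 0"
        using p_ge_5 unfolding True p_eq[symmetric] by (intro rat_cong_p_power_mult padic_1) auto
      then show ?thesis using True by simp
    next
      case False
      have "rat_cong p 1 (1 / of_nat (2 * k + 1) ^ 2) (of_nat (2 * k + 1) ^ (p - 1 - 2))"
        using False \<open>k \<in> {..<p}\<close> p_ge_5 by (intro inverse_power_cong odd_index_not_dvd) auto
      from rat_cong_sym[OF this] show ?thesis using False unfolding e by (simp only: if_False)
    qed
  qed
  also have "(\<Sum>k<p. (- 1) ^ k * (if k = h then 0 else 1 / of_nat (2 * k + 1) ^ 2)) =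
      (\<Sum>k\<in>{..<p} - {h}. (- 1) ^ k * (1 / of_nat (2 * k + 1) ^ 2) :: rat)"
    by (rule sum.mono_neutral_cong_right) auto
  finally have "rat_cong p 1 (4 * of_int (euler_num (p - 3))) (4 * (\<Sum>k\<in>{..<p} - {h}. (- 1) ^ k * (1 / of_nat (2 * k + 1) ^ 2)))"
    by (rule rat_cong_mult_left[OF padic_numeral])
  also have "4 * (\<Sum>k\<in>{..<p} - {h}. (- 1) ^ k * (1 / of_nat (2 * k + 1) ^ 2)) =
      (\<Sum>i=1..h. (- 1) ^ (h + i) * (4 / of_nat (p + 2 * i) ^ 2 + 4 / of_nat (p - 2 * i) ^ 2) :: rat)"
    unfolding sum_split_middle sum_distrib_left
  proof (rule sum.cong)
    fix i assume i: "i \<in> {1..h}"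
    have "(- 1 :: rat) ^ (h - i) = (- 1) ^ (h + i)" using i by (simp add: minus_one_power_iff)
    then show "4 * ((- 1) ^ (h + i) * (1 / of_nat (2 * (h + i) + 1) ^ 2) + (- 1) ^ (h - i) * (1 / of_nat (2 * (h - i) + 1) ^ 2)) =
      (- 1) ^ (h + i) * (4 / of_nat (p + 2 * i) ^ 2 + 4 / of_nat (p - 2 * i) ^ 2 :: rat)"
      unfolding odd_index_shift[OF i] by (simp add: algebra_simps)
  qed simp
  also have "rat_cong p 1 \<dots> (\<Sum>i=1..h. (- 1) ^ (h + i) * (1 / of_nat i ^ 2 + 1 / of_nat i ^ 2))"
  proof (intro rat_cong_sum rat_cong_mult_left rat_cong_add)
    fix i assume i: "i \<in> {1..h}"
    note pm = p_minus_even[OF i]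
    show "rat_padic_integer p ((- 1) ^ (h + i))" by (intro padic_power padic_uminus padic_1)
    have pos: "?q + 2 * of_nat i \<noteq> 0" by (rule pm(7))
    show "rat_cong p 1 (4 / of_nat (p + 2 * i) ^ 2) (1 / of_nat i ^ 2)"
    proof (rule rat_congI)
      show "4 / of_nat (p + 2 * i) ^ 2 = 1 / of_nat i ^ 2 + ?q ^ 1 * (- (?q + 4 * of_nat i) / of_nat i ^ 2 / of_nat (p + 2 * i) ^ 2)"
        using pm(5) pos by (simp add: divide_simps) (simp add: algebra_simps power2_eq_square)
      show "rat_padic_integer p (- (?q + 4 * of_nat i) / of_nat i ^ 2 / of_nat (p + 2 * i) ^ 2)"
        by (intro padic_divide_of_nat_power padic_uminus padic_add padic_mult padic_numeral padic_of_nat pm)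
    qed
    show "rat_cong p 1 (4 / of_nat (p - 2 * i) ^ 2) (1 / of_nat i ^ 2)"
    proof (rule rat_congI)
      show "4 / of_nat (p - 2 * i) ^ 2 = 1 / of_nat i ^ 2 + ?q ^ 1 * ((4 * of_nat i - ?q) / of_nat i ^ 2 / of_nat (p - 2 * i) ^ 2)"
        unfolding pm(1) using pm(5,6) by (simp add: divide_simps) (simp add: algebra_simps power2_eq_square)
      show "rat_padic_integer p ((4 * of_nat i - ?q) / of_nat i ^ 2 / of_nat (p - 2 * i) ^ 2)"
        by (intro padic_divide_of_nat_power padic_diff padic_mult padic_numeral padic_of_nat pm)
    qed
  qed
  also have "(\<Sum>i=1..h. (- 1) ^ (h + i) * (1 / of_nat i ^ 2 + 1 / of_nat i ^ 2)) = 2 * (\<Sum>i=1..h. (- 1) ^ (h + i) / of_nat i ^ 2 :: rat)"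
    unfolding sum_distrib_left by (rule sum.cong) simp_all
  finally have "rat_cong p 1 (of_nat 2 * (2 * of_int (euler_num (p - 3)))) (of_nat 2 * (\<Sum>i=1..h. (- 1) ^ (h + i) / of_nat i ^ 2))"
    by simp
  then show ?thesis by (rule rat_cong_cancel_of_nat[OF _ not_dvd_2])
qed

lemma alternating_sum_odd_reciprocal_cong:
  "rat_cong p 2 (\<Sum>k\<in>{..<p} - {h}. (- 1) ^ k * (1 / of_nat (2 * k + 1))) (- (of_nat p * of_int (euler_num (p - 3))))"
proof -
  let ?U = "\<Sum>i=1..h. (- 1) ^ (h + i) / of_nat i ^ 2 :: rat"
  have "2 * (\<Sum>k\<in>{..<p} - {h}. (- 1) ^ k * (1 / of_nat (2 * k + 1)) :: rat) =
      (\<Sum>i=1..h. (- 1) ^ (h + i) * (2 * (1 / of_nat (p + 2 * i) + 1 / of_nat (p - 2 * i))))"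
    unfolding sum_split_middle sum_distrib_left
  proof (rule sum.cong)
    fix i assume i: "i \<in> {1..h}"
    have "(- 1 :: rat) ^ (h - i) = (- 1) ^ (h + i)" using i by (simp add: minus_one_power_iff)
    then show "2 * ((- 1) ^ (h + i) * (1 / of_nat (2 * (h + i) + 1)) + (- 1) ^ (h - i) * (1 / of_nat (2 * (h - i) + 1))) =
      (- 1) ^ (h + i) * (2 * (1 / of_nat (p + 2 * i) + 1 / of_nat (p - 2 * i) :: rat))"
      unfolding odd_index_shift[OF i] by (simp add: algebra_simps)
  qed simp
  also have "rat_cong p 2 \<dots> (\<Sum>i=1..h. (- 1) ^ (h + i) * (- (of_nat p * (1 / of_nat i ^ 2))))"
    by (intro rat_cong_sum rat_cong_mult_left padic_power padic_uminus padic_1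
        rat_cong_weaken[OF odd_reciprocal_pair_cong]) auto
  also have "(\<Sum>i=1..h. (- 1) ^ (h + i) * (- (of_nat p * (1 / of_nat i ^ 2)))) = - (of_nat p ^ 1 * ?U)"
    unfolding sum_distrib_left sum_negf[symmetric] by (rule sum.cong) simp_all
  also have "rat_cong p 2 \<dots> (- (of_nat p ^ 1 * (2 * of_int (euler_num (p - 3)))))"
    by (intro rat_cong_uminus rat_cong_mult_p_power[OF rat_cong_sym[OF euler_num_cong]]) simp
  finally have "rat_cong p 2 (of_nat 2 * (\<Sum>k\<in>{..<p} - {h}. (- 1) ^ k * (1 / of_nat (2 * k + 1))))
      (of_nat 2 * (- (of_nat p * of_int (euler_num (p - 3)))))" by (simp add: mult.left_commute)
  then show ?thesis by (rule rat_cong_cancel_of_nat[OF _ not_dvd_2])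
qed

text \<open>The main term is \<open>(-1) ^ h * p\<close>, since its correction has the factor \<open>p ^ 3 * harmonic 2 h\<close> and
\<open>harmonic 2 h\<close> is divisible by \<open>p\<close>. In the other terms everything beyond the odd reciprocals is of order \<open>p ^ 4\<close>.\<close>

lemma sum_odd_Apery_minus_1_cong:
  "[(\<Sum>k<p. int (2 * k + 1) * poly (Apery_poly k) (-1))
    = Legendre (-1) (int p) * int p - int p ^ 3 * euler_num (p - 3)] (mod int p ^ 4)"
proof -
  let ?q = "of_nat p :: rat" and ?E = "of_int (euler_num (p - 3)) :: rat"
  let ?T = "\<Sum>k<p. of_nat (2 * k + 1) * poly (Apery_poly k) (- 1 :: rat)"
  let ?R = "\<Sum>k\<in>{..<p} - {h}. (- 1) ^ k * (1 / of_nat (2 * k + 1)) :: rat"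
  have sgn: "rat_padic_integer p ((- 1) ^ k)" for k by (intro padic_power padic_uminus padic_1)
  have h: "h < p" using p_eq by simp
  have "rat_cong p 5 ?T
    (?q * ((- 1) ^ h * (1 - 2 * ?q ^ 2 * harmonic 2 h)) +
     ?q ^ 2 * (\<Sum>k\<in>{..<p} - {h}. (- 1) ^ k * (1 - 2 * ?q ^ 2 * harmonic 2 k) * (1 / of_nat (2 * k + 1))))"
    by (rule sum_odd_Apery_split[of _ "- 1"]) simp
  then have "rat_cong p 4 ?T
    (?q * ((- 1) ^ h * (1 - 2 * ?q ^ 2 * harmonic 2 h)) +
     ?q ^ 2 * (\<Sum>k\<in>{..<p} - {h}. (- 1) ^ k * (1 - 2 * ?q ^ 2 * harmonic 2 k) * (1 / of_nat (2 * k + 1))))"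
    by (rule rat_cong_weaken) simp
  also have "rat_cong p 4 \<dots> (?q * (- 1) ^ h + ?q ^ 2 * (- (?q * ?E)))"
  proof (rule rat_cong_add)
    have "rat_cong p 1 (harmonic 2 h) 0"
    proof -
      have "rat_cong p 1 (3 * harmonic 2 h) (7 * ?q * bernoulli_num (p - 3))"
        using harmonic_2_half_cong by (rule rat_cong_weaken) simp
      also have "rat_cong p 1 (7 * ?q * bernoulli_num (p - 3)) 0"
        by (rule rat_congI[of _ _ _ "7 * bernoulli_num (p - 3)"]) (auto intro!: padic_mult padic_numeral padic_B)
      finally have "rat_cong p 1 (of_nat 3 * harmonic 2 h) (of_nat 3 * 0)" by simp
      then show ?thesis by (rule rat_cong_cancel_of_nat[OF _ not_dvd_3])
    qed
    then have "rat_cong p 4 (?q ^ 3 * (- (2 * (- 1) ^ h) * harmonic 2 h)) (?q ^ 3 * (- (2 * (- 1) ^ h) * 0))"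
      by (intro rat_cong_mult_p_power[of 1] rat_cong_mult_left padic_uminus padic_mult padic_numeral sgn) auto
    from rat_cong_add[OF rat_cong_refl[of 4 "?q * (- 1) ^ h"] this]
    show "rat_cong p 4 (?q * ((- 1) ^ h * (1 - 2 * ?q ^ 2 * harmonic 2 h))) (?q * (- 1) ^ h)"
      by (simp add: algebra_simps power2_eq_square power3_eq_cube)
    show "rat_cong p 4 (?q ^ 2 * (\<Sum>k\<in>{..<p} - {h}. (- 1) ^ k * (1 - 2 * ?q ^ 2 * harmonic 2 k) * (1 / of_nat (2 * k + 1))))
      (?q ^ 2 * (- (?q * ?E)))"
    proof (rule rat_cong_mult_p_power[of 2])
      have "rat_cong p 2 (\<Sum>k\<in>{..<p} - {h}. (- 1) ^ k * (1 - 2 * ?q ^ 2 * harmonic 2 k) * (1 / of_nat (2 * k + 1)))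
         (\<Sum>k\<in>{..<p} - {h}. (- 1) ^ k * 1 * (1 / of_nat (2 * k + 1)))"
      proof (intro rat_cong_sum rat_cong_mult_right rat_cong_mult_left sgn)
        fix k assume k: "k \<in> {..<p} - {h}"
        then show "rat_padic_integer p (1 / of_nat (2 * k + 1))"
          by (intro padic_divide_of_nat padic_1 odd_index_not_dvd) auto
        show "rat_cong p 2 (1 - 2 * ?q ^ 2 * harmonic 2 k) 1"
          using k by (intro rat_congI[of _ _ _ "- (2 * harmonic 2 k)"] padic_uminus padic_mult padic_numeral padic_harmonic) auto
      qed
      then have "rat_cong p 2 (\<Sum>k\<in>{..<p} - {h}. (- 1) ^ k * (1 - 2 * ?q ^ 2 * harmonic 2 k) * (1 / of_nat (2 * k + 1))) ?R"
        by simp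
      also note alternating_sum_odd_reciprocal_cong
      finally show "rat_cong p 2 (\<Sum>k\<in>{..<p} - {h}. (- 1) ^ k * (1 - 2 * ?q ^ 2 * harmonic 2 k) * (1 / of_nat (2 * k + 1))) (- (?q * ?E))" .
    qed simp
  qed
  finally have "rat_cong p 4 ?T (?q * (- 1) ^ h + ?q ^ 2 * (- (?q * ?E)))" .
  moreover have "?T = of_int (\<Sum>k<p. int (2 * k + 1) * poly (Apery_poly k) (- 1))"
    by (simp add: poly_Apery_of_int)
  moreover have "?q * (- 1) ^ h + ?q ^ 2 * (- (?q * ?E)) = of_int (Legendre (- 1) (int p) * int p - int p ^ 3 * euler_num (p - 3))"
    unfolding Legendre_minus_1 by (simp add: algebra_simps power2_eq_square power3_eq_cube)
  ultimately show ?thesis by (simp only: rat_cong_of_int_iff)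
qed

end

section \<open>The congruences for sums of Apery polynomials\<close>

lemma odd_primeI: "prime p \<Longrightarrow> odd p \<Longrightarrow> odd_prime p ((p - 1) div 2)"
  by unfold_locales auto

lemma prime_gt_3I:
  assumes "prime p" "p > 3"
  shows "prime_gt_3 p ((p - 1) div 2)"
proof -
  have "odd p" using assms prime_odd_nat[of p] by simp
  with assms show ?thesis by (intro prime_gt_3.intro odd_primeI prime_gt_3_axioms.intro)
qed

theorem theorem1p1:
  shows
    "(\<forall>p::nat. prime p \<and> odd p \<longrightarrow>
        rat_poly_cong p 2
          (\<Sum>k<p. smult ((-1) ^ k) (Apery_poly k))
          (\<Sum>k<p. smult ((-1) ^ k) (pcompose (W_poly k) [:0, -1:])) \<and>
        rat_poly_cong p 2
          (\<Sum>k<p. smult ((-1) ^ k) (pcompose (W_poly k) [:0, -1:]))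
          (\<Sum>k<p. monom (of_nat ((2 * k) choose k) ^ 3 / 16 ^ k) k) \<and>
        (\<forall>x\<in>carrier (Zp p). \<not> Zp_cong_mod p 1 x \<zero>\<^bsub>Zp p\<^esub> \<longrightarrow>
          Zp_cong_mod p 2
            (\<Oplus>\<^bsub>Zp p\<^esub>k\<in>{..<p}. ring_eval (Zp p) (Apery_poly k) x)
            (\<Oplus>\<^bsub>Zp p\<^esub>k\<in>{..<p}. ring_eval (Zp p) (W_poly k) x) \<and>
          Zp_cong_mod p 1
            (\<Oplus>\<^bsub>Zp p\<^esub>k\<in>{..<p}. ring_eval (Zp p) (Apery_poly k) x)
            ([Legendre (x 1) (int p)] \<cdot>\<^bsub>Zp p\<^esub>
              (\<Oplus>\<^bsub>Zp p\<^esub>k\<in>{..<p}. [multinomial4 k] \<cdot>\<^bsub>Zp p\<^esub>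
                 (inv\<^bsub>Zp p\<^esub> (([(256::nat)] \<cdot>\<^bsub>Zp p\<^esub> x) [^]\<^bsub>Zp p\<^esub> k))))))
   \<and>
     (\<forall>n::nat. n \<ge> 1 \<longrightarrow>
        smult (1 / of_nat n) (\<Sum>k<n. smult (of_nat (2 * k + 1)) (Apery_poly k)) =
        (\<Sum>k<n. monom (of_nat (((n - 1) choose k) * ((n + k) choose k)
                   * ((n + k) choose (2 * k + 1)) * ((2 * k) choose k)) :: rat) k))
   \<and>
     (\<forall>p::nat. prime p \<and> p > 3 \<longrightarrow>
        rat_cong p 5
          (\<Sum>k<p. of_nat (2 * k + 1) * of_int (Apery_num k))
          (of_nat p + 7 / 6 * of_nat p ^ 4 * bernoulli_num (p - 3)) \<and>
        [(\<Sum>k<p. int (2 * k + 1) * poly (Apery_poly k) (-1))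
          = Legendre (-1) (int p) * int p - int p ^ 3 * euler_num (p - 3)] (mod int p ^ 4))
   \<and>
     (\<forall>(\<epsilon>::int) (m::nat) (p::nat). \<epsilon> \<in> {1, -1} \<and> m \<ge> 1 \<and> prime p \<longrightarrow>
        [(\<Sum>k<p. int (2 * k + 1) * \<epsilon> ^ k * Apery_num k ^ m) = 0] (mod int p))"
proof (intro conjI allI impI ballI, goal_cases)
  case (1 p)
  then interpret odd_prime p "(p - 1) div 2" by (intro odd_primeI) auto
  show ?case by (rule alternating_sum_Apery_cong)
next
  case (2 p)
  then interpret odd_prime p "(p - 1) div 2" by (intro odd_primeI) auto
  show ?case by (rule alternating_sum_W_cong_central)
next
  case (3 p x)
  then interpret odd_prime p "(p - 1) div 2" by (intro odd_primeI) auto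
  show ?case by (rule Zp_sum_Apery_cong_W[OF 3(2)])
next
  case (4 p x)
  then interpret odd_prime p "(p - 1) div 2" by (intro odd_primeI) auto
  show ?case by (rule Zp_sum_Apery_cong_multinomial4[OF 4(2) Zp_residue_nonzero[OF 4(2,3)]])
next
  case (5 n)
  then show ?case by (rule sum_odd_Apery_poly)
next
  case (6 p)
  then interpret prime_gt_3 p "(p - 1) div 2" by (intro prime_gt_3I) auto
  show ?case by (rule sum_odd_Apery_num_cong)
next
  case (7 p)
  then interpret prime_gt_3 p "(p - 1) div 2" by (intro prime_gt_3I) auto
  show ?case by (rule sum_odd_Apery_minus_1_cong)
next
  case (8 \<epsilon> m p)
  then interpret prime_modulus p by (simp add: prime_modulus.intro)
  show ?case using 8 by (intro sum_odd_Apery_num_power_cong_0) auto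
qed

end
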